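(* Let $k\in\mathbb{N}$, let $\mathcal{R}$ be a finite set of real linear relations in the variables $e,p_1,\dots,p_N$, let $\mathcal{U}_{\mathcal{R}}$ be the associated universal $*$-vector space with generators $e,p_1,\dots,p_N$, and let $E^{\mathrm{proj}(k)}\subseteq M_k(\mathcal{U}_{\mathcal{R}})_h$ be the cone defined in the context. Suppose that there exists a $k$-AOU space $(\mathcal{V},\tilde{C},f)$ with abstract projections (in the $k$-AOU sense) $q_1,\dots,q_N$ such that $f,q_1,\dots,q_N$ satisfy $\mathcal{R}$, $\mathcal{V}=\operatorname{span}\{f,q_1,\dots,q_N\}$ and $\dim(\mathcal{U}_{\mathcal{R}})=\dim(\mathcal{V})$ (so that $(\mathcal{U}_{\mathcal{R}},E^{\mathrm{proj}(k)},e)$ is a $k$-AOU space). Then for each $p\in\{p_1,\dots,p_N\}$ one has $E^{\mathrm{proj}(k)}[p]=E^{\mathrm{proj}(k)}$. In other words, the positive contractions $p_1,\dots,p_N\in\mathcal{U}_{\mathcal{R}}$ are abstract projections in the $k$-AOU space $(\mathcal{U}_{\mathcal{R}},E^{\mathrm{proj}(k)},e)$.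
   Context: Notation: $[N]=\{1,\dots,N\}$; $M_{n,m}$ is the space of complex $n\times m$ matrices, $M_n=M_{n,n}$. For a $*$-vector space $\mathcal{V}$, $M_n(\mathcal{V})_h$ is the set of hermitian elements of $M_n(\mathcal{V})$, where $(a_{ij})^*=(a_{ji}^* )$; a cone is a set of hermitian elements closed under sums and nonnegative scalars, and is proper if $C\cap-C=\{0\}$. A $k$-AOU space is $(\mathcal{V},C,e)$ with $\mathcal{V}$ a $*$-vector space, $C\subseteq M_k(\mathcal{V})_h$ a proper cone with $\alpha^*C\alpha\subseteq C$ for all $\alpha\in M_k$, and $e\in\mathcal{V}$ such that $I_k\otimes e$ is an Archimedean order unit for $(M_k(\mathcal{V}),C)$. A positive contraction is a hermitian $p\in\mathcal{V}$ with $I_k\otimes p\in C$ and $I_k\otimes p^\perp\in C$, where $p^\perp=e-p$. For such $p$, $C[p]$ is the set of $x\in M_k(\mathcal{V})_h$ such that for every $\epsilon>0$ there exists $t>0$ with $$(\alpha+\beta)^*x(\alpha+\beta)+(\epsilon\alpha^*\alpha+t\beta^*\beta)\otimes p+(\epsilon\beta^*\beta+t\alpha^*\alpha)\otimes p^\perp\in C\quad\text{for all }\alpha,\beta\in M_k.$$ A positive contraction $p$ is an abstract projection in the $k$-AOU sense if $C=C[p]$. (The formula for $C[p]$ is also used when $C$ is not known to be proper.) The space $\mathcal{U}_{\mathcal{R}}$. The relations $\mathcal{R}$ consist of $l$ linear equations encoded by $M_{\mathcal{R}}\in M_{l,N+1}(\mathbb{R})$ with rows $r_1,\dots,r_l$.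 Vectors $f,q_1,\dots,q_N$ satisfy $\mathcal{R}$ if $M_{\mathcal{R}}(f\ q_1\cdots q_N)^T=0$. Put $J_{\mathcal{R}}=\operatorname{span}\{r_i^T\}\subseteq\mathbb{C}^{N+1}$, $\mathcal{U}_{\mathcal{R}}=\mathbb{C}^{N+1}/J_{\mathcal{R}}$, $e=e_0+J_{\mathcal{R}}$, $p_i=e_i+J_{\mathcal{R}}$ with $e_0,\dots,e_N$ the standard basis; the involution is induced by entrywise conjugation. $\widetilde{E}=\{r_0e+\sum_{i=1}^N t_ip_i+\sum_{i=1}^N s_ip_i^\perp:r_0,t_i,s_i\ge0\}$; $E=\{x\in\mathcal U_{\mathcal R}:x=x^*,\ x+\epsilon e\in\widetilde{E}\ \forall\epsilon>0\}$; $D_n^{\max}=\{\alpha^*\operatorname{diag}(s_1,\dots,s_m)\alpha:m\in\mathbb{N},\alpha\in M_{m,n},s_i\in E\}$; $E_n^{\max}=\{x\in M_n(\mathcal{U}_{\mathcal{R}})_h:x+\epsilon I_n\otimes e\in D_n^{\max}\ \forall\epsilon>0\}$. The cone $E^{\mathrm{proj}(k)}$. Set $E^0=E_k^{\max}\subseteq M_k(\mathcal{U}_{\mathcal{R}})_h$ and $E^n=E^{n-1}[p_i]$ for $n\ge1$, where $i\in[N]$, $i\equiv n\pmod N$. Then $E^{\mathrm{proj}(k)}$ is the Archimedean closure of $\bigcup_nE^n$, i.e. the set of $x\in M_k(\mathcal{U}_{\mathcal{R}})_h$ such that for every $\epsilon>0$ there is $n$ with $x+\epsilon I_k\otimes e\in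 E^n$. *)

theory Defs
  imports "Jordan_Normal_Form.Schur_Decomposition" "HOL-Algebra.AbelCoset"
begin

hide_const (open) Polynomial.smult Multiset.mult

text \<open>
  Complex *-vector spaces are carrier-based records, because the universal space of a set of
  relations is a quotient depending on a term. The ring multiplication and unit fields inherited
  from module records are irrelevant.
\<close>

record 'v star_space = "(complex, 'v) module" +
  star :: "'v \<Rightarrow> 'v"

locale star_vector_space = vectorspace "class_ring :: complex ring" V
  for V :: "'v star_space" (structure) +
  assumes star_closed: "v \<in> carrier V \<Longrightarrow> star V v \<in> carrier V"
    and star_star: "v \<in> carrier V \<Longrightarrow> star V (star V v) = v"
    and star_add: "v \<in> carrier V \<Longrightarrow> w \<in> carrier V \<Longrightarrow> star V (v \<oplus> w) = star V v \<oplus> star V w"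
    and star_smult: "v \<in> carrier V \<Longrightarrow> star V (c \<odot> v) = cnj c \<odot> star V v"

definition herm :: "'v star_space \<Rightarrow> 'v set" where
  "herm V = {v \<in> carrier V. star V v = v}"

abbreviation rsmult :: "'v star_space \<Rightarrow> real \<Rightarrow> 'v \<Rightarrow> 'v" where
  "rsmult V r v \<equiv> complex_of_real r \<odot>\<^bsub>V\<^esub> v"

definition is_cone :: "'v star_space \<Rightarrow> 'v set \<Rightarrow> bool" where
  "is_cone V C \<longleftrightarrow> C \<subseteq> herm V
     \<and> (\<forall>x\<in>C. \<forall>y\<in>C. x \<oplus>\<^bsub>V\<^esub> y \<in> C)
     \<and> (\<forall>r\<ge>0. \<forall>x\<in>C. rsmult V r x \<in> C)"

definition is_proper_cone :: "'v star_space \<Rightarrow> 'v set \<Rightarrow> bool" where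
  "is_proper_cone V C \<longleftrightarrow> is_cone V C \<and> C \<inter> (a_inv V) ` C = {\<zero>\<^bsub>V\<^esub>}"

definition archimedean_order_unit :: "'v star_space \<Rightarrow> 'v set \<Rightarrow> 'v \<Rightarrow> bool" where
  "archimedean_order_unit V C u \<longleftrightarrow> u \<in> herm V
     \<and> (\<forall>x\<in>herm V. \<exists>r>0. rsmult V r u \<oplus>\<^bsub>V\<^esub> x \<in> C)
     \<and> (\<forall>x\<in>herm V. (\<forall>\<epsilon>>0. x \<oplus>\<^bsub>V\<^esub> rsmult V \<epsilon> u \<in> C) \<longrightarrow> x \<in> C)"

definition archimedean_closure :: "'v star_space \<Rightarrow> 'v \<Rightarrow> 'v set \<Rightarrow> 'v set" where
  "archimedean_closure V u C = {x \<in> herm V. \<forall>\<epsilon>>0. x \<oplus>\<^bsub>V\<^esub> rsmult V \<epsilon> u \<in> C}"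


subsection \<open>Matrices over a *-vector space\<close>

definition mat_space :: "nat \<Rightarrow> 'v star_space \<Rightarrow> 'v mat star_space" where
  "mat_space n V = \<lparr>
     carrier = {X \<in> carrier_mat n n. elements_mat X \<subseteq> carrier V},
     mult = undefined,
     one = undefined,
     zero = mat n n (\<lambda>_. \<zero>\<^bsub>V\<^esub>),
     add = (\<lambda>X Y. mat n n (\<lambda>ij. X $$ ij \<oplus>\<^bsub>V\<^esub> Y $$ ij)),
     smult = (\<lambda>c. map_mat (\<lambda>v. c \<odot>\<^bsub>V\<^esub> v)),
     star = (\<lambda>X. mat n n (\<lambda>(i, j). star V (X $$ (j, i))))\<rparr>"

text \<open>\<open>compress V \<alpha> X\<close> is the product of the adjoint of \<open>\<alpha>\<close>, the square matrix \<open>X\<close> over \<open>V\<close>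
  and \<open>\<alpha>\<close>, where \<open>\<alpha>\<close> may be rectangular; \<open>tens V \<alpha> v\<close> is the tensor of \<open>\<alpha>\<close> and \<open>v\<close>.\<close>

definition compress :: "'v star_space \<Rightarrow> complex mat \<Rightarrow> 'v mat \<Rightarrow> 'v mat" where
  "compress V \<alpha> X = mat (dim_col \<alpha>) (dim_col \<alpha>) (\<lambda>(i, j).
     \<Oplus>\<^bsub>V\<^esub>a\<in>{..<dim_row \<alpha>}. \<Oplus>\<^bsub>V\<^esub>b\<in>{..<dim_row \<alpha>}.
       (cnj (\<alpha> $$ (a, i)) * \<alpha> $$ (b, j)) \<odot>\<^bsub>V\<^esub> X $$ (a, b))"

definition tens :: "'v star_space \<Rightarrow> complex mat \<Rightarrow> 'v \<Rightarrow> 'v mat" where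
  "tens V \<alpha> v = map_mat (\<lambda>c. c \<odot>\<^bsub>V\<^esub> v) \<alpha>"

definition diag_of :: "'v star_space \<Rightarrow> nat \<Rightarrow> (nat \<Rightarrow> 'v) \<Rightarrow> 'v mat" where
  "diag_of V m s = mat m m (\<lambda>(i, j). if i = j then s i else \<zero>\<^bsub>V\<^esub>)"


subsection \<open>k-AOU spaces and abstract projections\<close>

locale k_aou_space = star_vector_space V for V :: "'v star_space" (structure) +
  fixes k :: nat and C :: "'v mat set" and e :: 'v
  assumes proper_cone: "is_proper_cone (mat_space k V) C"
    and compress_closed: "\<alpha> \<in> carrier_mat k k \<Longrightarrow> x \<in> C \<Longrightarrow> compress V \<alpha> x \<in> C"
    and unit_closed: "e \<in> carrier V"
    and order_unit: "archimedean_order_unit (mat_space k V) C (tens V (1\<^sub>m k) e)"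

definition positive_contraction ::
    "'v star_space \<Rightarrow> nat \<Rightarrow> 'v mat set \<Rightarrow> 'v \<Rightarrow> 'v \<Rightarrow> bool" where
  "positive_contraction V k C e p \<longleftrightarrow> p \<in> herm V
     \<and> tens V (1\<^sub>m k) p \<in> C \<and> tens V (1\<^sub>m k) (e \<ominus>\<^bsub>V\<^esub> p) \<in> C"

text \<open>The set \<open>C[p]\<close>.\<close>

definition proj_cone ::
    "'v star_space \<Rightarrow> nat \<Rightarrow> 'v \<Rightarrow> 'v mat set \<Rightarrow> 'v \<Rightarrow> 'v mat set" where
  "proj_cone V k e C p = {x \<in> herm (mat_space k V).
     \<forall>\<epsilon>>0. \<exists>t>0. \<forall>\<alpha>\<in>carrier_mat k k. \<forall>\<beta>\<in>carrier_mat k k.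
       compress V (\<alpha> + \<beta>) x
       \<oplus>\<^bsub>mat_space k V\<^esub>
         tens V (complex_of_real \<epsilon> \<cdot>\<^sub>m (mat_adjoint \<alpha> * \<alpha>)
                 + complex_of_real t \<cdot>\<^sub>m (mat_adjoint \<beta> * \<beta>)) p
       \<oplus>\<^bsub>mat_space k V\<^esub>
         tens V (complex_of_real \<epsilon> \<cdot>\<^sub>m (mat_adjoint \<beta> * \<beta>)
                 + complex_of_real t \<cdot>\<^sub>m (mat_adjoint \<alpha> * \<alpha>)) (e \<ominus>\<^bsub>V\<^esub> p)
       \<in> C}"

definition abstract_projection ::
    "'v star_space \<Rightarrow> nat \<Rightarrow> 'v mat set \<Rightarrow> 'v \<Rightarrow> 'v \<Rightarrow> bool" where
  "abstract_projection V k C e p \<longleftrightarrow>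
     positive_contraction V k C e p \<and> C = proj_cone V k e C p"


subsection \<open>Relations and the universal *-vector space\<close>

definition satisfies_relations ::
    "'v star_space \<Rightarrow> nat \<Rightarrow> real mat \<Rightarrow> 'v \<Rightarrow> (nat \<Rightarrow> 'v) \<Rightarrow> bool" where
  "satisfies_relations V N R f q \<longleftrightarrow> (\<forall>i<dim_row R.
     (\<Oplus>\<^bsub>V\<^esub>j\<in>{0..N}. rsmult V (R $$ (i, j)) (if j = 0 then f else q j)) = \<zero>\<^bsub>V\<^esub>)"

definition rel_span :: "nat \<Rightarrow> real mat \<Rightarrow> complex vec set" where
  "rel_span N R = LinearCombinations.module.span class_ring (module_vec TYPE(complex) (Suc N))
     {map_vec complex_of_real (row R i) | i. i < dim_row R}"

text \<open>The quotient by the span of the relations. That span is invariant under entrywise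
  conjugation, so the image of a coset under conjugation is again a coset. As in the library's
  quotient rings, scalar multiples are formed as unions of cosets, so that
  multiplication by zero is also correct.\<close>

definition univ_space :: "nat \<Rightarrow> real mat \<Rightarrow> complex vec set star_space" where
  "univ_space N R = (let W = module_vec TYPE(complex) (Suc N); J = rel_span N R in \<lparr>
     carrier = a_rcosets\<^bsub>W\<^esub> J,
     mult = undefined,
     one = undefined,
     zero = J,
     add = set_add W,
     smult = (\<lambda>c X. \<Union>x\<in>X. J +>\<^bsub>W\<^esub> (c \<odot>\<^bsub>W\<^esub> x)),
     star = (\<lambda>X. conjugate ` X)\<rparr>)"

text \<open>Index 0 gives the unit \<open>e\<close>, the indices \<open>1, \<dots>, N\<close> give the generators \<open>p\<^sub>i\<close>.\<close>

definition univ_gen :: "nat \<Rightarrow> real mat \<Rightarrow> nat \<Rightarrow> complex vec set" where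
  "univ_gen N R j = rel_span N R +>\<^bsub>module_vec TYPE(complex) (Suc N)\<^esub> unit_vec (Suc N) j"


subsection \<open>The maximal cones and the projection cone\<close>

definition cone_tilde :: "'v star_space \<Rightarrow> nat \<Rightarrow> 'v \<Rightarrow> (nat \<Rightarrow> 'v) \<Rightarrow> 'v set" where
  "cone_tilde V N e p = {rsmult V r e
       \<oplus>\<^bsub>V\<^esub> (\<Oplus>\<^bsub>V\<^esub>i\<in>{1..N}. rsmult V (t i) (p i))
       \<oplus>\<^bsub>V\<^esub> (\<Oplus>\<^bsub>V\<^esub>i\<in>{1..N}. rsmult V (s i) (e \<ominus>\<^bsub>V\<^esub> p i))
     | r t s. 0 \<le> r \<and> (\<forall>i\<in>{1..N}. 0 \<le> t i \<and> 0 \<le> s i)}"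

definition cone_E :: "'v star_space \<Rightarrow> nat \<Rightarrow> 'v \<Rightarrow> (nat \<Rightarrow> 'v) \<Rightarrow> 'v set" where
  "cone_E V N e p = archimedean_closure V e (cone_tilde V N e p)"

definition D_max :: "'v star_space \<Rightarrow> nat \<Rightarrow> 'v \<Rightarrow> (nat \<Rightarrow> 'v) \<Rightarrow> nat \<Rightarrow> 'v mat set" where
  "D_max V N e p n = {compress V \<alpha> (diag_of V m s) | m \<alpha> s.
     1 \<le> m \<and> \<alpha> \<in> carrier_mat m n \<and> (\<forall>i<m. s i \<in> cone_E V N e p)}"

definition E_max :: "'v star_space \<Rightarrow> nat \<Rightarrow> 'v \<Rightarrow> (nat \<Rightarrow> 'v) \<Rightarrow> nat \<Rightarrow> 'v mat set" where
  "E_max V N e p n =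
     archimedean_closure (mat_space n V) (tens V (1\<^sub>m n) e) (D_max V N e p n)"

text \<open>The step from \<open>n\<close> to \<open>n + 1\<close> uses the index in \<open>{1..N}\<close> congruent to \<open>n + 1\<close> modulo \<open>N\<close>.\<close>

fun proj_iter ::
    "'v star_space \<Rightarrow> nat \<Rightarrow> 'v \<Rightarrow> (nat \<Rightarrow> 'v) \<Rightarrow> nat \<Rightarrow> nat \<Rightarrow> 'v mat set" where
  "proj_iter V N e p k 0 = E_max V N e p k"
| "proj_iter V N e p k (Suc n) = proj_cone V k e (proj_iter V N e p k n) (p (n mod N + 1))"

definition E_proj :: "'v star_space \<Rightarrow> nat \<Rightarrow> 'v \<Rightarrow> (nat \<Rightarrow> 'v) \<Rightarrow> nat \<Rightarrow> 'v mat set" where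
  "E_proj V N e p k =
     archimedean_closure (mat_space k V) (tens V (1\<^sub>m k) e) (\<Union>n. proj_iter V N e p k n)"

end

theory Submission
  imports Defs
begin

text \<open>The inclusion \<open>E \<subseteq> E[p]\<close> is formal, and so is the monotonicity of \<open>C \<mapsto> C[p]\<close>. The substance of the theorem
is the inclusion \<open>E[p] \<subseteq> E\<close> for the Archimedean closure \<open>E\<close> of the increasing union of the cones \<open>E\<^sup>n\<close>.
Write \<open>Q(\<alpha>, \<beta>)\<close> for the expression in the definition of \<open>C[p]\<close>, for given \<open>x\<close>, \<open>\<epsilon>\<close> and \<open>t\<close>. If \<open>x \<in> E[p]\<close>,
then every \<open>Q(\<alpha>, \<beta>)\<close> lies in \<open>E\<close>, so that for each \<open>\<delta> > 0\<close> a perturbation of it by \<open>\<delta>\<close> lies in some \<open>E\<^sup>n\<close>, where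
\<open>n\<close> may depend on \<open>\<alpha>\<close> and \<open>\<beta>\<close>. Two facts remove this dependence.

\<^item> Orthonormalisation (\<open>pair_orthonormalise\<close>): every pair is \<open>(\<alpha>'\<tau>, \<beta>'\<tau>)\<close> where the entries of
  \<open>\<alpha>'\<close> and \<open>\<beta>'\<close> are bounded by 1 and \<open>\<alpha>\<^sup>*\<alpha> + \<beta>\<^sup>*\<beta> = \<tau>\<^sup>*\<tau>\<close>. Then \<open>Q(\<alpha>, \<beta>) = \<tau>\<^sup>*Q(\<alpha>', \<beta>')\<tau>\<close>, and compressing
  \<open>Q(\<alpha>', \<beta>') + \<delta> I \<otimes> e\<close> by \<open>\<tau>\<close> gives \<open>Q(\<alpha>, \<beta>) + \<delta> (\<alpha>\<^sup>*\<alpha> + \<beta>\<^sup>*\<beta>) \<otimes> e\<close>.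
\<^item> Total boundedness (\<open>uniform_level\<close>): the elements \<open>Q(\<alpha>', \<beta>')\<close> have bounded matrix coefficients with respect to
  the finitely many generators, and elements with close coefficients differ by at most a small multiple of \<open>I \<otimes> e\<close>.
  Hence finitely many of them decide about one common \<open>n\<close>.

With one \<open>n\<close> for all \<open>\<alpha>\<close> and \<open>\<beta>\<close>, the inequality \<open>(\<alpha> + \<beta>)\<^sup>*(\<alpha> + \<beta>) \<ge> \<alpha>\<^sup>*\<alpha> / 2 - \<beta>\<^sup>*\<beta>\<close> turns the fixed \<open>\<epsilon>\<close> into
every \<open>\<epsilon>' > 0\<close> at the price of replacing \<open>x\<close> by \<open>x + 4\<epsilon> I \<otimes> e\<close> (\<open>shifted_in_proj_cone\<close>). So
\<open>x + 4\<epsilon> I \<otimes> e\<close> lies in \<open>E\<^sup>n[p]\<close>, which is contained in a later \<open>E\<^sup>m\<close> because every generator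
recurs. As \<open>\<epsilon>\<close> was arbitrary, \<open>x \<in> E\<close> (\<open>proj_cone_closure_Union\<close>).

That \<open>I \<otimes> e\<close> is an Archimedean order unit holds for every closed cone of this kind, since the universal space is spanned
by generators between 0 and \<open>e\<close>. Properness is the only place where the given space enters:
evaluation of the generators at \<open>f, q\<^sub>1, \<dots>, q\<^sub>N\<close> maps each \<open>E\<^sup>n\<close>, and hence \<open>E\<close>, into the given proper cone
(\<open>mhom_E\<close>), and it is injective because it is onto and the dimensions agree.\<close>

section \<open>Complex matrices\<close>

abbreviation Mat :: "nat \<Rightarrow> 'a mat set" where
  "Mat k \<equiv> carrier_mat k k"

abbreviation real_scale :: "real \<Rightarrow> complex mat \<Rightarrow> complex mat" (infixl \<open>\<cdot>\<^sub>r\<close> 70) where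
  "r \<cdot>\<^sub>r A \<equiv> complex_of_real r \<cdot>\<^sub>m A"

abbreviation sq :: "complex mat \<Rightarrow> complex mat" where
  "sq A \<equiv> mat_adjoint A * A"

lemma mat_adjoint_dim [simp]: "dim_row (mat_adjoint A) = dim_col A" "dim_col (mat_adjoint A) = dim_row A"
  by (auto simp: mat_adjoint_def)

lemma mat_adjoint_carrier [simp, intro]:
  "A \<in> carrier_mat n m \<Longrightarrow> mat_adjoint A \<in> carrier_mat m n"
  by auto

lemma mat_adjoint_index [simp]:
  fixes A :: "complex mat"
  shows "i < dim_col A \<Longrightarrow> j < dim_row A \<Longrightarrow> mat_adjoint A $$ (i, j) = cnj (A $$ (j, i))"
  by (auto simp: mat_adjoint_def mat_of_rows_index)

lemma mult_index:
  "A \<in> Mat k \<Longrightarrow> B \<in> Mat k \<Longrightarrow> i < k \<Longrightarrow> j < k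
    \<Longrightarrow> (A * B) $$ (i, j) = (\<Sum>l<k. A $$ (i, l) * B $$ (l, j))"
  by (auto simp: scalar_prod_def atLeast0LessThan)

lemma mult_square_carrier [simp]:
  "A \<in> Mat k \<Longrightarrow> B \<in> Mat k \<Longrightarrow> A * B \<in> Mat k"
  by auto

lemma mult_square_assoc:
  fixes A :: "'a :: semiring_0 mat"
  shows "A \<in> Mat k \<Longrightarrow> B \<in> Mat k \<Longrightarrow> C \<in> Mat k
    \<Longrightarrow> A * B * C = A * (B * C)"
  by (rule assoc_mult_mat)

lemma mult_square_distrib:
  fixes A :: "'a :: semiring_0 mat"
  shows "A \<in> Mat k \<Longrightarrow> B \<in> Mat k \<Longrightarrow> C \<in> Mat k
    \<Longrightarrow> A * (B + C) = A * B + A * C"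
  "A \<in> Mat k \<Longrightarrow> B \<in> Mat k \<Longrightarrow> C \<in> Mat k
    \<Longrightarrow> (A + B) * C = A * C + B * C"
  by (auto intro: mult_add_distrib_mat add_mult_distrib_mat)

lemma mat_adjoint_mult:
  fixes A :: "complex mat"
  assumes "A \<in> Mat k" "B \<in> Mat k"
  shows "mat_adjoint (A * B) = mat_adjoint B * mat_adjoint A"
  using assms
  by (intro eq_matI) (auto simp: mult_index[of _ k] mult.commute
      simp del: index_mult_mat(1))

lemma mat_adjoint_add:
  fixes A :: "complex mat"
  assumes "A \<in> Mat k" "B \<in> Mat k"
  shows "mat_adjoint (A + B) = mat_adjoint A + mat_adjoint B"
  using assms by (intro eq_matI) (auto)

lemma mat_adjoint_smult:
  fixes A :: "complex mat"
  assumes "A \<in> Mat k"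
  shows "mat_adjoint (c \<cdot>\<^sub>m A) = cnj c \<cdot>\<^sub>m mat_adjoint A"
  using assms by (intro eq_matI) (auto)

lemma mat_adjoint_adjoint [simp]: "mat_adjoint (mat_adjoint A) = (A :: complex mat)"
  by (intro eq_matI) auto

lemma mat_adjoint_one [simp]: "mat_adjoint (1\<^sub>m k :: complex mat) = 1\<^sub>m k"
  by (intro eq_matI) (auto)

definition herm_mats :: "nat \<Rightarrow> complex mat set" where
  "herm_mats k = {A \<in> Mat k. mat_adjoint A = A}"

lemma herm_mats_carrier [simp, intro]: "A \<in> herm_mats k \<Longrightarrow> A \<in> Mat k"
  by (simp add: herm_mats_def)

lemma herm_mats_cnj:
  assumes "A \<in> herm_mats k" "i < k" "j < k"
  shows "cnj (A $$ (i, j)) = A $$ (j, i)"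
proof -
  have A: "A \<in> Mat k" "mat_adjoint A = A"
    using assms(1) unfolding herm_mats_def by blast+
  have "mat_adjoint A $$ (j, i) = cnj (A $$ (i, j))"
    using A(1) assms(2,3) by (intro mat_adjoint_index) auto
  with A(2) show ?thesis by argo
qed

lemma herm_matsI: "A \<in> Mat k \<Longrightarrow> mat_adjoint A = A \<Longrightarrow> A \<in> herm_mats k"
  unfolding herm_mats_def by blast

lemma herm_mats_adjoint: "A \<in> herm_mats k \<Longrightarrow> mat_adjoint A = A"
  unfolding herm_mats_def by blast

lemma herm_mats_add:
  assumes "A \<in> herm_mats k" "B \<in> herm_mats k"
  shows "A + B \<in> herm_mats k"
  using mat_adjoint_add[of A k B] assms by (intro herm_matsI) (auto simp: herm_mats_adjoint)

lemma herm_mats_rsmult: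
  assumes "A \<in> herm_mats k"
  shows "r \<cdot>\<^sub>r A \<in> herm_mats k"
  using mat_adjoint_smult[of A k "complex_of_real r"] assms
  by (intro herm_matsI) (auto simp: herm_mats_adjoint)

lemma herm_mats_compress:
  assumes A: "A \<in> herm_mats k" and B: "B \<in> Mat k"
  shows "mat_adjoint B * A * B \<in> herm_mats k"
proof -
  note A' = herm_mats_carrier[OF A]
  have "mat_adjoint (mat_adjoint B * A * B) = mat_adjoint B * (mat_adjoint A * B)"
    using A' B by (simp add: mat_adjoint_mult[of _ k])
  also have "\<dots> = mat_adjoint B * A * B"
    unfolding herm_mats_adjoint[OF A] using A' B by (simp add: mult_square_assoc[of _ k])
  finally show ?thesis using A' B by (intro herm_matsI) auto
qed

lemma herm_mats_gram: "A \<in> Mat k \<Longrightarrow> sq A \<in> herm_mats k"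
  by (intro herm_matsI) (auto simp: mat_adjoint_mult[of _ k])

lemma herm_mats_zero [simp]: "0\<^sub>m k k \<in> herm_mats k"
  by (intro herm_matsI eq_matI) auto

lemma herm_mats_one [simp]: "1\<^sub>m k \<in> herm_mats k"
  by (intro herm_matsI) auto

subsection \<open>Sums of squares\<close>

text \<open>Positive semidefinite matrices are generated as sums of squares, because in this form their tensors with a positive
element are seen to lie in a cone without any spectral theory.\<close>

inductive_set psd :: "nat \<Rightarrow> complex mat set" for k where
  gram: "A \<in> Mat k \<Longrightarrow> sq A \<in> psd k"
| add: "P \<in> psd k \<Longrightarrow> Q \<in> psd k \<Longrightarrow> P + Q \<in> psd k"

lemma psd_herm: "P \<in> psd k \<Longrightarrow> P \<in> herm_mats k"
  by (induction rule: psd.induct) (auto intro: herm_mats_gram herm_mats_add)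

lemma psd_carrier [simp, intro]: "P \<in> psd k \<Longrightarrow> P \<in> Mat k"
  by (auto dest: psd_herm)

lemma psd_one [simp]: "1\<^sub>m k \<in> psd k"
  using psd.gram[of "1\<^sub>m k" k] by simp

lemma psd_zero [simp]: "0\<^sub>m k k \<in> psd k"
  using psd.gram[of "0\<^sub>m k k" k] by (simp add: mat_adjoint_carrier)

lemma psd_compress:
  assumes "P \<in> psd k" "B \<in> Mat k"
  shows "mat_adjoint B * P * B \<in> psd k"
  using assms(1)
proof (induction rule: psd.induct)
  case (gram A)
  have "mat_adjoint B * sq A * B = sq (A * B)"
    using gram assms(2) by (simp add: mat_adjoint_mult[of _ k] mult_square_assoc[of _ k])
  then show ?case using gram assms(2) by (auto intro!: psd.gram)
next
  case (add P Q)
  have "mat_adjoint B * (P + Q) * B = mat_adjoint B * P * B + mat_adjoint B * Q * B"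
    using add(1,2) assms(2)
    by (simp add: mult_square_distrib[of _ k])
  then show ?case using add by (auto intro!: psd.add)
qed

lemma psd_smult:
  assumes "P \<in> psd k" "0 \<le> r"
  shows "r \<cdot>\<^sub>r P \<in> psd k"
  using assms(1)
proof (induction rule: psd.induct)
  case (gram A)
  let ?B = "(sqrt r) \<cdot>\<^sub>r A"
  have s: "complex_of_real (sqrt r) * complex_of_real (sqrt r) = complex_of_real r"
    using assms(2) by (simp flip: of_real_mult)
  have rr: "complex_of_real (sqrt r) * x * (complex_of_real (sqrt r) * y) = complex_of_real r * (x * y)" for x y
    unfolding s[symmetric] by (simp only: mult_ac)
  have "r \<cdot>\<^sub>r sq A = sq ?B"
    using gram by (intro eq_matI) (auto simp: mult_index[of _ k] sum_distrib_left rr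
        simp del: index_mult_mat(1) intro!: sum.cong)
  then show ?case using gram by (auto intro!: psd.gram)
next
  case (add P Q)
  then show ?case
    using add_smult_distrib_left_mat[of P k k Q "complex_of_real r"] by (auto intro!: psd.add)
qed

lemma psd_rank_one: "mat k k (\<lambda>(a, b). cnj (w a) * w b) \<in> psd k"
proof (cases "k = 0")
  case True
  then have "mat k k (\<lambda>(a, b). cnj (w a) * w b) = 0\<^sub>m k k" by (intro eq_matI) auto
  then show ?thesis by simp
next
  case False
  let ?A = "mat k k (\<lambda>(i, b). if i = 0 then w b else 0)"
  have "mat k k (\<lambda>(a, b). cnj (w a) * w b) = sq ?A"
    using False
    by (intro eq_matI) (auto simp: mult_index[of _ k]  if_distrib
        simp del: index_mult_mat(1) cong: if_cong)
  then show ?thesis by (auto intro!: psd.gram)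
qed

lemma psd_rank_one_sum:
  "finite I \<Longrightarrow> mat k k (\<lambda>(a, b). \<Sum>i\<in>I. cnj (w i a) * w i b) \<in> psd k"
proof (induction rule: finite_induct)
  case empty
  have "mat k k (\<lambda>(a, b). \<Sum>i\<in>{}. cnj (w i a) * w i b) = 0\<^sub>m k k" by (intro eq_matI) auto
  then show ?case by (simp only: psd_zero)
next
  case (insert x F)
  have "mat k k (\<lambda>(a, b). \<Sum>i\<in>insert x F. cnj (w i a) * w i b)
     = mat k k (\<lambda>(a, b). cnj (w x a) * w x b) + mat k k (\<lambda>(a, b). \<Sum>i\<in>F. cnj (w i a) * w i b)"
    using insert by (intro eq_matI) auto
  then show ?case using insert psd_rank_one by (auto intro!: psd.add)
qed

definition entry_bound :: "real \<Rightarrow> complex mat \<Rightarrow> bool" where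
  "entry_bound r A \<longleftrightarrow> (\<forall>i<dim_row A. \<forall>j<dim_col A. cmod (A $$ (i, j)) \<le> r)"

text \<open>A quantitative form of diagonal dominance. The sum of the rank one squares of \<open>e\<^sub>i + u\<^sub>i\<^sub>j e\<^sub>j\<close>, where \<open>u\<^sub>i\<^sub>j\<close> is the phase of
\<open>H\<^sub>i\<^sub>j\<close>, with weights \<open>\<bar>H\<^sub>i\<^sub>j\<bar> / 2\<close>, is \<open>H\<close> plus the diagonal matrix of the absolute row sums, which are at most \<open>k \<eta>\<close>.\<close>

lemma herm_bound_psd:
  assumes H: "H \<in> herm_mats k" and b: "entry_bound \<eta> H"
  shows "(real k * \<eta>) \<cdot>\<^sub>r 1\<^sub>m k + H \<in> psd k"
proof -
  define u where "u i j = (if H $$ (i, j) = 0 then 0 else H $$ (i, j) / cmod (H $$ (i, j)))" for i j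
  define w where "w = (\<lambda>(i, j) a. complex_of_real (sqrt (cmod (H $$ (i, j)) / 2))
      * ((if a = i then 1 else 0) + u i j * (if a = j then 1 else 0)))"
  define d where "d i = real k * \<eta> - (\<Sum>j<k. cmod (H $$ (i, j)))" for i
  define v where "v i a = (if a = i then complex_of_real (sqrt (d i)) else 0)" for i a :: nat
  have b': "cmod (H $$ (i, j)) \<le> \<eta>" if "i < k" "j < k" for i j
    using b that H by (auto simp: entry_bound_def dest: herm_mats_carrier)
  have d0: "0 \<le> d i" if "i < k" for i
    using sum_bounded_above[of "{..<k}" "\<lambda>j. cmod (H $$ (i, j))" \<eta>] b' that by (auto simp: d_def)
  have hu: "complex_of_real (cmod (H $$ (i, j))) * u i j = H $$ (i, j)" for i j
    by (simp add: u_def)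
  have huu: "complex_of_real (cmod (H $$ (i, j))) * (cnj (u i j) * u i j) = cmod (H $$ (i, j))" for i j
  proof (cases "H $$ (i, j) = 0")
    case False
    have "cnj (H $$ (i, j)) * H $$ (i, j) = complex_of_real (cmod (H $$ (i, j))) * complex_of_real (cmod (H $$ (i, j)))"
      using complex_norm_square[of "H $$ (i, j)"] by (simp add: power2_eq_square mult.commute)
    then show ?thesis using False by (simp add: u_def)
  qed (simp add: u_def)
  have hcu: "complex_of_real (cmod (H $$ (i, j))) * cnj (u i j) = cnj (H $$ (i, j))" for i j
    using arg_cong[OF hu[of i j], of cnj] by simp
  have ww: "cnj (w (i, j) a) * w (i, j) b
      = ((if a = i \<and> b = i then complex_of_real (cmod (H $$ (i, j))) else 0)
       + (if a = i \<and> b = j then H $$ (i, j) else 0)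
       + (if a = j \<and> b = i then cnj (H $$ (i, j)) else 0)
       + (if a = j \<and> b = j then complex_of_real (cmod (H $$ (i, j))) else 0)) / 2" for i j a b
  proof -
    have s: "complex_of_real (sqrt (cmod (H $$ (i, j)) / 2)) * complex_of_real (sqrt (cmod (H $$ (i, j)) / 2))
      = complex_of_real (cmod (H $$ (i, j))) / 2" by (simp flip: of_real_mult)
    have "cnj (w (i, j) a) * w (i, j) b = complex_of_real (cmod (H $$ (i, j))) / 2 *
       (((if a = i then 1 else 0) + cnj (u i j) * (if a = j then 1 else 0))
       * ((if b = i then 1 else 0) + u i j * (if b = j then 1 else 0)))"
      unfolding w_def s[symmetric] by (simp add: algebra_simps)
    also have "\<dots> = ((if a = i \<and> b = i then complex_of_real (cmod (H $$ (i, j))) else 0)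
       + (if a = i \<and> b = j then complex_of_real (cmod (H $$ (i, j))) * u i j else 0)
       + (if a = j \<and> b = i then complex_of_real (cmod (H $$ (i, j))) * cnj (u i j) else 0)
       + (if a = j \<and> b = j then complex_of_real (cmod (H $$ (i, j))) * (cnj (u i j) * u i j) else 0)) / 2"
      by (simp add: algebra_simps)
    finally show ?thesis unfolding hu huu hcu .
  qed
  have sym: "cmod (H $$ (j, i)) = cmod (H $$ (i, j))" if "i < k" "j < k" for i j
    unfolding herm_mats_cnj[OF H that, symmetric] by simp
  have "(real k * \<eta>) \<cdot>\<^sub>r 1\<^sub>m k + H
     = mat k k (\<lambda>(a, b). \<Sum>p\<in>{..<k} \<times> {..<k}. cnj (w p a) * w p b)
     + mat k k (\<lambda>(a, b). \<Sum>i<k. cnj (v i a) * v i b)" (is "_ = ?W + ?D")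
  proof (intro eq_matI)
    fix a b assume "a < dim_row (?W + ?D)" "b < dim_col (?W + ?D)"
    then have ab: "a < k" "b < k" by auto
    have "?W $$ (a, b) = (\<Sum>i<k. \<Sum>j<k. cnj (w (i, j) a) * w (i, j) b)"
      using ab by (simp add: sum.cartesian_product)
    also have "\<dots> = ((if a = b then (\<Sum>j<k. complex_of_real (cmod (H $$ (a, j)))) else 0)
        + H $$ (a, b) + cnj (H $$ (b, a))
        + (if a = b then (\<Sum>i<k. complex_of_real (cmod (H $$ (i, a)))) else 0)) / 2"
    proof -
      have 1: "(\<Sum>i<k. \<Sum>j<k. if a = i \<and> b = i then f i j else 0) = (if a = b then \<Sum>j<k. f a j else 0)"
        for f :: "nat \<Rightarrow> nat \<Rightarrow> complex"
        using ab by (subst sum.swap, cases "a = b")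
          (auto simp: if_distrib sum.delta cong: if_cong intro!: sum.neutral)
      have 2: "(\<Sum>i<k. \<Sum>j<k. if a = i \<and> b = j then f i j else 0) = f a b"
        for f :: "nat \<Rightarrow> nat \<Rightarrow> complex"
      proof -
        have "(\<Sum>i<k. \<Sum>j<k. if a = i \<and> b = j then f i j else 0) = (\<Sum>i<k. if a = i then f i b else 0)"
          using ab by (intro sum.cong) auto
        then show ?thesis using ab by simp
      qed
      have 3: "(\<Sum>i<k. \<Sum>j<k. if a = j \<and> b = i then f i j else 0) = f b a"
        for f :: "nat \<Rightarrow> nat \<Rightarrow> complex"
      proof -
        have "(\<Sum>i<k. \<Sum>j<k. if a = j \<and> b = i then f i j else 0) = (\<Sum>i<k. if b = i then f i a else 0)"
          using ab by (intro sum.cong) auto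
        then show ?thesis using ab by simp
      qed
      have 4: "(\<Sum>i<k. \<Sum>j<k. if a = j \<and> b = j then f i j else 0) = (if a = b then \<Sum>i<k. f i a else 0)"
        for f :: "nat \<Rightarrow> nat \<Rightarrow> complex"
        using ab by (cases "a = b")
          (auto simp: if_distrib sum.delta cong: if_cong intro!: sum.neutral)
      show ?thesis
        unfolding ww sum_divide_distrib[symmetric] sum.distrib 1 2 3 4 ..
    qed
    also have "\<dots> = H $$ (a, b) + (if a = b then (\<Sum>j<k. complex_of_real (cmod (H $$ (a, j)))) else 0)"
      using ab herm_mats_cnj[OF H, of b a] sym by simp
    finally have W: "?W $$ (a, b) = \<dots>" .
    have "(\<Sum>i<k. cnj (v i a) * v i b) = (\<Sum>i<k. if a = i then (if a = b then complex_of_real (d a) else 0) else 0)"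
      using d0 by (intro sum.cong) (auto simp: v_def simp flip: of_real_mult)
    then have D: "?D $$ (a, b) = (if a = b then complex_of_real (d a) else 0)"
      using ab by simp
    have "complex_of_real (d a) + (\<Sum>j<k. complex_of_real (cmod (H $$ (a, j)))) = real k * \<eta>"
      by (simp add: d_def)
    then show "((real k * \<eta>) \<cdot>\<^sub>r 1\<^sub>m k + H) $$ (a, b) = (?W + ?D) $$ (a, b)"
      using W D ab herm_mats_carrier[OF H] by (auto simp: algebra_simps simp del: of_real_mult)
  qed (use herm_mats_carrier[OF H] in auto)
  then show ?thesis by (auto intro!: psd.add psd_rank_one_sum)
qed

subsection \<open>Bounds on entries\<close>

lemma entry_bound_add:
  assumes "A \<in> Mat k" "B \<in> Mat k" "entry_bound r A" "entry_bound s B"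
  shows "entry_bound (r + s) (A + B)"
  unfolding entry_bound_def
proof (intro allI impI)
  fix i j assume "i < dim_row (A + B)" "j < dim_col (A + B)"
  then show "cmod ((A + B) $$ (i, j)) \<le> r + s"
    using assms norm_triangle_mono[of "A $$ (i, j)" r "B $$ (i, j)" s] by (auto simp: entry_bound_def)
qed

lemma entry_bound_smult:
  "A \<in> Mat k \<Longrightarrow> entry_bound r A \<Longrightarrow> entry_bound (cmod c * r) (c \<cdot>\<^sub>m A)"
  by (auto simp: entry_bound_def norm_mult intro!: mult_left_mono)

lemma entry_bound_adjoint: "A \<in> Mat k \<Longrightarrow> entry_bound r A \<Longrightarrow> entry_bound r (mat_adjoint A)"
  by (auto simp: entry_bound_def )

lemma entry_bound_mult:
  assumes "A \<in> Mat k" "B \<in> Mat k" "entry_bound r A" "entry_bound s B" "0 \<le> r"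
  shows "entry_bound (real k * (r * s)) (A * B)"
  unfolding entry_bound_def
proof (intro allI impI)
  fix i j assume "i < dim_row (A * B)" "j < dim_col (A * B)"
  then have ij: "i < k" "j < k" using assms by auto
  have "cmod ((A * B) $$ (i, j)) \<le> (\<Sum>l<k. cmod (A $$ (i, l) * B $$ (l, j)))"
    unfolding mult_index[OF assms(1,2) ij] by (rule norm_sum)
  also have "\<dots> \<le> (\<Sum>l<k. r * s)"
    using assms ij by (intro sum_mono) (auto simp: norm_mult entry_bound_def intro!: mult_mono)
  finally show "cmod ((A * B) $$ (i, j)) \<le> real k * (r * s)" by simp
qed

lemma entry_bound_mono: "entry_bound r A \<Longrightarrow> r \<le> s \<Longrightarrow> entry_bound s A"
  unfolding entry_bound_def by (meson order_trans)

lemma entry_bound_exists: "\<exists>r\<ge>0. entry_bound r A"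
proof -
  let ?S = "insert 0 ((\<lambda>p. cmod (A $$ p)) ` ({..<dim_row A} \<times> {..<dim_col A}))"
  have "entry_bound (Max ?S) A" unfolding entry_bound_def by (auto intro!: Max_ge)
  moreover have "0 \<le> Max ?S" by (auto intro!: Max_ge)
  ultimately show ?thesis by blast
qed

subsection \<open>Orthonormalisation\<close>

text \<open>Gram--Schmidt orthogonalisation of possibly dependent columns. A dependent column contributes the vector 0 instead of
a unit vector, together with a zero row of \<open>\<tau>\<close>. This convention keeps the Gram matrix of the columns equal to \<open>\<tau>\<^sup>*\<tau>\<close>
in the rank deficient case.\<close>

lemma gram_schmidt_columns:
  fixes g :: "nat \<Rightarrow> nat \<Rightarrow> complex" and m :: nat
  defines "ip \<equiv> \<lambda>x y :: nat \<Rightarrow> complex. \<Sum>r<m. cnj (x r) * y r"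
  shows "\<exists>u \<tau>. (\<forall>b<n. \<forall>r<m. g b r = (\<Sum>a<n. u a r * \<tau> a b))
    \<and> (\<forall>a<n. \<forall>b<n. a \<noteq> b \<longrightarrow> ip (u a) (u b) = 0)
    \<and> (\<forall>a<n. ip (u a) (u a) = 1 \<or> (\<forall>r<m. u a r = 0) \<and> (\<forall>b. \<tau> a b = 0))"
proof (induction n)
  case 0
  then show ?case by simp
next
  case (Suc n)
  then obtain u \<tau> where
    H: "(\<forall>b<n. \<forall>r<m. g b r = (\<Sum>a<n. u a r * \<tau> a b))
      \<and> (\<forall>a<n. \<forall>b<n. a \<noteq> b \<longrightarrow> ip (u a) (u b) = 0)
      \<and> (\<forall>a<n. ip (u a) (u a) = 1 \<or> (\<forall>r<m. u a r = 0) \<and> (\<forall>b. \<tau> a b = 0))"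
    by (elim exE)
  note g = H[THEN conjunct1, rule_format]
    and o = H[THEN conjunct2, THEN conjunct1, rule_format]
    and i = H[THEN conjunct2, THEN conjunct2, THEN spec, THEN mp]
  \<comment> \<open>The component of the new column that is orthogonal to the previous vectors.\<close>
  define w where "w r = g n r - (\<Sum>a<n. u a r * ip (u a) (g n))" for r
  have zero: "ip (u a) (u a) = 0" "ip (u a) x = 0" if "\<forall>r<m. u a r = 0" for a x
    using that by (auto simp: ip_def)
  have ow: "ip (u c) w = 0" if "c < n" for c
  proof -
    have "ip (u c) w = ip (u c) (g n) - (\<Sum>r<m. \<Sum>a<n. cnj (u c r) * (u a r * ip (u a) (g n)))"
      unfolding ip_def w_def by (simp add: algebra_simps sum_subtractf sum_distrib_left)
    also have "(\<Sum>r<m. \<Sum>a<n. cnj (u c r) * (u a r * ip (u a) (g n))) = (\<Sum>a<n. ip (u c) (u a) * ip (u a) (g n))"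
    proof -
      have "(\<Sum>r<m. cnj (u c r) * (u a r * x)) = ip (u c) (u a) * x" for a x
        by (simp add: ip_def sum_distrib_right mult.assoc)
      then show ?thesis by (subst sum.swap) simp
    qed
    also have "\<dots> = (\<Sum>a<n. if a = c then ip (u c) (g n) else 0)"
      using that o i[OF that] zero[of c] by (intro sum.cong) auto
    also have "\<dots> = ip (u c) (g n)" using that by simp
    finally show ?thesis by simp
  qed
  have cip: "ip x y = cnj (ip y x)" for x y by (simp add: ip_def mult.commute)
  define s where "s = sqrt (\<Sum>r<m. (cmod (w r))\<^sup>2)"
  have ss: "s * s = (\<Sum>r<m. (cmod (w r))\<^sup>2)" by (simp add: s_def sum_nonneg)
  have ipw: "ip w w = complex_of_real (s * s)"
    by (simp add: ss ip_def complex_norm_square mult.commute del: of_real_power)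
  define u' where "u' = u(n := (\<lambda>r. if s = 0 then 0 else w r / complex_of_real s))"
  define \<tau>' where "\<tau>' a b = (if a = n then (if b = n then complex_of_real s else 0)
     else if b = n then ip (u a) (g n) else if b < n then \<tau> a b else 0)" for a b
  have w0: "w r = 0" if "s = 0" "r < m" for r
  proof -
    have "(\<Sum>r<m. (cmod (w r))\<^sup>2) = 0" using ss that by simp
    then have "\<forall>r\<in>{..<m}. (cmod (w r))\<^sup>2 = 0" by (subst (asm) sum_nonneg_eq_0_iff) auto
    then show ?thesis using that by auto
  qed
  have recon: "g b r = (\<Sum>a<Suc n. u' a r * \<tau>' a b)" if "b < Suc n" "r < m" for b r
  proof (cases "b = n")
    case True
    then show ?thesis using w0[OF _ that(2)] by (auto simp: u'_def \<tau>'_def w_def)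
  next
    case False
    then show ?thesis using that g by (auto simp: u'_def \<tau>'_def)
  qed
  have orth: "ip (u' a) (u' b) = 0" if ab: "a < Suc n" "b < Suc n" "a \<noteq> b" for a b
  proof -
    have "ip (u c) (u' n) = 0" if "c < n" for c
    proof -
      have "ip (u c) (u' n) = (if s = 0 then 0 else ip (u c) w / complex_of_real s)"
        by (auto simp: u'_def ip_def sum_divide_distrib)
      then show ?thesis using ow[OF that] by simp
    qed
    moreover from this have "ip (u' n) (u c) = 0" if "c < n" for c
      by (subst cip) (simp add: that)
    ultimately show ?thesis using ab o by (cases "a = n"; cases "b = n") (auto simp: u'_def)
  qed
  have unit: "ip (u' a) (u' a) = 1 \<or> (\<forall>r<m. u' a r = 0) \<and> (\<forall>b. \<tau>' a b = 0)" if a: "a < Suc n" for a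
  proof (cases "a = n")
    case True
    have "ip (u' n) (u' n) = 1" if "s \<noteq> 0"
    proof -
      have "ip (u' n) (u' n) = ip w w / complex_of_real (s * s)"
        using that by (simp add: u'_def ip_def sum_divide_distrib)
      then show ?thesis using ipw that by simp
    qed
    then show ?thesis using True by (cases "s = 0") (auto simp: u'_def \<tau>'_def)
  next
    case False
    have u'a: "u' a = u a" and an: "a < n" using False a by (simp_all add: u'_def)
    show ?thesis
    proof (cases "ip (u a) (u a) = 1")
      case True
      then show ?thesis unfolding u'a by (rule disjI1)
    next
      case F: False
      then have z: "\<forall>r<m. u a r = 0" "\<forall>b. \<tau> a b = 0" using i[OF an] by blast+
      have "\<tau>' a b = 0" for b using zero(2)[OF z(1)] z(2) False by (simp add: \<tau>'_def)
      then show ?thesis unfolding u'a using z(1) by blast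
    qed
  qed
  show ?case
    by (intro exI[of _ u'] exI[of _ \<tau>'] conjI allI impI; (rule recon orth unit; assumption))
qed

text \<open>The previous lemma for the columns of the \<open>2k \<times> k\<close> matrix with the blocks \<open>A\<close> and \<open>B\<close>. It writes an
arbitrary pair as a pair from a bounded set, multiplied from the right by a matrix with the same Gram matrix.\<close>

lemma pair_orthonormalise:
  assumes A: "A \<in> Mat k" and B: "B \<in> Mat k"
  obtains A' B' T where "A' \<in> Mat k" "B' \<in> Mat k" "T \<in> Mat k"
    "A = A' * T" "B = B' * T" "entry_bound 1 A'" "entry_bound 1 B'"
    "sq A + sq B = sq T"
proof -
  define g where "g b r = (if r < k then A $$ (r, b) else B $$ (r - k, b))" for b r
  obtain u \<tau> where
    H: "(\<forall>b<k. \<forall>r<k+k. g b r = (\<Sum>a<k. u a r * \<tau> a b))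
      \<and> (\<forall>a<k. \<forall>b<k. a \<noteq> b \<longrightarrow> (\<Sum>r<k+k. cnj (u a r) * u b r) = 0)
      \<and> (\<forall>a<k. (\<Sum>r<k+k. cnj (u a r) * u a r) = 1 \<or> (\<forall>r<k+k. u a r = 0) \<and> (\<forall>b. \<tau> a b = 0))"
    using gram_schmidt_columns[of k "k + k" g] by (elim exE)
  note g = H[THEN conjunct1, rule_format]
    and o = H[THEN conjunct2, THEN conjunct1, rule_format]
    and i = H[THEN conjunct2, THEN conjunct2, THEN spec, THEN mp]
  have split: "(\<Sum>r<k+n. f r) = (\<Sum>r<k. f r) + (\<Sum>r<n. f (k + r))" for f :: "nat \<Rightarrow> complex" and n
    by (induction n) auto
  let ?A = "mat k k (\<lambda>(r, a). u a r)" and ?B = "mat k k (\<lambda>(r, a). u a (k + r))"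
  let ?T = "mat k k (\<lambda>(a, b). \<tau> a b)"
  have bd: "cmod (u a r) \<le> 1" if "a < k" "r < k + k" for a r
  proof (cases "(\<Sum>r<k+k. cnj (u a r) * u a r) = 1")
    case True
    have "complex_of_real (\<Sum>r<k+k. (cmod (u a r))\<^sup>2) = (\<Sum>r<k+k. cnj (u a r) * u a r)"
      by (simp add: complex_norm_square mult.commute del: of_real_power)
    then have "(\<Sum>r<k+k. (cmod (u a r))\<^sup>2) = 1" using True of_real_eq_1_iff by metis
    then have "(cmod (u a r))\<^sup>2 \<le> 1"
      using member_le_sum[of r "{..<k+k}" "\<lambda>r. (cmod (u a r))\<^sup>2"] that by simp
    then show ?thesis by (simp add: power_le_one_iff)
  next
    case False
    then show ?thesis using i[of a] that by auto
  qed
  have gA: "A $$ (r, b) = (\<Sum>a<k. u a r * \<tau> a b)" if "r < k" "b < k" for r b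
    using g[OF that(2), of r] that by (simp add: g_def)
  have gB: "B $$ (r, b) = (\<Sum>a<k. u a (k + r) * \<tau> a b)" if "r < k" "b < k" for r b
    using g[OF that(2), of "k + r"] that by (simp add: g_def)
  have AA: "A = ?A * ?T"
    using A gA by (intro eq_matI) (auto simp: mult_index[of _ k] simp del: index_mult_mat(1))
  have BB: "B = ?B * ?T"
    using B gB by (intro eq_matI) (auto simp: mult_index[of _ k] simp del: index_mult_mat(1))
  have "sq A + sq B = sq ?T"
  proof (intro eq_matI)
    fix b c assume "b < dim_row (sq ?T)" "c < dim_col (sq ?T)"
    then have bc: "b < k" "c < k" by (auto simp: mat_adjoint_def)
    have "(sq A + sq B) $$ (b, c) = (\<Sum>r<k+k. cnj (g b r) * g c r)"
      unfolding split using A B bc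
      by (simp add: mult_index[of _ k] g_def  del: index_mult_mat(1))
    also have "\<dots> = (\<Sum>r<k+k. \<Sum>a<k. \<Sum>d<k. cnj (\<tau> a b) * \<tau> d c * (cnj (u a r) * u d r))"
    proof (rule sum.cong[OF refl])
      fix r assume "r \<in> {..<k+k}"
      then have r: "r < k + k" by simp
      show "cnj (g b r) * g c r = (\<Sum>a<k. \<Sum>d<k. cnj (\<tau> a b) * \<tau> d c * (cnj (u a r) * u d r))"
        unfolding g[OF bc(1) r] g[OF bc(2) r] cnj_sum sum_product by (simp only: complex_cnj_mult mult_ac)
    qed
    also have "\<dots> = (\<Sum>a<k. \<Sum>r<k+k. \<Sum>d<k. cnj (\<tau> a b) * \<tau> d c * (cnj (u a r) * u d r))"
      by (rule sum.swap)
    also have "\<dots> = (\<Sum>a<k. \<Sum>d<k. cnj (\<tau> a b) * \<tau> d c * (\<Sum>r<k+k. cnj (u a r) * u d r))"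
      by (rule sum.cong[OF refl], subst sum.swap) (simp add: sum_distrib_left)
    also have "\<dots> = (\<Sum>a<k. \<Sum>d<k. if d = a then cnj (\<tau> a b) * \<tau> a c else 0)"
      using o i by (intro sum.cong) (auto, force)
    also have "\<dots> = sq ?T $$ (b, c)"
      using bc by (simp add: mult_index[of _ k]  del: index_mult_mat(1))
    finally show "(sq A + sq B) $$ (b, c) = sq ?T $$ (b, c)" .
  qed (use A B in \<open>auto simp: mat_adjoint_def\<close>)
  then show ?thesis using AA BB bd by (intro that[of ?A ?B ?T]) (auto simp: entry_bound_def)
qed

subsection \<open>Finite approximation\<close>

text \<open>Total boundedness of bounded families of complex numbers with a finite index set. Real and imaginary parts
are rounded down to multiples of \<open>\<eta>\<close>; only finitely many rounded families occur, and one representative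
is chosen for each of them.\<close>

lemma finite_approximation:
  fixes f :: "'s \<Rightarrow> 'i \<Rightarrow> complex"
  assumes "finite I" "\<And>s i. s \<in> S \<Longrightarrow> i \<in> I \<Longrightarrow> cmod (f s i) \<le> r" "0 < \<eta>"
  obtains S0 where "finite S0" "S0 \<subseteq> S"
    "\<And>s. s \<in> S \<Longrightarrow> \<exists>s0\<in>S0. \<forall>i\<in>I. cmod (f s i - f s0 i) \<le> 2 * \<eta>"
proof -
  define cell where "cell s = (\<lambda>i\<in>I. (\<lfloor>Re (f s i) / \<eta>\<rfloor>, \<lfloor>Im (f s i) / \<eta>\<rfloor>))" for s
  define m where "m = \<lceil>r / \<eta>\<rceil> + 1"
  have fl: "\<lfloor>x / \<eta>\<rfloor> \<in> {- m..m}" if "\<bar>x\<bar> \<le> r" for x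
  proof -
    have "\<bar>x / \<eta>\<bar> \<le> r / \<eta>" using that assms(3) by (simp add: abs_divide divide_right_mono)
    then show ?thesis unfolding m_def by (auto; linarith)
  qed
  have "cell ` S \<subseteq> (\<Pi>\<^sub>E i\<in>I. {- m..m} \<times> {- m..m})"
  proof
    fix c assume "c \<in> cell ` S"
    then obtain s where s: "s \<in> S" "c = cell s" by blast
    have "(\<lfloor>Re (f s i) / \<eta>\<rfloor>, \<lfloor>Im (f s i) / \<eta>\<rfloor>) \<in> {- m..m} \<times> {- m..m}" if "i \<in> I" for i
      using fl[of "Re (f s i)"] fl[of "Im (f s i)"] assms(2)[OF s(1) that]
        abs_Re_le_cmod[of "f s i"] abs_Im_le_cmod[of "f s i"] by (meson SigmaI order_trans)
    then show "c \<in> (\<Pi>\<^sub>E i\<in>I. {- m..m} \<times> {- m..m})" unfolding s(2) cell_def by (rule restrict_PiE_iff[THEN iffD2, rule_format])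
  qed
  moreover have "finite (\<Pi>\<^sub>E i\<in>I. {- m..m} \<times> {- m..m})" using assms(1) by (intro finite_PiE) auto
  ultimately have fin: "finite (cell ` S)" by (rule finite_subset)
  have close: "cmod (f s i - f s0 i) \<le> 2 * \<eta>" if "cell s = cell s0" "i \<in> I" for s s0 i
  proof -
    have eq: "\<lfloor>Re (f s i) / \<eta>\<rfloor> = \<lfloor>Re (f s0 i) / \<eta>\<rfloor>" "\<lfloor>Im (f s i) / \<eta>\<rfloor> = \<lfloor>Im (f s0 i) / \<eta>\<rfloor>"
      using fun_cong[OF that(1), of i] that(2) by (auto simp: cell_def)
    have d: "\<bar>x - y\<bar> \<le> \<eta>" if "\<lfloor>x / \<eta>\<rfloor> = \<lfloor>y / \<eta>\<rfloor>" for x y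
    proof -
      have "\<bar>x / \<eta> - y / \<eta>\<bar> \<le> 1" using that by linarith
      then have "\<bar>x - y\<bar> / \<eta> \<le> 1" using assms(3) by (simp add: diff_divide_distrib[symmetric] abs_divide)
      then show ?thesis using assms(3) by simp
    qed
    have "cmod (f s i - f s0 i) \<le> \<bar>Re (f s i - f s0 i)\<bar> + \<bar>Im (f s i - f s0 i)\<bar>" by (rule cmod_le)
    also have "\<dots> \<le> \<eta> + \<eta>" using d[OF eq(1)] d[OF eq(2)] by (intro add_mono) simp_all
    finally show ?thesis by simp
  qed
  show ?thesis
  proof (rule that[of "inv_into S cell ` (cell ` S)"])
    show "finite (inv_into S cell ` (cell ` S))" using fin by (rule finite_imageI)
    show "inv_into S cell ` (cell ` S) \<subseteq> S" by (auto intro: inv_into_into)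
    fix s assume "s \<in> S"
    then have "cell (inv_into S cell (cell s)) = cell s" by (intro f_inv_into_f) auto
    then show "\<exists>s0\<in>inv_into S cell ` (cell ` S). \<forall>i\<in>I. cmod (f s i - f s0 i) \<le> 2 * \<eta>"
      using close \<open>s \<in> S\<close> by (intro bexI[of _ "inv_into S cell (cell s)"]) auto
  qed
qed

section \<open>Matrices over a star vector space\<close>

text \<open>The laws of scalar multiplication, with the trivial membership conditions on the scalars removed.\<close>

context star_vector_space
begin

lemma sm_closed [simp, intro]: "v \<in> carrier V \<Longrightarrow> c \<odot> v \<in> carrier V"
  using smult_closed[of c v] by simp

lemma sm_add_left: "v \<in> carrier V \<Longrightarrow> (a + b) \<odot> v = a \<odot> v \<oplus> b \<odot> v"
  using smult_l_distr[of a b v] by simp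

lemma sm_add_right: "v \<in> carrier V \<Longrightarrow> w \<in> carrier V \<Longrightarrow> a \<odot> (v \<oplus> w) = a \<odot> v \<oplus> a \<odot> w"
  using smult_r_distr[of a v w] by simp

lemma sm_mult: "v \<in> carrier V \<Longrightarrow> a \<odot> (b \<odot> v) = (a * b) \<odot> v"
  using smult_assoc1[of a b v] by simp

lemma sm_one [simp]: "v \<in> carrier V \<Longrightarrow> 1 \<odot> v = v"
  using smult_one[of v] by simp

lemma sm_zero [simp]: "v \<in> carrier V \<Longrightarrow> 0 \<odot> v = \<zero>"
  using smult_l_null[of v] by simp

lemma sm_zero_right [simp]: "c \<odot> \<zero> = \<zero>"
  using smult_r_null[of c] by simp

lemma minus_eq_sm: "v \<in> carrier V \<Longrightarrow> w \<in> carrier V \<Longrightarrow> v \<ominus> w = v \<oplus> (- 1) \<odot> w"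
  using smult_l_minus[of 1 w] by (simp add: a_minus_def class_ring_simps)

lemma minus_add_cancel: "v \<in> carrier V \<Longrightarrow> w \<in> carrier V \<Longrightarrow> w \<oplus> (v \<ominus> w) = v"
  by (simp add: a_minus_def a_lcomm r_neg)

lemma finsum_coeff:
  "finite F \<Longrightarrow> v \<in> carrier V \<Longrightarrow> (\<Oplus>i\<in>F. c i \<odot> v) = (\<Sum>i\<in>F. c i) \<odot> v"
  by (induction F rule: finite_induct) (auto simp: sm_add_left)

lemma star_finsum:
  "finite F \<Longrightarrow> (\<And>i. i \<in> F \<Longrightarrow> f i \<in> carrier V) \<Longrightarrow> star V (\<Oplus>i\<in>F. f i) = (\<Oplus>i\<in>F. star V (f i))"
proof (induction F rule: finite_induct)
  case empty
  have "star V \<zero> = star V (0 \<odot> \<zero>)" by simp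
  also have "\<dots> = \<zero>" using star_smult[of \<zero> 0] star_closed[of \<zero>] by simp
  finally show ?case by simp
next
  case (insert x F)
  then show ?case by (simp add: star_add star_closed Pi_def)
qed

lemma finsum_sm:
  "finite F \<Longrightarrow> (\<And>i. i \<in> F \<Longrightarrow> f i \<in> carrier V) \<Longrightarrow> c \<odot> (\<Oplus>i\<in>F. f i) = (\<Oplus>i\<in>F. c \<odot> f i)"
  by (rule finsum_smult_ldistr) auto

lemma herm_carrier [simp, intro]: "v \<in> herm V \<Longrightarrow> v \<in> carrier V"
  unfolding herm_def by blast

lemma herm_star: "v \<in> herm V \<Longrightarrow> star V v = v"
  unfolding herm_def by blast

lemma hermI: "v \<in> carrier V \<Longrightarrow> star V v = v \<Longrightarrow> v \<in> herm V"
  unfolding herm_def by blast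

lemma herm_add: "v \<in> herm V \<Longrightarrow> w \<in> herm V \<Longrightarrow> v \<oplus> w \<in> herm V"
  by (rule hermI) (simp_all add: star_add herm_star)

lemma herm_rsmult: "v \<in> herm V \<Longrightarrow> rsmult V r v \<in> herm V"
  by (rule hermI) (simp_all add: star_smult herm_star)

lemma herm_minus: "v \<in> herm V \<Longrightarrow> w \<in> herm V \<Longrightarrow> v \<ominus> w \<in> herm V"
  using herm_add[OF _ herm_rsmult, of v w "- 1"] by (simp add: minus_eq_sm)

lemma is_coneD:
  assumes "is_cone V C"
  shows "x \<in> C \<Longrightarrow> x \<in> herm V" "x \<in> C \<Longrightarrow> y \<in> C \<Longrightarrow> x \<oplus> y \<in> C"
    "0 \<le> r \<Longrightarrow> x \<in> C \<Longrightarrow> rsmult V r x \<in> C"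
  using assms unfolding is_cone_def by auto

lemma is_cone_zero:
  assumes "is_cone V C" "C \<noteq> {}"
  shows "\<zero> \<in> C"
proof -
  obtain x where "x \<in> C" using assms(2) by blast
  then show ?thesis using is_coneD(3)[OF assms(1), of 0 x] is_coneD(1)[OF assms(1), of x] by simp
qed

end

locale matrix_space = star_vector_space V for V :: "'v star_space" (structure) +
  fixes k :: nat
begin

abbreviation M :: "'v mat star_space" where "M \<equiv> mat_space k V"

lemma mem_M: "X \<in> carrier M \<longleftrightarrow> X \<in> Mat k \<and> (\<forall>i<k. \<forall>j<k. X $$ (i, j) \<in> carrier V)"
  by (force simp: mat_space_def)

lemma M_dim [simp]: "X \<in> carrier M \<Longrightarrow> dim_row X = k" "X \<in> carrier M \<Longrightarrow> dim_col X = k"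
  by (auto simp: mem_M)

lemma M_entry [simp]: "X \<in> carrier M \<Longrightarrow> i < k \<Longrightarrow> j < k \<Longrightarrow> X $$ (i, j) \<in> carrier V"
  by (auto simp: mem_M)

lemma M_add: "X \<oplus>\<^bsub>M\<^esub> Y = mat k k (\<lambda>ij. X $$ ij \<oplus> Y $$ ij)"
  and M_smult: "c \<odot>\<^bsub>M\<^esub> X = map_mat (\<lambda>v. c \<odot> v) X"
  and M_star: "star M X = mat k k (\<lambda>(i, j). star V (X $$ (j, i)))"
  and M_zero: "\<zero>\<^bsub>M\<^esub> = mat k k (\<lambda>_. \<zero>)"
  by (simp_all add: mat_space_def)

lemma M_add_index [simp]: "i < k \<Longrightarrow> j < k \<Longrightarrow> (X \<oplus>\<^bsub>M\<^esub> Y) $$ (i, j) = X $$ (i, j) \<oplus> Y $$ (i, j)"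
  and M_add_dim [simp]: "dim_row (X \<oplus>\<^bsub>M\<^esub> Y) = k" "dim_col (X \<oplus>\<^bsub>M\<^esub> Y) = k"
  and M_zero_index [simp]: "i < k \<Longrightarrow> j < k \<Longrightarrow> \<zero>\<^bsub>M\<^esub> $$ (i, j) = \<zero>"
  and M_zero_dim [simp]: "dim_row \<zero>\<^bsub>M\<^esub> = k" "dim_col \<zero>\<^bsub>M\<^esub> = k"
  by (simp_all add: M_add M_zero)

lemma M_eqI:
  assumes "dim_row X = k" "dim_col X = k" "dim_row Y = k" "dim_col Y = k"
    "\<And>i j. i < k \<Longrightarrow> j < k \<Longrightarrow> X $$ (i, j) = Y $$ (i, j)"
  shows "X = Y"
  using assms by (intro eq_matI) simp_all

lemma M_I:
  assumes "dim_row X = k" "dim_col X = k" "\<And>i j. i < k \<Longrightarrow> j < k \<Longrightarrow> X $$ (i, j) \<in> carrier V"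
  shows "X \<in> carrier M"
  unfolding mem_M using assms by (intro conjI carrier_matI allI impI)

lemma M_abelian_group: "abelian_group M"
proof (rule abelian_groupI)
  fix X assume X: "X \<in> carrier M"
  show "\<exists>Y\<in>carrier M. Y \<oplus>\<^bsub>M\<^esub> X = \<zero>\<^bsub>M\<^esub>"
  proof (rule bexI)
    show "map_mat (\<lambda>v. \<ominus> v) X \<oplus>\<^bsub>M\<^esub> X = \<zero>\<^bsub>M\<^esub>"
      using X by (intro M_eqI) (simp_all add: l_neg)
    show "map_mat (\<lambda>v. \<ominus> v) X \<in> carrier M" using X by (intro M_I) simp_all
  qed
next
  fix X Y Z assume "X \<in> carrier M" "Y \<in> carrier M" "Z \<in> carrier M"
  then show "X \<oplus>\<^bsub>M\<^esub> Y \<oplus>\<^bsub>M\<^esub> Z = X \<oplus>\<^bsub>M\<^esub> (Y \<oplus>\<^bsub>M\<^esub> Z)"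
    by (intro M_eqI) (simp_all add: a_assoc)
next
  fix X Y assume "X \<in> carrier M" "Y \<in> carrier M"
  then show "X \<oplus>\<^bsub>M\<^esub> Y = Y \<oplus>\<^bsub>M\<^esub> X"
    by (intro M_eqI) (simp_all add: a_comm)
next
  fix X Y assume "X \<in> carrier M" "Y \<in> carrier M"
  then show "X \<oplus>\<^bsub>M\<^esub> Y \<in> carrier M"
    by (intro M_I) simp_all
next
  show "\<zero>\<^bsub>M\<^esub> \<in> carrier M" by (intro M_I) simp_all
next
  fix X assume "X \<in> carrier M"
  then show "\<zero>\<^bsub>M\<^esub> \<oplus>\<^bsub>M\<^esub> X = X" by (intro M_eqI) simp_all
qed

lemma M_smult_index [simp]: "X \<in> carrier M \<Longrightarrow> i < k \<Longrightarrow> j < k \<Longrightarrow> (c \<odot>\<^bsub>M\<^esub> X) $$ (i, j) = c \<odot> X $$ (i, j)"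
  and M_smult_dim [simp]: "dim_row (c \<odot>\<^bsub>M\<^esub> X) = dim_row X" "dim_col (c \<odot>\<^bsub>M\<^esub> X) = dim_col X"
  and M_star_index [simp]: "i < k \<Longrightarrow> j < k \<Longrightarrow> star M X $$ (i, j) = star V (X $$ (j, i))"
  and M_star_dim [simp]: "dim_row (star M X) = k" "dim_col (star M X) = k"
  by (simp_all add: M_smult M_star)

lemma M_star_vector_space: "star_vector_space M"
proof -
  have c: "c \<odot>\<^bsub>M\<^esub> X \<in> carrier M" if "X \<in> carrier M" for c X
    using that by (intro M_I) simp_all
  have a: "X \<oplus>\<^bsub>M\<^esub> Y \<in> carrier M" if "X \<in> carrier M" "Y \<in> carrier M" for X Y
    using that by (intro M_I) simp_all
  have "Module.module (class_ring :: complex ring) M"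
  proof (rule moduleI[OF is_cring M_abelian_group])
    fix X and s t :: complex assume X: "X \<in> carrier M"
    show "(s \<oplus>\<^bsub>class_ring\<^esub> t) \<odot>\<^bsub>M\<^esub> X = s \<odot>\<^bsub>M\<^esub> X \<oplus>\<^bsub>M\<^esub> t \<odot>\<^bsub>M\<^esub> X"
      using X by (intro M_eqI) (simp_all add: sm_add_left)
    show "(s \<otimes>\<^bsub>class_ring\<^esub> t) \<odot>\<^bsub>M\<^esub> X = s \<odot>\<^bsub>M\<^esub> (t \<odot>\<^bsub>M\<^esub> X)"
      using X c[OF X] by (intro M_eqI) (simp_all add: sm_mult)
    show "s \<odot>\<^bsub>M\<^esub> X \<in> carrier M" by (rule c[OF X])
    show "\<one>\<^bsub>class_ring\<^esub> \<odot>\<^bsub>M\<^esub> X = X"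
      using X by (intro M_eqI) simp_all
    fix Y assume Y: "Y \<in> carrier M"
    show "s \<odot>\<^bsub>M\<^esub> (X \<oplus>\<^bsub>M\<^esub> Y) = s \<odot>\<^bsub>M\<^esub> X \<oplus>\<^bsub>M\<^esub> s \<odot>\<^bsub>M\<^esub> Y"
      using X Y a[OF X Y] by (intro M_eqI) (simp_all add: sm_add_right)
  qed
  then have vs: "vectorspace (class_ring :: complex ring) M"
    by (intro vectorspace.intro field_axioms)
  show ?thesis
  proof (intro star_vector_space.intro[OF vs] star_vector_space_axioms.intro)
    fix X and s :: complex assume X: "X \<in> carrier M"
    show "star M X \<in> carrier M" using X by (intro M_I) (simp_all add: star_closed)
    show "star M (star M X) = X" using X by (intro M_eqI) (simp_all add: star_star)
    show "star M (s \<odot>\<^bsub>M\<^esub> X) = cnj s \<odot>\<^bsub>M\<^esub> star M X"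
      using X \<open>star M X \<in> carrier M\<close> by (intro M_eqI) (simp_all add: star_smult)
    fix Y assume Y: "Y \<in> carrier M"
    show "star M (X \<oplus>\<^bsub>M\<^esub> Y) = star M X \<oplus>\<^bsub>M\<^esub> star M Y"
      using X Y by (intro M_eqI) (simp_all add: star_add)
  qed
qed

end

sublocale matrix_space \<subseteq> M: star_vector_space "mat_space k V"
  by (rule M_star_vector_space)

context matrix_space
begin

lemma M_herm_entry: "X \<in> herm M \<Longrightarrow> i < k \<Longrightarrow> j < k \<Longrightarrow> star V (X $$ (i, j)) = X $$ (j, i)"
  using arg_cong[OF M.herm_star[of X], of "\<lambda>Y. Y $$ (j, i)"] by (simp add: M_star)

subsection \<open>Tensors\<close>

lemma tens_index [simp]:
  "A \<in> Mat k \<Longrightarrow> i < k \<Longrightarrow> j < k \<Longrightarrow> tens V A v $$ (i, j) = A $$ (i, j) \<odot> v"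
  by (auto simp: tens_def)

lemma tens_dim [simp]: "dim_row (tens V A v) = dim_row A" "dim_col (tens V A v) = dim_col A"
  by (auto simp: tens_def)

lemma tens_closed [simp, intro]: "A \<in> Mat k \<Longrightarrow> v \<in> carrier V \<Longrightarrow> tens V A v \<in> carrier M"
  by (intro M_I) auto

lemma tens_add_left:
  "A \<in> Mat k \<Longrightarrow> B \<in> Mat k \<Longrightarrow> v \<in> carrier V
    \<Longrightarrow> tens V (A + B) v = tens V A v \<oplus>\<^bsub>M\<^esub> tens V B v"
  by (auto simp: M_add sm_add_left intro!: eq_matI)

lemma tens_add_right:
  "A \<in> Mat k \<Longrightarrow> v \<in> carrier V \<Longrightarrow> w \<in> carrier V
    \<Longrightarrow> tens V A (v \<oplus> w) = tens V A v \<oplus>\<^bsub>M\<^esub> tens V A w"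
  by (auto simp: M_add sm_add_right intro!: eq_matI)

lemma tens_smult:
  "A \<in> Mat k \<Longrightarrow> v \<in> carrier V \<Longrightarrow> c \<odot>\<^bsub>M\<^esub> tens V A v = tens V (c \<cdot>\<^sub>m A) v"
  by (auto simp: M_smult sm_mult intro!: eq_matI)

lemma tens_zero_left [simp]: "v \<in> carrier V \<Longrightarrow> tens V (0\<^sub>m k k) v = \<zero>\<^bsub>M\<^esub>"
  by (auto simp: M_zero intro!: eq_matI)

lemma tens_zero_right [simp]: "A \<in> Mat k \<Longrightarrow> tens V A \<zero> = \<zero>\<^bsub>M\<^esub>"
  by (auto simp: M_zero intro!: eq_matI)

lemma tens_herm:
  assumes "A \<in> herm_mats k" "v \<in> herm V"
  shows "tens V A v \<in> herm M"
proof -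
  have "star M (tens V A v) = tens V A v"
    using assms(2) herm_mats_cnj[OF assms(1)] herm_mats_carrier[OF assms(1)]
    by (auto simp: M_star star_smult herm_star intro!: eq_matI)
  then show ?thesis using assms by (intro M.hermI) auto
qed

subsection \<open>Compressions\<close>

lemma compress_dim [simp]:
  "dim_row (compress V A X) = dim_col A" "dim_col (compress V A X) = dim_col A"
  by (simp_all add: compress_def)

lemma compress_index:
  "A \<in> Mat k \<Longrightarrow> i < k \<Longrightarrow> j < k \<Longrightarrow> compress V A X $$ (i, j) =
    (\<Oplus>a\<in>{..<k}. \<Oplus>b\<in>{..<k}. (cnj (A $$ (a, i)) * A $$ (b, j)) \<odot> X $$ (a, b))"
  by (auto simp: compress_def)

lemma compress_closed [simp, intro]:
  "A \<in> Mat k \<Longrightarrow> X \<in> carrier M \<Longrightarrow> compress V A X \<in> carrier M"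
  by (intro M_I) (simp_all add: compress_index finsum_closed Pi_def)

lemma compress_add:
  assumes "A \<in> Mat k" "X \<in> carrier M" "Y \<in> carrier M"
  shows "compress V A (X \<oplus>\<^bsub>M\<^esub> Y) = compress V A X \<oplus>\<^bsub>M\<^esub> compress V A Y"
proof (rule eq_matI)
  fix i j assume "i < dim_row (compress V A X \<oplus>\<^bsub>M\<^esub> compress V A Y)"
    "j < dim_col (compress V A X \<oplus>\<^bsub>M\<^esub> compress V A Y)"
  then have ij: "i < k" "j < k" by (auto simp: M_add)
  let ?c = "\<lambda>a b. cnj (A $$ (a, i)) * A $$ (b, j)"
  have "compress V A (X \<oplus>\<^bsub>M\<^esub> Y) $$ (i, j)
     = (\<Oplus>a\<in>{..<k}. \<Oplus>b\<in>{..<k}. ?c a b \<odot> X $$ (a, b) \<oplus> ?c a b \<odot> Y $$ (a, b))"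
    unfolding compress_index[OF assms(1) ij]
    using assms by (intro finsum_cong' refl) (auto simp: M_add sm_add_right intro!: finsum_closed)
  also have "\<dots> = (\<Oplus>a\<in>{..<k}. (\<Oplus>b\<in>{..<k}. ?c a b \<odot> X $$ (a, b)) \<oplus> (\<Oplus>b\<in>{..<k}. ?c a b \<odot> Y $$ (a, b)))"
    using assms by (intro finsum_cong' finsum_addf) (auto intro!: finsum_closed)
  also have "\<dots> = (\<Oplus>a\<in>{..<k}. \<Oplus>b\<in>{..<k}. ?c a b \<odot> X $$ (a, b)) \<oplus> (\<Oplus>a\<in>{..<k}. \<Oplus>b\<in>{..<k}. ?c a b \<odot> Y $$ (a, b))"
    using assms by (intro finsum_addf) (auto intro!: finsum_closed)
  also have "\<dots> = (compress V A X \<oplus>\<^bsub>M\<^esub> compress V A Y) $$ (i, j)"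
    using ij assms by (simp add: M_add compress_index)
  finally show "compress V A (X \<oplus>\<^bsub>M\<^esub> Y) $$ (i, j) = (compress V A X \<oplus>\<^bsub>M\<^esub> compress V A Y) $$ (i, j)" .
qed (use assms in \<open>auto simp: M_add\<close>)

lemma compress_tens:
  assumes "A \<in> Mat k" "B \<in> Mat k" "v \<in> carrier V"
  shows "compress V A (tens V B v) = tens V (mat_adjoint A * B * A) v"
proof (rule eq_matI)
  fix i j assume "i < dim_row (tens V (mat_adjoint A * B * A) v)" "j < dim_col (tens V (mat_adjoint A * B * A) v)"
  then have ij: "i < k" "j < k" using assms by auto
  let ?c = "\<lambda>a b. cnj (A $$ (a, i)) * A $$ (b, j)"
  have "compress V A (tens V B v) $$ (i, j) = (\<Oplus>a\<in>{..<k}. \<Oplus>b\<in>{..<k}. (?c a b * B $$ (a, b)) \<odot> v)"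
    unfolding compress_index[OF assms(1) ij]
    using assms by (intro finsum_cong' refl) (auto simp: sm_mult intro!: finsum_closed)
  also have "\<dots> = (\<Oplus>a\<in>{..<k}. (\<Sum>b<k. ?c a b * B $$ (a, b)) \<odot> v)"
    using assms by (intro finsum_cong' refl) (auto simp: finsum_coeff)
  also have "\<dots> = (\<Sum>a<k. \<Sum>b<k. ?c a b * B $$ (a, b)) \<odot> v"
    using assms by (simp add: finsum_coeff)
  also have "(\<Sum>a<k. \<Sum>b<k. ?c a b * B $$ (a, b)) = (mat_adjoint A * B * A) $$ (i, j)"
    using assms ij
    by (subst sum.swap) (simp add: mult_index[of _ k] sum_distrib_left sum_distrib_right mult_ac del: index_mult_mat(1))
  finally show "compress V A (tens V B v) $$ (i, j) = tens V (mat_adjoint A * B * A) v $$ (i, j)"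
    using assms ij by simp
qed (use assms in auto)

subsection \<open>Linear combinations with matrix coefficients\<close>

text \<open>The sum of the tensors \<open>Z\<^sub>g \<otimes> b\<^sub>g\<close>. With the generators as \<open>b\<close>, the family \<open>Z\<close> consists of coordinates of a matrix over the
space; with rank one coefficients, these sums are the elements of the cone \<open>D\<^sup>m\<^sup>a\<^sup>x\<close>.\<close>

definition matcomb :: "(nat \<Rightarrow> 'v) \<Rightarrow> nat set \<Rightarrow> (nat \<Rightarrow> complex mat) \<Rightarrow> 'v mat" where
  "matcomb b F Z = mat k k (\<lambda>ij. \<Oplus>g\<in>F. Z g $$ ij \<odot> b g)"

lemma matcomb_empty [simp]: "matcomb b {} Z = \<zero>\<^bsub>M\<^esub>"
  by (simp add: matcomb_def M_zero)

lemma matcomb_insert: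
  assumes "finite F" "g \<notin> F" "\<And>h. h \<in> insert g F \<Longrightarrow> b h \<in> carrier V" "Z g \<in> Mat k"
  shows "matcomb b (insert g F) Z = tens V (Z g) (b g) \<oplus>\<^bsub>M\<^esub> matcomb b F Z"
  using assms by (intro eq_matI) (auto simp: matcomb_def M_add)

lemma matcomb_closed [simp, intro]: "(\<And>h. h \<in> F \<Longrightarrow> b h \<in> carrier V) \<Longrightarrow> matcomb b F Z \<in> carrier M"
  by (intro M_I) (simp_all add: matcomb_def finsum_closed Pi_def)

lemma matcomb_cong:
  assumes "\<And>h. h \<in> F \<Longrightarrow> b h \<in> carrier V" "\<And>h. h \<in> F \<Longrightarrow> Z h = Z' h"
  shows "matcomb b F Z = matcomb b F Z'"
  using assms by (intro eq_matI) (auto simp: matcomb_def intro!: finsum_cong')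

lemma matcomb_add:
  assumes "\<And>h. h \<in> F \<Longrightarrow> b h \<in> carrier V"
    "\<And>h. h \<in> F \<Longrightarrow> Z h \<in> Mat k" "\<And>h. h \<in> F \<Longrightarrow> Z' h \<in> Mat k"
  shows "matcomb b F (\<lambda>g. Z g + Z' g) = matcomb b F Z \<oplus>\<^bsub>M\<^esub> matcomb b F Z'"
proof (rule eq_matI)
  fix i j assume "i < dim_row (matcomb b F Z \<oplus>\<^bsub>M\<^esub> matcomb b F Z')" "j < dim_col (matcomb b F Z \<oplus>\<^bsub>M\<^esub> matcomb b F Z')"
  then have ij: "i < k" "j < k" by (auto simp: M_add)
  have "(\<Oplus>g\<in>F. (Z g + Z' g) $$ (i, j) \<odot> b g) = (\<Oplus>g\<in>F. Z g $$ (i, j) \<odot> b g \<oplus> Z' g $$ (i, j) \<odot> b g)"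
    using assms ij carrier_matD[OF assms(3)] by (intro finsum_cong' refl) (auto simp: sm_add_left)
  also have "\<dots> = (\<Oplus>g\<in>F. Z g $$ (i, j) \<odot> b g) \<oplus> (\<Oplus>g\<in>F. Z' g $$ (i, j) \<odot> b g)"
    using assms by (intro finsum_addf) auto
  finally show "matcomb b F (\<lambda>g. Z g + Z' g) $$ (i, j) = (matcomb b F Z \<oplus>\<^bsub>M\<^esub> matcomb b F Z') $$ (i, j)"
    using ij by (simp add: matcomb_def M_add)
qed (auto simp: M_add matcomb_def)

lemma matcomb_smult:
  assumes "finite F" "\<And>h. h \<in> F \<Longrightarrow> b h \<in> carrier V" "\<And>h. h \<in> F \<Longrightarrow> Z h \<in> Mat k"
  shows "matcomb b F (\<lambda>g. c \<cdot>\<^sub>m Z g) = c \<odot>\<^bsub>M\<^esub> matcomb b F Z"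
proof (rule eq_matI)
  fix i j assume "i < dim_row (c \<odot>\<^bsub>M\<^esub> matcomb b F Z)" "j < dim_col (c \<odot>\<^bsub>M\<^esub> matcomb b F Z)"
  then have ij: "i < k" "j < k" by (auto simp: M_smult matcomb_def)
  have "(\<Oplus>g\<in>F. (c \<cdot>\<^sub>m Z g) $$ (i, j) \<odot> b g) = (\<Oplus>g\<in>F. c \<odot> (Z g $$ (i, j) \<odot> b g))"
    using assms ij carrier_matD[OF assms(3)] by (intro finsum_cong' refl) (auto simp: sm_mult)
  also have "\<dots> = c \<odot> (\<Oplus>g\<in>F. Z g $$ (i, j) \<odot> b g)"
    using assms by (simp add: finsum_sm)
  finally show "matcomb b F (\<lambda>g. c \<cdot>\<^sub>m Z g) $$ (i, j) = (c \<odot>\<^bsub>M\<^esub> matcomb b F Z) $$ (i, j)"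
    using ij by (simp add: matcomb_def M_smult)
qed (auto simp: M_smult matcomb_def)

lemma matcomb_star:
  assumes "finite F" "\<And>h. h \<in> F \<Longrightarrow> b h \<in> herm V" "\<And>h. h \<in> F \<Longrightarrow> Z h \<in> Mat k"
  shows "star M (matcomb b F Z) = matcomb b F (\<lambda>g. mat_adjoint (Z g))"
proof (rule eq_matI)
  fix i j assume "i < dim_row (matcomb b F (\<lambda>g. mat_adjoint (Z g)))" "j < dim_col (matcomb b F (\<lambda>g. mat_adjoint (Z g)))"
  then have ij: "i < k" "j < k" by (auto simp: matcomb_def)
  have "star V (\<Oplus>g\<in>F. Z g $$ (j, i) \<odot> b g) = (\<Oplus>g\<in>F. star V (Z g $$ (j, i) \<odot> b g))"
    using assms by (intro star_finsum) auto
  also have "\<dots> = (\<Oplus>g\<in>F. mat_adjoint (Z g) $$ (i, j) \<odot> b g)"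
    using assms ij carrier_matD[OF assms(3)] by (intro finsum_cong' refl) (auto simp: star_smult herm_star)
  finally show "star M (matcomb b F Z) $$ (i, j) = matcomb b F (\<lambda>g. mat_adjoint (Z g)) $$ (i, j)"
    using ij by (simp add: matcomb_def M_star)
qed (auto simp: M_star matcomb_def)

lemma matcomb_herm:
  assumes "finite F" "\<And>h. h \<in> F \<Longrightarrow> b h \<in> herm V" "\<And>h. h \<in> F \<Longrightarrow> Z h \<in> herm_mats k"
  shows "matcomb b F Z \<in> herm M"
proof (rule M.hermI)
  show "matcomb b F Z \<in> carrier M" using assms by auto
  have "star M (matcomb b F Z) = matcomb b F (\<lambda>g. mat_adjoint (Z g))"
    using assms by (intro matcomb_star) auto
  also have "\<dots> = matcomb b F Z"
    using assms by (intro matcomb_cong) (auto simp: herm_mats_adjoint[of _ k])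
  finally show "star M (matcomb b F Z) = matcomb b F Z" .
qed

lemma compress_zero [simp]:
  assumes "A \<in> Mat k"
  shows "compress V A \<zero>\<^bsub>M\<^esub> = \<zero>\<^bsub>M\<^esub>"
proof -
  have "compress V A (tens V (0\<^sub>m k k) \<zero>) = tens V (mat_adjoint A * 0\<^sub>m k k * A) \<zero>"
    using assms by (intro compress_tens) auto
  then show ?thesis using assms by simp
qed

text \<open>Compression acts on coefficients by ordinary multiplication of complex matrices. Over a space spanned by
generators, the algebraic laws of compression therefore follow from those of complex matrices.\<close>

lemma compress_matcomb:
  assumes "A \<in> Mat k"
  shows "finite F \<Longrightarrow> (\<And>h. h \<in> F \<Longrightarrow> b h \<in> carrier V) \<Longrightarrow> (\<And>h. h \<in> F \<Longrightarrow> Z h \<in> Mat k)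
    \<Longrightarrow> compress V A (matcomb b F Z) = matcomb b F (\<lambda>g. mat_adjoint A * Z g * A)"
proof (induction F rule: finite_induct)
  case empty
  then show ?case using assms by simp
next
  case (insert g F)
  have 1: "compress V A (matcomb b (insert g F) Z)
    = compress V A (tens V (Z g) (b g) \<oplus>\<^bsub>M\<^esub> matcomb b F Z)"
    using insert by (subst matcomb_insert) auto
  have 2: "matcomb b (insert g F) (\<lambda>g. mat_adjoint A * Z g * A)
    = tens V (mat_adjoint A * Z g * A) (b g) \<oplus>\<^bsub>M\<^esub> matcomb b F (\<lambda>g. mat_adjoint A * Z g * A)"
    using insert assms by (subst matcomb_insert) auto
  show ?case unfolding 1 2
    using insert assms by (subst compress_add) (auto simp: compress_tens)
qed

lemma tens_psd:
  assumes C: "is_cone M C" "\<And>A x. A \<in> Mat k \<Longrightarrow> x \<in> C \<Longrightarrow> compress V A x \<in> C"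
    and v: "v \<in> carrier V" "tens V (1\<^sub>m k) v \<in> C" and P: "P \<in> psd k"
  shows "tens V P v \<in> C"
  using P
proof (induction rule: psd.induct)
  case (gram A)
  have "compress V A (tens V (1\<^sub>m k) v) = tens V (sq A) v"
    using gram v by (simp add: compress_tens)
  then show ?case using C(2)[OF gram v(2)] by simp
next
  case (add P Q)
  then show ?case using v M.is_coneD(2)[OF C(1)] by (simp add: tens_add_left psd_carrier)
qed

lemma compress_diag:
  assumes A: "A \<in> carrier_mat m k" and s: "\<And>i. i < m \<Longrightarrow> s i \<in> carrier V"
  shows "compress V A (diag_of V m s)
    = matcomb s {..<m} (\<lambda>l. mat k k (\<lambda>(i, j). cnj (A $$ (l, i)) * A $$ (l, j)))"
proof (rule eq_matI)
  fix i j
  assume "i < dim_row (matcomb s {..<m} (\<lambda>l. mat k k (\<lambda>(i, j). cnj (A $$ (l, i)) * A $$ (l, j))))"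
    "j < dim_col (matcomb s {..<m} (\<lambda>l. mat k k (\<lambda>(i, j). cnj (A $$ (l, i)) * A $$ (l, j))))"
  then have ij: "i < k" "j < k" by (auto simp: matcomb_def)
  have "compress V A (diag_of V m s) $$ (i, j) = (\<Oplus>a\<in>{..<m}. \<Oplus>b\<in>{..<m}.
       (cnj (A $$ (a, i)) * A $$ (b, j)) \<odot> diag_of V m s $$ (a, b))"
    using A ij by (auto simp: compress_def)
  also have "\<dots> = (\<Oplus>a\<in>{..<m}. (cnj (A $$ (a, i)) * A $$ (a, j)) \<odot> s a)"
  proof (rule finsum_cong')
    fix a assume a: "a \<in> {..<m}"
    have "(\<Oplus>b\<in>{..<m}. (cnj (A $$ (a, i)) * A $$ (b, j)) \<odot> diag_of V m s $$ (a, b))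
      = (\<Oplus>b\<in>{..<m}. if a = b then (cnj (A $$ (a, i)) * A $$ (b, j)) \<odot> s b else \<zero>)"
      using a s by (intro finsum_cong') (auto simp: diag_of_def)
    also have "\<dots> = (cnj (A $$ (a, i)) * A $$ (a, j)) \<odot> s a"
      using a s by (intro finsum_singleton) auto
    finally show "(\<Oplus>b\<in>{..<m}. (cnj (A $$ (a, i)) * A $$ (b, j)) \<odot> diag_of V m s $$ (a, b))
      = (cnj (A $$ (a, i)) * A $$ (a, j)) \<odot> s a" .
  qed (use s in auto)
  finally show "compress V A (diag_of V m s) $$ (i, j)
    = matcomb s {..<m} (\<lambda>l. mat k k (\<lambda>(i, j). cnj (A $$ (l, i)) * A $$ (l, j))) $$ (i, j)"
    using ij by (simp add: matcomb_def)
qed (use A in \<open>auto simp: matcomb_def\<close>)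

end

section \<open>Cones over a space with finitely many generators\<close>

text \<open>The generator with index 0 is the unit; the others are to become projections.\<close>

locale gen_space = matrix_space V k for V :: "'v star_space" (structure) and k :: nat +
  fixes N :: nat and p :: "nat \<Rightarrow> 'v"
  assumes k_pos: "1 \<le> k" and N_pos: "1 \<le> N"
    and p_herm: "i \<le> N \<Longrightarrow> p i \<in> herm V"
    and spanning: "v \<in> carrier V \<Longrightarrow> \<exists>c. v = (\<Oplus>g\<in>{0..N}. c g \<odot> p g)"
begin

abbreviation comb :: "(nat \<Rightarrow> complex mat) \<Rightarrow> 'v mat" where
  "comb \<equiv> matcomb p {0..N}"

abbreviation I_e :: "'v mat" where "I_e \<equiv> tens V (1\<^sub>m k) (p 0)"

abbreviation cone_e :: "'v set" where "cone_e \<equiv> cone_E V N (p 0) p"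

abbreviation arch_cl :: "'v mat set \<Rightarrow> 'v mat set" where
  "arch_cl \<equiv> archimedean_closure M I_e"

abbreviation pcone :: "'v mat set \<Rightarrow> nat \<Rightarrow> 'v mat set" where
  "pcone C i \<equiv> proj_cone V k (p 0) C (p i)"

lemma p_carrier [simp]: "i \<le> N \<Longrightarrow> p i \<in> carrier V"
  by (rule herm_carrier[OF p_herm])

lemma compl_carrier [simp]: "i \<le> N \<Longrightarrow> p 0 \<ominus> p i \<in> carrier V"
  by simp

lemma comb_closed [simp]: "comb Z \<in> carrier M"
  by auto

lemma comb_exists:
  assumes "X \<in> carrier M"
  obtains Z where "\<And>g. Z g \<in> Mat k" "X = comb Z"
proof -
  have "\<exists>c. i < k \<and> j < k \<longrightarrow> X $$ (i, j) = (\<Oplus>g\<in>{0..N}. c g \<odot> p g)" for i j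
    using spanning[of "X $$ (i, j)"] assms by auto
  then obtain c where c: "\<And>i j. i < k \<Longrightarrow> j < k \<Longrightarrow> X $$ (i, j) = (\<Oplus>g\<in>{0..N}. c i j g \<odot> p g)"
    by metis
  let ?Z = "\<lambda>g. mat k k (\<lambda>(i, j). c i j g)"
  have "X = comb ?Z"
    using assms c by (intro M_eqI) (auto simp: matcomb_def intro!: finsum_cong')
  then show ?thesis by (intro that[of ?Z]) auto
qed

text \<open>Since the generators are hermitian, the coefficients of a hermitian matrix can be replaced by their hermitian parts.\<close>

lemma herm_comb_exists:
  assumes "X \<in> herm M"
  obtains Z where "\<And>g. Z g \<in> herm_mats k" "X = comb Z"
proof -
  obtain Z where Z: "\<And>g. Z g \<in> Mat k" and X: "X = comb Z"
    using comb_exists[OF M.herm_carrier[OF assms]] by blast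
  let ?Y = "\<lambda>g. (1/2) \<cdot>\<^sub>r (Z g + mat_adjoint (Z g))"
  have Y: "?Y g \<in> herm_mats k" for g
    using Z by (intro herm_mats_rsmult herm_matsI)
      (auto simp: mat_adjoint_add[of _ k] comm_add_mat[of _ k k])
  have "comb ?Y = complex_of_real (1/2) \<odot>\<^bsub>M\<^esub> comb (\<lambda>g. Z g + mat_adjoint (Z g))"
    using Z by (intro matcomb_smult) auto
  also have "comb (\<lambda>g. Z g + mat_adjoint (Z g)) = comb Z \<oplus>\<^bsub>M\<^esub> comb (\<lambda>g. mat_adjoint (Z g))"
    using Z by (intro matcomb_add) auto
  also have "comb (\<lambda>g. mat_adjoint (Z g)) = star M (comb Z)"
    using Z p_herm by (intro matcomb_star[symmetric]) auto
  also have "\<dots> = comb Z"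
    using M.herm_star[OF assms] unfolding X .
  also have "complex_of_real (1/2) \<odot>\<^bsub>M\<^esub> (comb Z \<oplus>\<^bsub>M\<^esub> comb Z) = complex_of_real (1/2) \<odot>\<^bsub>M\<^esub> ((1 + 1) \<odot>\<^bsub>M\<^esub> comb Z)"
    by (subst M.sm_add_left) auto
  also have "\<dots> = comb Z" by (simp add: M.sm_mult)
  finally show ?thesis using Y X by (intro that[of ?Y]) auto
qed

lemma compress_comb:
  assumes "A \<in> Mat k" "\<And>g. Z g \<in> Mat k"
  shows "compress V A (comb Z) = comb (\<lambda>g. mat_adjoint A * Z g * A)"
  using assms by (intro compress_matcomb) auto

lemma compress_herm:
  assumes A: "A \<in> Mat k" and X: "X \<in> herm M"
  shows "compress V A X \<in> herm M"
proof -
  obtain Z where Z: "\<And>g. Z g \<in> herm_mats k" "X = comb Z" using herm_comb_exists[OF X] by blast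
  have "compress V A X = comb (\<lambda>g. mat_adjoint A * Z g * A)"
    unfolding Z(2) using A Z(1) by (intro compress_comb) auto
  also have "\<dots> \<in> herm M"
    using Z(1) A p_herm by (intro matcomb_herm herm_mats_compress) auto
  finally show ?thesis .
qed

lemma compress_smult:
  assumes A: "A \<in> Mat k" and X: "X \<in> carrier M"
  shows "compress V A (c \<odot>\<^bsub>M\<^esub> X) = c \<odot>\<^bsub>M\<^esub> compress V A X"
proof -
  obtain Z where Z: "\<And>g. Z g \<in> Mat k" "X = comb Z" using comb_exists[OF X] by blast
  have "compress V A (c \<odot>\<^bsub>M\<^esub> comb Z) = compress V A (comb (\<lambda>g. c \<cdot>\<^sub>m Z g))"
    using Z by (subst matcomb_smult) auto
  also have "\<dots> = comb (\<lambda>g. mat_adjoint A * (c \<cdot>\<^sub>m Z g) * A)"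
    using A Z(1) by (intro compress_comb) auto
  also have "\<dots> = comb (\<lambda>g. c \<cdot>\<^sub>m (mat_adjoint A * Z g * A))"
    using A Z(1) by (simp add: mult_smult_distrib[of _ k k _ k] mult_smult_assoc_mat[of _ k k _ k])
  also have "\<dots> = c \<odot>\<^bsub>M\<^esub> comb (\<lambda>g. mat_adjoint A * Z g * A)"
    using A Z(1) by (intro matcomb_smult) auto
  also have "comb (\<lambda>g. mat_adjoint A * Z g * A) = compress V A (comb Z)"
    using A Z(1) by (intro compress_comb[symmetric]) auto
  finally show ?thesis unfolding Z(2) .
qed

lemma compress_compress:
  assumes A: "A \<in> Mat k" and B: "B \<in> Mat k" and X: "X \<in> carrier M"
  shows "compress V A (compress V B X) = compress V (B * A) X"
proof -
  obtain Z where Z: "\<And>g. Z g \<in> Mat k" "X = comb Z" using comb_exists[OF X] by blast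
  have "compress V A (compress V B (comb Z)) = compress V A (comb (\<lambda>g. mat_adjoint B * Z g * B))"
    using B Z(1) by (subst compress_comb) auto
  also have "\<dots> = comb (\<lambda>g. mat_adjoint A * (mat_adjoint B * Z g * B) * A)"
    using A B Z(1) by (intro compress_comb) auto
  also have "\<dots> = comb (\<lambda>g. mat_adjoint (B * A) * Z g * (B * A))"
    using A B Z(1) by (simp add: mat_adjoint_mult[of _ k] mult_square_assoc[of _ k])
  also have "\<dots> = compress V (B * A) (comb Z)"
    using A B Z(1) by (intro compress_comb[symmetric]) auto
  finally show ?thesis unfolding Z(2) .
qed

subsection \<open>Matrix cones containing the generators\<close>

text \<open>The properties common to all cones in the construction of the projection cone. They are preserved by all of its
steps, and they already imply that the identity tensored with the unit is an order unit.\<close>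

definition gen_cone :: "'v mat set \<Rightarrow> bool" where
  "gen_cone C \<longleftrightarrow> is_cone M C \<and> (\<forall>A\<in>Mat k. \<forall>x\<in>C. compress V A x \<in> C)
     \<and> (\<forall>i\<in>{1..N}. tens V (1\<^sub>m k) (p i) \<in> C \<and> tens V (1\<^sub>m k) (p 0 \<ominus> p i) \<in> C)"

lemma gen_cone_is_cone: "gen_cone C \<Longrightarrow> is_cone M C"
  by (simp add: gen_cone_def)

lemmas gen_cone_herm = M.is_coneD(1)[OF gen_cone_is_cone]
  and gen_cone_add = M.is_coneD(2)[OF gen_cone_is_cone]
  and gen_cone_rsmult = M.is_coneD(3)[OF gen_cone_is_cone]

lemma gen_cone_carrier: "gen_cone C \<Longrightarrow> x \<in> C \<Longrightarrow> x \<in> carrier M"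
  by (rule M.herm_carrier[OF gen_cone_herm])

lemma gen_cone_compress: "gen_cone C \<Longrightarrow> A \<in> Mat k \<Longrightarrow> x \<in> C \<Longrightarrow> compress V A x \<in> C"
  by (simp add: gen_cone_def)

lemma gen_cone_zero: "gen_cone C \<Longrightarrow> \<zero>\<^bsub>M\<^esub> \<in> C"
  using N_pos by (intro M.is_cone_zero gen_cone_is_cone) (auto simp: gen_cone_def)

lemma gen_cone_contraction:
  assumes C: "gen_cone C" and g: "g \<le> N"
  shows "tens V (1\<^sub>m k) (p g) \<in> C" "tens V (1\<^sub>m k) (p 0 \<ominus> p g) \<in> C"
proof -
  have pos: "tens V (1\<^sub>m k) (p i) \<in> C" "tens V (1\<^sub>m k) (p 0 \<ominus> p i) \<in> C" if "1 \<le> i" "i \<le> N" for i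
    using C that by (auto simp: gen_cone_def)
  have "tens V (1\<^sub>m k) (p 1 \<oplus> (p 0 \<ominus> p 1)) \<in> C"
    using N_pos gen_cone_add[OF C pos(1)[of 1] pos(2)[of 1]] by (subst tens_add_right) auto
  then have e: "tens V (1\<^sub>m k) (p 0) \<in> C" using N_pos by (simp add: minus_add_cancel)
  have z: "p 0 \<ominus> p 0 = \<zero>" by (simp add: a_minus_def r_neg)
  show "tens V (1\<^sub>m k) (p g) \<in> C" using e pos(1)[of g] g by (cases "g = 0") auto
  show "tens V (1\<^sub>m k) (p 0 \<ominus> p g) \<in> C"
    using gen_cone_zero[OF C] pos(2)[of g] g by (cases "g = 0") (auto simp: z)
qed

lemma gen_cone_tens:
  assumes C: "gen_cone C" and g: "g \<le> N" and P: "P \<in> psd k"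
  shows "tens V P (p g) \<in> C" "tens V P (p 0 \<ominus> p g) \<in> C"
  using tens_psd[OF gen_cone_is_cone[OF C] gen_cone_compress[OF C], of "p g" P]
    tens_psd[OF gen_cone_is_cone[OF C] gen_cone_compress[OF C], of "p 0 \<ominus> p g" P]
    gen_cone_contraction[OF C g] g P by auto

lemma tens_unit_split:
  "A \<in> Mat k \<Longrightarrow> i \<le> N \<Longrightarrow> tens V A (p 0) = tens V A (p i) \<oplus>\<^bsub>M\<^esub> tens V A (p 0 \<ominus> p i)"
  using tens_add_right[of A "p i" "p 0 \<ominus> p i"] by (simp add: minus_add_cancel)

lemma I_e_herm: "I_e \<in> herm M"
  using p_herm by (intro tens_herm) auto

lemma rsmult_I_e: "c \<odot>\<^bsub>M\<^esub> I_e = tens V (c \<cdot>\<^sub>m 1\<^sub>m k) (p 0)"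
  by (intro tens_smult) auto

lemma herm_dominated:
  assumes "H \<in> herm_mats k"
  obtains c where "c > 0" "c \<cdot>\<^sub>r 1\<^sub>m k + H \<in> psd k"
proof -
  obtain r where r: "0 \<le> r" "entry_bound r H" using entry_bound_exists by blast
  have "complex_of_real 1 \<cdot>\<^sub>m 1\<^sub>m k + ((real k * r) \<cdot>\<^sub>r 1\<^sub>m k + H) \<in> psd k"
    by (intro psd.add psd_smult herm_bound_psd assms r) auto
  also have "complex_of_real 1 \<cdot>\<^sub>m 1\<^sub>m k + ((real k * r) \<cdot>\<^sub>r 1\<^sub>m k + H)
    = (1 + real k * r) \<cdot>\<^sub>r 1\<^sub>m k + H"
    using herm_mats_carrier[OF assms] by (intro eq_matI) (auto simp: algebra_simps)
  finally show ?thesis using r(1) by (intro that[of "1 + real k * r"]) (auto intro!: add_pos_nonneg)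
qed

text \<open>The constant \<open>c\<close> plays the role of the squared operator norm of \<open>A\<close>: it corrects compressions by
arbitrary \<open>A\<close>, under which the unit is not preserved.\<close>

lemma gram_complement:
  assumes "A \<in> Mat k"
  obtains c P where "c > 0" "P \<in> psd k" "sq A + P = c \<cdot>\<^sub>r 1\<^sub>m k"
proof -
  have "(- 1) \<cdot>\<^sub>r sq A \<in> herm_mats k"
    by (intro herm_mats_rsmult herm_mats_gram assms)
  then obtain c where c: "c > 0"
    "c \<cdot>\<^sub>r 1\<^sub>m k + (- 1) \<cdot>\<^sub>r sq A \<in> psd k"
    using herm_dominated by blast
  moreover have "sq A + (c \<cdot>\<^sub>r 1\<^sub>m k + (- 1) \<cdot>\<^sub>r sq A)
    = c \<cdot>\<^sub>r 1\<^sub>m k"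
    using assms by (intro eq_matI) (auto simp: algebra_simps)
  ultimately show ?thesis by (rule that)
qed

text \<open>Each generator \<open>g\<close> satisfies \<open>0 \<le> g \<le> e\<close>, hence \<open>H \<otimes> g = (H + k\<eta>) \<otimes> g - k\<eta> \<otimes> g \<ge> - k\<eta> \<otimes> e\<close>
whenever \<open>H\<close> is hermitian with entries bounded by \<open>\<eta>\<close>. For large \<open>\<eta>\<close> this gives the order unit, for small \<open>\<eta>\<close> it says that
elements with close coefficients are close in the order.\<close>

lemma comb_dominated:
  assumes C: "gen_cone C" and \<eta>: "0 \<le> \<eta>"
  shows "finite F \<Longrightarrow> F \<subseteq> {0..N} \<Longrightarrow> (\<And>g. g \<in> F \<Longrightarrow> H g \<in> herm_mats k \<and> entry_bound \<eta> (H g))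
    \<Longrightarrow> matcomb p F H \<oplus>\<^bsub>M\<^esub> rsmult M (real (card F) * (real k * \<eta>)) I_e \<in> C"
proof (induction F rule: finite_induct)
  case empty
  then show ?case using gen_cone_zero[OF C] by simp
next
  case (insert g F)
  let ?c = "complex_of_real (real k * \<eta>)"
  let ?P = "?c \<cdot>\<^sub>m 1\<^sub>m k + H g"
  have g: "g \<le> N" and H: "H g \<in> herm_mats k" "entry_bound \<eta> (H g)" using insert by auto
  note Hc = herm_mats_carrier[OF H(1)]
  have P: "?P \<in> psd k" by (rule herm_bound_psd[OF H])
  have "?c \<cdot>\<^sub>m 1\<^sub>m k \<in> psd k" using \<eta> by (intro psd_smult) auto
  then have mem: "(tens V ?P (p g) \<oplus>\<^bsub>M\<^esub> tens V (?c \<cdot>\<^sub>m 1\<^sub>m k) (p 0 \<ominus> p g))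
      \<oplus>\<^bsub>M\<^esub> (matcomb p F H \<oplus>\<^bsub>M\<^esub> rsmult M (real (card F) * (real k * \<eta>)) I_e) \<in> C"
    using insert by (intro gen_cone_add[OF C] gen_cone_tens[OF C g] P insert.IH) auto
  have F: "matcomb p F H \<in> carrier M" using insert.prems(1) by (intro matcomb_closed p_carrier) auto
  have "tens V ?P (p g) \<oplus>\<^bsub>M\<^esub> tens V (?c \<cdot>\<^sub>m 1\<^sub>m k) (p 0 \<ominus> p g)
     = tens V (H g) (p g) \<oplus>\<^bsub>M\<^esub> tens V (?c \<cdot>\<^sub>m 1\<^sub>m k) (p 0)"
    using g Hc by (simp add: tens_unit_split[of _ g] tens_add_left M.a_assoc M.a_lcomm)
  also have "tens V (?c \<cdot>\<^sub>m 1\<^sub>m k) (p 0) = ?c \<odot>\<^bsub>M\<^esub> I_e" by (simp add: rsmult_I_e)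
  finally have 1: "tens V ?P (p g) \<oplus>\<^bsub>M\<^esub> tens V (?c \<cdot>\<^sub>m 1\<^sub>m k) (p 0 \<ominus> p g)
     = tens V (H g) (p g) \<oplus>\<^bsub>M\<^esub> ?c \<odot>\<^bsub>M\<^esub> I_e" .
  have 2: "matcomb p (insert g F) H = tens V (H g) (p g) \<oplus>\<^bsub>M\<^esub> matcomb p F H"
    using insert Hc by (intro matcomb_insert) auto
  have "real (card (insert g F)) * (real k * \<eta>) = real k * \<eta> + real (card F) * (real k * \<eta>)"
    using insert by (simp add: algebra_simps)
  then have 3: "rsmult M (real (card (insert g F)) * (real k * \<eta>)) I_e
     = ?c \<odot>\<^bsub>M\<^esub> I_e \<oplus>\<^bsub>M\<^esub> rsmult M (real (card F) * (real k * \<eta>)) I_e"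
    by (simp only: of_real_add M.sm_add_left tens_closed one_carrier_mat p_carrier le0)
  show ?case using mem g Hc F unfolding 1 2 3 by (simp add: M.a_assoc M.a_lcomm)
qed

lemma gen_cone_order_unit:
  assumes C: "gen_cone C" and X: "X \<in> herm M"
  shows "\<exists>r>0. rsmult M r I_e \<oplus>\<^bsub>M\<^esub> X \<in> C"
proof -
  obtain Z where Z: "\<And>g. Z g \<in> herm_mats k" "X = comb Z" using herm_comb_exists[OF X] by blast
  have "\<exists>r\<ge>0. entry_bound r (Z g)" for g by (rule entry_bound_exists)
  then obtain r where r: "\<And>g. 0 \<le> r g" "\<And>g. entry_bound (r g) (Z g)" by metis
  define R where "R = (\<Sum>g\<in>{0..N}. r g) + 1"
  have R: "r g \<le> R" if "g \<in> {0..N}" for g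
    using member_le_sum[of g "{0..N}" r] r that by (simp add: R_def)
  have R0: "0 < R" using r by (auto simp: R_def intro!: add_nonneg_pos sum_nonneg)
  have "comb Z \<oplus>\<^bsub>M\<^esub> rsmult M (real (card {0..N}) * (real k * R)) I_e \<in> C"
    using R0 Z(1) entry_bound_mono[OF r(2) R] by (intro comb_dominated[OF C]) auto
  moreover have "0 < real (card {0..N}) * (real k * R)" using R0 k_pos by simp
  ultimately show ?thesis using X Z(2) by (auto simp: M.a_comm intro!: exI)
qed

subsection \<open>The cone \<open>C[p]\<close>\<close>

text \<open>The expression \<open>Q(\<alpha>, \<beta>)\<close> in the definition of \<open>C[p]\<close>, as a function of all its parameters.\<close>

definition proj_expr :: "nat \<Rightarrow> real \<Rightarrow> real \<Rightarrow> complex mat \<Rightarrow> complex mat \<Rightarrow> 'v mat \<Rightarrow> 'v mat" where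
  "proj_expr i \<epsilon> t A B x = compress V (A + B) x
     \<oplus>\<^bsub>M\<^esub> tens V (\<epsilon> \<cdot>\<^sub>r sq A + t \<cdot>\<^sub>r sq B) (p i)
     \<oplus>\<^bsub>M\<^esub> tens V (\<epsilon> \<cdot>\<^sub>r sq B + t \<cdot>\<^sub>r sq A) (p 0 \<ominus> p i)"

lemma mem_proj_cone: "x \<in> pcone C i \<longleftrightarrow> x \<in> herm M \<and>
   (\<forall>\<epsilon>>0. \<exists>t>0. \<forall>A\<in>Mat k. \<forall>B\<in>Mat k. proj_expr i \<epsilon> t A B x \<in> C)"
  by (simp add: proj_cone_def proj_expr_def)

lemma proj_cone_mono: "C \<subseteq> D \<Longrightarrow> proj_cone V k e C q \<subseteq> proj_cone V k e D q"
  unfolding proj_cone_def by blast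

lemma proj_expr_closed [simp]:
  "i \<le> N \<Longrightarrow> A \<in> Mat k \<Longrightarrow> B \<in> Mat k \<Longrightarrow> x \<in> carrier M
    \<Longrightarrow> proj_expr i \<epsilon> t A B x \<in> carrier M"
  by (simp add: proj_expr_def)

lemma proj_expr_add:
  assumes "i \<le> N" and A: "A \<in> Mat k" and B: "B \<in> Mat k"
    and "x \<in> carrier M" "y \<in> carrier M"
  shows "proj_expr i (\<epsilon> + \<epsilon>') (t + t') A B (x \<oplus>\<^bsub>M\<^esub> y) = proj_expr i \<epsilon> t A B x \<oplus>\<^bsub>M\<^esub> proj_expr i \<epsilon>' t' A B y"
proof -
  have *: "(\<epsilon> + \<epsilon>') \<cdot>\<^sub>r sq C + (t + t') \<cdot>\<^sub>r sq D
     = (\<epsilon> \<cdot>\<^sub>r sq C + t \<cdot>\<^sub>r sq D)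
     + (\<epsilon>' \<cdot>\<^sub>r sq C + t' \<cdot>\<^sub>r sq D)"
    if "C \<in> Mat k" "D \<in> Mat k" for C D :: "complex mat"
    using that by (intro eq_matI) (auto simp: algebra_simps)
  show ?thesis
    unfolding proj_expr_def *[OF A B] *[OF B A]
    using assms by (simp add: compress_add tens_add_left M.a_assoc M.a_lcomm)
qed

lemma proj_expr_smult:
  assumes "i \<le> N" and A: "A \<in> Mat k" and B: "B \<in> Mat k" and "x \<in> carrier M"
  shows "proj_expr i (r * \<epsilon>) (r * t) A B (rsmult M r x) = rsmult M r (proj_expr i \<epsilon> t A B x)"
proof -
  have *: "(r * \<epsilon>) \<cdot>\<^sub>r sq C + (r * t) \<cdot>\<^sub>r sq D
     = r \<cdot>\<^sub>r (\<epsilon> \<cdot>\<^sub>r sq C + t \<cdot>\<^sub>r sq D)"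
    if "C \<in> Mat k" "D \<in> Mat k" for C D :: "complex mat"
    using that by (intro eq_matI) (auto simp: algebra_simps)
  show ?thesis
    unfolding proj_expr_def *[OF A B] *[OF B A]
    using assms by (simp add: compress_smult tens_smult M.sm_add_right)
qed

lemma gram_mult:
  fixes A T :: "complex mat"
  assumes "A \<in> Mat k" "T \<in> Mat k"
  shows "sq (A * T) = mat_adjoint T * sq A * T"
  using assms by (simp add: mat_adjoint_mult[of _ k] mult_square_assoc[of _ k])

text \<open>The expression is homogeneous: multiplying both matrices from the right amounts to a compression.\<close>

lemma compress_proj_expr:
  assumes "i \<le> N" and A: "A \<in> Mat k" and B: "B \<in> Mat k" and "x \<in> carrier M"
    and T: "T \<in> Mat k"
  shows "compress V T (proj_expr i \<epsilon> t A B x) = proj_expr i \<epsilon> t (A * T) (B * T) x"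
proof -
  have *: "mat_adjoint T * (\<epsilon> \<cdot>\<^sub>r sq C + t \<cdot>\<^sub>r sq D) * T
     = \<epsilon> \<cdot>\<^sub>r sq (C * T) + t \<cdot>\<^sub>r sq (D * T)"
    if "C \<in> Mat k" "D \<in> Mat k" for C D :: "complex mat"
    unfolding gram_mult[OF that(1) T] gram_mult[OF that(2) T] using that T
    by (simp add: mult_square_distrib[of _ k] mult_smult_distrib[of _ k k _ k] mult_smult_assoc_mat[of _ k k _ k])
  have "(A + B) * T = A * T + B * T" using assms by (simp add: mult_square_distrib[of _ k])
  then show ?thesis
    unfolding proj_expr_def *[OF A B, symmetric] *[OF B A, symmetric]
    using assms by (simp add: compress_add compress_compress compress_tens)
qed

end

context gen_space
begin

lemma weighted_grams_psd:
  "0 \<le> \<epsilon> \<Longrightarrow> 0 \<le> t \<Longrightarrow> A \<in> Mat k \<Longrightarrow> B \<in> Mat k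
    \<Longrightarrow> \<epsilon> \<cdot>\<^sub>r sq A + t \<cdot>\<^sub>r sq B \<in> psd k"
  by (intro psd.add psd_smult psd.gram)

lemma proj_cone_supset:
  assumes C: "gen_cone C" and i: "i \<le> N"
  shows "C \<subseteq> pcone C i"
proof
  fix x assume x: "x \<in> C"
  have "proj_expr i \<epsilon> 1 A B x \<in> C" if "\<epsilon> > 0" "A \<in> Mat k" "B \<in> Mat k" for \<epsilon> A B
    unfolding proj_expr_def using that x
    by (intro gen_cone_add[OF C] gen_cone_compress[OF C] gen_cone_tens[OF C i] weighted_grams_psd) auto
  then show "x \<in> pcone C i"
    unfolding mem_proj_cone using gen_cone_herm[OF C x] by (intro conjI allI impI exI[of _ 1]) auto
qed

lemma gen_cone_supset:
  assumes "gen_cone C" "C \<subseteq> D" "is_cone M D"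
    "\<And>A x. A \<in> Mat k \<Longrightarrow> x \<in> D \<Longrightarrow> compress V A x \<in> D"
  shows "gen_cone D"
  using assms unfolding gen_cone_def by blast

lemma gram_split:
  fixes A D P :: "complex mat"
  assumes A: "A \<in> Mat k" and D: "D \<in> Mat k" and P: "P \<in> Mat k"
    and c: "sq A + P = c \<cdot>\<^sub>m 1\<^sub>m k"
  shows "c \<cdot>\<^sub>m sq D = sq (A * D) + mat_adjoint D * P * D"
proof -
  have "sq (A * D) + mat_adjoint D * P * D = mat_adjoint D * (sq A + P) * D"
    unfolding gram_mult[OF A D] using A D P by (simp add: mult_square_distrib[of _ k])
  also have "\<dots> = c \<cdot>\<^sub>m sq D"
    unfolding c using D by (simp add: mult_smult_distrib[of _ k k _ k] mult_smult_assoc_mat[of _ k k _ k])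
  finally show ?thesis by simp
qed

lemma proj_cone_is_cone:
  assumes C: "gen_cone C" and i: "i \<le> N"
  shows "is_cone M (pcone C i)"
  unfolding is_cone_def
proof (intro conjI ballI allI impI)
  show "pcone C i \<subseteq> herm M" by (auto simp: mem_proj_cone)
next
  fix x y assume x: "x \<in> pcone C i" and y: "y \<in> pcone C i"
  then have h: "x \<in> herm M" "y \<in> herm M" by (auto simp: mem_proj_cone)
  show "x \<oplus>\<^bsub>M\<^esub> y \<in> pcone C i"
    unfolding mem_proj_cone
  proof (intro conjI allI impI)
    show "x \<oplus>\<^bsub>M\<^esub> y \<in> herm M" using h by (rule M.herm_add)
    fix \<epsilon> :: real assume e: "\<epsilon> > 0"
    then have e2: "\<epsilon> / 2 > 0" by simp
    obtain s where s: "s > 0" "\<forall>A\<in>Mat k. \<forall>B\<in>Mat k. proj_expr i (\<epsilon>/2) s A B x \<in> C"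
      using x e2 unfolding mem_proj_cone by blast
    obtain t where t: "t > 0" "\<forall>A\<in>Mat k. \<forall>B\<in>Mat k. proj_expr i (\<epsilon>/2) t A B y \<in> C"
      using y e2 unfolding mem_proj_cone by blast
    show "\<exists>t>0. \<forall>A\<in>Mat k. \<forall>B\<in>Mat k. proj_expr i \<epsilon> t A B (x \<oplus>\<^bsub>M\<^esub> y) \<in> C"
    proof (intro exI[of _ "s + t"] conjI ballI)
      fix A B :: "complex mat" assume AB: "A \<in> Mat k" "B \<in> Mat k"
      have "proj_expr i (\<epsilon>/2 + \<epsilon>/2) (s + t) A B (x \<oplus>\<^bsub>M\<^esub> y) \<in> C"
        using i AB h s(2) t(2) by (subst proj_expr_add) (auto intro!: gen_cone_add[OF C])
      then show "proj_expr i \<epsilon> (s + t) A B (x \<oplus>\<^bsub>M\<^esub> y) \<in> C" by simp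
    qed (use s t in simp)
  qed
next
  fix x and r :: real assume r: "r \<ge> 0" and x: "x \<in> pcone C i"
  then have h: "x \<in> herm M" by (auto simp: mem_proj_cone)
  show "rsmult M r x \<in> pcone C i"
  proof (cases "r = 0")
    case True
    then show ?thesis using proj_cone_supset[OF C i] gen_cone_zero[OF C] h by auto
  next
    case False
    then have r: "r > 0" using r by simp
    show ?thesis unfolding mem_proj_cone
    proof (intro conjI allI impI)
      show "rsmult M r x \<in> herm M" using h by (rule M.herm_rsmult)
      fix \<epsilon> :: real assume e: "\<epsilon> > 0"
      then obtain t where t: "t > 0" "\<forall>A\<in>Mat k. \<forall>B\<in>Mat k. proj_expr i (\<epsilon>/r) t A B x \<in> C"
        using x r unfolding mem_proj_cone by (metis divide_pos_pos)
      show "\<exists>t>0. \<forall>A\<in>Mat k. \<forall>B\<in>Mat k. proj_expr i \<epsilon> t A B (rsmult M r x) \<in> C"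
      proof (intro exI[of _ "r * t"] conjI ballI)
        fix A B :: "complex mat" assume AB: "A \<in> Mat k" "B \<in> Mat k"
        have "proj_expr i (r * (\<epsilon>/r)) (r * t) A B (rsmult M r x) \<in> C"
          using i AB h t(2) r by (subst proj_expr_smult) (auto intro!: gen_cone_rsmult[OF C])
        then show "proj_expr i \<epsilon> (r * t) A B (rsmult M r x) \<in> C" using r by simp
      qed (use r t in simp)
    qed
  qed
qed

text \<open>Compression by \<open>\<gamma>\<close> turns \<open>(\<alpha>, \<beta>)\<close> into \<open>(\<gamma>\<alpha>, \<gamma>\<beta>)\<close> in the term with \<open>x\<close>. The other two terms change only by a factor
\<open>c\<close> and a positive remainder, so \<open>\<epsilon>\<close> and \<open>t\<close> have to be rescaled by \<open>c\<close>.\<close>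

lemma proj_cone_compress:
  assumes C: "gen_cone C" and i: "i \<le> N" and G: "G \<in> Mat k"
    and x: "x \<in> pcone C i"
  shows "compress V G x \<in> pcone C i"
  unfolding mem_proj_cone
proof (intro conjI allI impI)
  have h: "x \<in> herm M" using x by (auto simp: mem_proj_cone)
  then show "compress V G x \<in> herm M" by (rule compress_herm[OF G])
  obtain c P where c: "c > 0" and P: "P \<in> psd k" and GP: "sq G + P = c \<cdot>\<^sub>r 1\<^sub>m k"
    using gram_complement[OF G] by blast
  fix \<epsilon> :: real assume e: "\<epsilon> > 0"
  define d where "d = \<epsilon> / c"
  have d: "d > 0" "\<epsilon> = c * d" using e c by (simp_all add: d_def)
  then obtain t where t: "t > 0" "\<forall>A\<in>Mat k. \<forall>B\<in>Mat k. proj_expr i d t A B x \<in> C"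
    using x unfolding mem_proj_cone by blast
  show "\<exists>t>0. \<forall>A\<in>Mat k. \<forall>B\<in>Mat k. proj_expr i \<epsilon> t A B (compress V G x) \<in> C"
  proof (intro exI[of _ "c * t"] conjI ballI)
    fix A B :: "complex mat" assume A: "A \<in> Mat k" and B: "B \<in> Mat k"
    define R where "R D D' = d \<cdot>\<^sub>r (mat_adjoint D * P * D) + t \<cdot>\<^sub>r (mat_adjoint D' * P * D')" for D D'
    have R: "R D D' \<in> psd k" if "D \<in> Mat k" "D' \<in> Mat k" for D D'
      unfolding R_def using that P d t by (intro psd.add psd_smult psd_compress) auto
    have *: "(c * d) \<cdot>\<^sub>r sq D + (c * t) \<cdot>\<^sub>r sq D'
      = (d \<cdot>\<^sub>r sq (G * D) + t \<cdot>\<^sub>r sq (G * D')) + R D D'"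
      if "D \<in> Mat k" "D' \<in> Mat k" for D D' :: "complex mat"
    proof -
      have "(c * d) \<cdot>\<^sub>r sq D + (c * t) \<cdot>\<^sub>r sq D'
        = d \<cdot>\<^sub>r (c \<cdot>\<^sub>r sq D) + t \<cdot>\<^sub>r (c \<cdot>\<^sub>r sq D')"
        using that by (intro eq_matI) (auto simp: algebra_simps)
      also have "\<dots> = d \<cdot>\<^sub>r (sq (G * D) + mat_adjoint D * P * D)
         + t \<cdot>\<^sub>r (sq (G * D') + mat_adjoint D' * P * D')"
        unfolding gram_split[OF G that(1) psd_carrier[OF P] GP] gram_split[OF G that(2) psd_carrier[OF P] GP] ..
      also have "\<dots> = (d \<cdot>\<^sub>r sq (G * D) + t \<cdot>\<^sub>r sq (G * D')) + R D D'"
        unfolding R_def using that G psd_carrier[OF P] by (intro eq_matI) (auto simp: algebra_simps)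
      finally show ?thesis .
    qed
    have GAB: "G * (A + B) = G * A + G * B" using G A B by (simp add: mult_square_distrib[of _ k])
    have "proj_expr i (c * d) (c * t) A B (compress V G x)
      = proj_expr i d t (G * A) (G * B) x \<oplus>\<^bsub>M\<^esub> tens V (R A B) (p i) \<oplus>\<^bsub>M\<^esub> tens V (R B A) (p 0 \<ominus> p i)"
      unfolding proj_expr_def *[OF A B] *[OF B A]
      using i A B G h psd_carrier[OF R[OF A B]] psd_carrier[OF R[OF B A]]
      by (simp add: compress_compress GAB tens_add_left M.a_assoc M.a_lcomm)
    moreover have "\<dots> \<in> C"
      using t(2) A B G by (intro gen_cone_add[OF C] gen_cone_tens[OF C i] R) auto
    ultimately show "proj_expr i \<epsilon> (c * t) A B (compress V G x) \<in> C" using d(2) by simp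
  qed (use c t in simp)
qed

lemma gen_cone_proj_cone:
  assumes "gen_cone C" "i \<le> N"
  shows "gen_cone (pcone C i)"
  by (rule gen_cone_supset[OF assms(1) proj_cone_supset[OF assms] proj_cone_is_cone[OF assms]])
    (rule proj_cone_compress[OF assms])

subsection \<open>Archimedean closures\<close>

lemma mem_closure: "x \<in> arch_cl C \<longleftrightarrow> x \<in> herm M \<and> (\<forall>\<epsilon>>0. x \<oplus>\<^bsub>M\<^esub> rsmult M \<epsilon> I_e \<in> C)"
  by (simp add: archimedean_closure_def)

lemma closureD: "x \<in> arch_cl C \<Longrightarrow> \<epsilon> > 0 \<Longrightarrow> x \<oplus>\<^bsub>M\<^esub> rsmult M \<epsilon> I_e \<in> C"
  by (simp add: mem_closure)

lemma I_e_mem: "gen_cone C \<Longrightarrow> I_e \<in> C"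
  by (rule gen_cone_contraction) auto

lemma closure_supset: "gen_cone C \<Longrightarrow> C \<subseteq> arch_cl C"
  by (auto simp: mem_closure gen_cone_herm intro!: gen_cone_add gen_cone_rsmult I_e_mem)

lemma closure_is_cone:
  assumes C: "gen_cone C"
  shows "is_cone M (arch_cl C)"
  unfolding is_cone_def
proof (intro conjI ballI allI impI)
  show "arch_cl C \<subseteq> herm M" by (auto simp: mem_closure)
next
  fix x y assume x: "x \<in> arch_cl C" and y: "y \<in> arch_cl C"
  then have h: "x \<in> herm M" "y \<in> herm M" by (auto simp: mem_closure)
  show "x \<oplus>\<^bsub>M\<^esub> y \<in> arch_cl C"
    unfolding mem_closure
  proof (intro conjI allI impI)
    show "x \<oplus>\<^bsub>M\<^esub> y \<in> herm M" using h by (rule M.herm_add)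
    fix \<epsilon> :: real assume "\<epsilon> > 0"
    then have "(x \<oplus>\<^bsub>M\<^esub> rsmult M (\<epsilon>/2) I_e) \<oplus>\<^bsub>M\<^esub> (y \<oplus>\<^bsub>M\<^esub> rsmult M (\<epsilon>/2) I_e) \<in> C"
      using gen_cone_add[OF C closureD[OF x] closureD[OF y], of "\<epsilon>/2" "\<epsilon>/2"] by simp
    also have "(x \<oplus>\<^bsub>M\<^esub> rsmult M (\<epsilon>/2) I_e) \<oplus>\<^bsub>M\<^esub> (y \<oplus>\<^bsub>M\<^esub> rsmult M (\<epsilon>/2) I_e)
      = (x \<oplus>\<^bsub>M\<^esub> y) \<oplus>\<^bsub>M\<^esub> (rsmult M (\<epsilon>/2) I_e \<oplus>\<^bsub>M\<^esub> rsmult M (\<epsilon>/2) I_e)"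
      using h by (simp add: M.a_assoc M.a_lcomm)
    also have "rsmult M (\<epsilon>/2) I_e \<oplus>\<^bsub>M\<^esub> rsmult M (\<epsilon>/2) I_e = rsmult M \<epsilon> I_e"
      by (subst M.sm_add_left[symmetric]) auto
    finally show "x \<oplus>\<^bsub>M\<^esub> y \<oplus>\<^bsub>M\<^esub> rsmult M \<epsilon> I_e \<in> C" .
  qed
next
  fix x and r :: real assume r: "r \<ge> 0" and x: "x \<in> arch_cl C"
  then have h: "x \<in> herm M" by (auto simp: mem_closure)
  show "rsmult M r x \<in> arch_cl C"
  proof (cases "r = 0")
    case True
    then show ?thesis using closure_supset[OF C] gen_cone_zero[OF C] h by auto
  next
    case False
    then have r: "r > 0" using r by simp
    show ?thesis unfolding mem_closure
    proof (intro conjI allI impI)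
      show "rsmult M r x \<in> herm M" using h by (rule M.herm_rsmult)
      fix \<epsilon> :: real assume "\<epsilon> > 0"
      then have "rsmult M r (x \<oplus>\<^bsub>M\<^esub> rsmult M (\<epsilon>/r) I_e) \<in> C"
        using closureD[OF x, of "\<epsilon>/r"] r by (intro gen_cone_rsmult[OF C]) auto
      then show "rsmult M r x \<oplus>\<^bsub>M\<^esub> rsmult M \<epsilon> I_e \<in> C"
        using h r by (simp add: M.sm_add_right M.sm_mult del: of_real_divide flip: of_real_mult)
    qed
  qed
qed

lemma compress_I_e: "A \<in> Mat k \<Longrightarrow> compress V A I_e = tens V (sq A) (p 0)"
  by (simp add: compress_tens)

lemma closure_compress:
  assumes C: "gen_cone C" and G: "G \<in> Mat k" and x: "x \<in> arch_cl C"
  shows "compress V G x \<in> arch_cl C"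
  unfolding mem_closure
proof (intro conjI allI impI)
  have h: "x \<in> herm M" using x by (auto simp: mem_closure)
  then show "compress V G x \<in> herm M" by (rule compress_herm[OF G])
  obtain c P where c: "c > 0" and P: "P \<in> psd k" and GP: "sq G + P = c \<cdot>\<^sub>r 1\<^sub>m k"
    using gram_complement[OF G] by blast
  fix \<epsilon> :: real assume e: "\<epsilon> > 0"
  then have "compress V G (x \<oplus>\<^bsub>M\<^esub> rsmult M (\<epsilon>/c) I_e) \<oplus>\<^bsub>M\<^esub> rsmult M (\<epsilon>/c) (tens V P (p 0)) \<in> C"
    using c G P by (intro gen_cone_add[OF C _ gen_cone_rsmult[OF C]]
        gen_cone_compress[OF C _ closureD[OF x]] gen_cone_tens[OF C]) auto
  also have "compress V G (x \<oplus>\<^bsub>M\<^esub> rsmult M (\<epsilon>/c) I_e) \<oplus>\<^bsub>M\<^esub> rsmult M (\<epsilon>/c) (tens V P (p 0))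
    = compress V G x \<oplus>\<^bsub>M\<^esub> rsmult M (\<epsilon>/c) (tens V (sq G + P) (p 0))"
    using G h psd_carrier[OF P]
    by (simp add: compress_add compress_smult compress_I_e tens_add_left M.sm_add_right M.a_assoc)
  also have "rsmult M (\<epsilon>/c) (tens V (sq G + P) (p 0)) = rsmult M \<epsilon> I_e"
    unfolding GP rsmult_I_e[symmetric] using c by (simp add: M.sm_mult)
  finally show "compress V G x \<oplus>\<^bsub>M\<^esub> rsmult M \<epsilon> I_e \<in> C" .
qed

lemma gen_cone_closure:
  assumes "gen_cone C"
  shows "gen_cone (arch_cl C)"
  by (rule gen_cone_supset[OF assms closure_supset[OF assms] closure_is_cone[OF assms]])
    (rule closure_compress[OF assms])

lemma gen_cone_Union:
  fixes K :: "nat \<Rightarrow> 'v mat set"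
  assumes K: "\<And>n. gen_cone (K n)" and mono: "\<And>m n. m \<le> n \<Longrightarrow> K m \<subseteq> K n"
  shows "gen_cone (\<Union>n. K n)"
proof (rule gen_cone_supset[OF K[of 0]])
  show "K 0 \<subseteq> (\<Union>n. K n)" by blast
  show "is_cone M (\<Union>n. K n)"
    unfolding is_cone_def
  proof (intro conjI ballI allI impI)
    show "(\<Union>n. K n) \<subseteq> herm M" using gen_cone_herm[OF K] by blast
  next
    fix x y assume "x \<in> (\<Union>n. K n)" "y \<in> (\<Union>n. K n)"
    then obtain m n where "x \<in> K m" "y \<in> K n" by blast
    then have "x \<in> K (max m n)" "y \<in> K (max m n)" using mono[of m "max m n"] mono[of n "max m n"] by auto
    then show "x \<oplus>\<^bsub>M\<^esub> y \<in> (\<Union>n. K n)" using gen_cone_add[OF K] by blast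
  next
    fix x and r :: real assume "0 \<le> r" "x \<in> (\<Union>n. K n)"
    then show "rsmult M r x \<in> (\<Union>n. K n)" using gen_cone_rsmult[OF K] by blast
  qed
  fix A :: "complex mat" and x assume "A \<in> Mat k" "x \<in> (\<Union>n. K n)"
  then show "compress V A x \<in> (\<Union>n. K n)" using gen_cone_compress[OF K] by blast
qed

lemma closure_order_unit:
  assumes C: "gen_cone C"
  shows "archimedean_order_unit M (arch_cl C) I_e"
  unfolding archimedean_order_unit_def
proof (intro conjI ballI impI)
  show "I_e \<in> herm M" by (rule I_e_herm)
  fix x assume x: "x \<in> herm M"
  show "\<exists>r>0. rsmult M r I_e \<oplus>\<^bsub>M\<^esub> x \<in> arch_cl C"
    by (rule gen_cone_order_unit[OF gen_cone_closure[OF C] x])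
  assume cl: "\<forall>\<epsilon>>0. x \<oplus>\<^bsub>M\<^esub> rsmult M \<epsilon> I_e \<in> arch_cl C"
  show "x \<in> arch_cl C"
    unfolding mem_closure
  proof (intro conjI x allI impI)
    fix \<epsilon> :: real assume e: "\<epsilon> > 0"
    then have "x \<oplus>\<^bsub>M\<^esub> rsmult M (\<epsilon>/2) I_e \<oplus>\<^bsub>M\<^esub> rsmult M (\<epsilon>/2) I_e \<in> C"
      using cl half_gt_zero[OF e] unfolding mem_closure by blast
    also have "x \<oplus>\<^bsub>M\<^esub> rsmult M (\<epsilon>/2) I_e \<oplus>\<^bsub>M\<^esub> rsmult M (\<epsilon>/2) I_e
      = x \<oplus>\<^bsub>M\<^esub> (rsmult M (\<epsilon>/2) I_e \<oplus>\<^bsub>M\<^esub> rsmult M (\<epsilon>/2) I_e)"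
      using x by (simp add: M.a_assoc)
    also have "rsmult M (\<epsilon>/2) I_e \<oplus>\<^bsub>M\<^esub> rsmult M (\<epsilon>/2) I_e = rsmult M \<epsilon> I_e"
      by (subst M.sm_add_left[symmetric]) auto
    finally show "x \<oplus>\<^bsub>M\<^esub> rsmult M \<epsilon> I_e \<in> C" .
  qed
qed

end

context gen_space
begin

section \<open>Uniformity in the index of the iteration\<close>

subsection \<open>Bounded representations\<close>

text \<open>Coefficients are not unique, so the bound asks for some hermitian family with small entries. It serves as
a substitute for a norm on matrices over the space.\<close>

definition rep_bound :: "real \<Rightarrow> 'v mat \<Rightarrow> bool" where
  "rep_bound r z \<longleftrightarrow> (\<exists>Z. (\<forall>g\<in>{0..N}. Z g \<in> herm_mats k \<and> entry_bound r (Z g)) \<and> z = comb Z)"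

lemma rep_boundI:
  assumes "z = comb Z" "\<forall>g\<in>{0..N}. Z g \<in> herm_mats k \<and> entry_bound r (Z g)"
  shows "rep_bound r z"
  unfolding rep_bound_def using assms by (intro exI[of _ Z] conjI)

lemma rep_bound_exists:
  assumes "x \<in> herm M"
  obtains r where "0 \<le> r" "rep_bound r x"
proof -
  obtain Z where Z: "\<And>g. Z g \<in> herm_mats k" "x = comb Z" using herm_comb_exists[OF assms] by blast
  have "\<exists>r\<ge>0. entry_bound r (Z g)" for g by (rule entry_bound_exists)
  then obtain r where r: "\<And>g. 0 \<le> r g" "\<And>g. entry_bound (r g) (Z g)" by metis
  define R where "R = (\<Sum>g\<in>{0..N}. r g)"
  have R: "r g \<le> R" if "g \<in> {0..N}" for g
    using member_le_sum[of g "{0..N}" r] r that by (simp add: R_def)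
  have "rep_bound R x"
    unfolding rep_bound_def using Z entry_bound_mono[OF r(2) R] by blast
  moreover have "0 \<le> R" using r by (auto simp: R_def intro!: sum_nonneg)
  ultimately show ?thesis using that by blast
qed

lemma rep_bound_add:
  assumes "rep_bound r x" "rep_bound s y"
  shows "rep_bound (r + s) (x \<oplus>\<^bsub>M\<^esub> y)"
proof -
  obtain Z where Z: "\<forall>g\<in>{0..N}. Z g \<in> herm_mats k \<and> entry_bound r (Z g)" "x = comb Z"
    using assms(1) unfolding rep_bound_def by blast
  obtain Y where Y: "\<forall>g\<in>{0..N}. Y g \<in> herm_mats k \<and> entry_bound s (Y g)" "y = comb Y"
    using assms(2) unfolding rep_bound_def by blast
  have "x \<oplus>\<^bsub>M\<^esub> y = comb (\<lambda>g. Z g + Y g)"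
    unfolding Z(2) Y(2) using Z(1) Y(1) by (intro matcomb_add[symmetric]) auto
  moreover have "\<forall>g\<in>{0..N}. Z g + Y g \<in> herm_mats k \<and> entry_bound (r + s) (Z g + Y g)"
    using Z(1) Y(1) by (auto intro!: herm_mats_add entry_bound_add[of _ k])
  ultimately show ?thesis by (rule rep_boundI)
qed

lemma rep_bound_tens:
  assumes g: "g \<le> N" and P: "P \<in> herm_mats k" "entry_bound r P" and r: "0 \<le> r"
  shows "rep_bound r (tens V P (p g))"
proof -
  let ?Z = "\<lambda>h. if g = h then P else 0\<^sub>m k k"
  note Pc = herm_mats_carrier[OF P(1)]
  have "tens V P (p g) = comb ?Z"
  proof (rule M_eqI)
    fix i j assume ij: "i < k" "j < k"
    have "(\<Oplus>h\<in>{0..N}. ?Z h $$ (i, j) \<odot> p h) = (\<Oplus>h\<in>{0..N}. if g = h then P $$ (i, j) \<odot> p h else \<zero>)"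
      using ij by (intro finsum_cong') auto
    also have "\<dots> = P $$ (i, j) \<odot> p g"
      using g by (intro finsum_singleton) auto
    finally show "tens V P (p g) $$ (i, j) = comb ?Z $$ (i, j)"
      using ij Pc by (simp add: matcomb_def)
  qed (use Pc in \<open>auto simp: matcomb_def\<close>)
  moreover have "\<forall>h\<in>{0..N}. ?Z h \<in> herm_mats k \<and> entry_bound r (?Z h)"
    using P r by (auto simp: entry_bound_def)
  ultimately show ?thesis by (rule rep_boundI)
qed

lemma rep_bound_tens_compl:
  assumes g: "g \<le> N" and P: "P \<in> herm_mats k" "entry_bound r P" and r: "0 \<le> r"
  shows "rep_bound (r + r) (tens V P (p 0 \<ominus> p g))"
proof -
  let ?Q = "(- 1) \<cdot>\<^sub>r P"
  note Pc = herm_mats_carrier[OF P(1)]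
  have eq: "tens V P (p 0 \<ominus> p g) = tens V P (p 0) \<oplus>\<^bsub>M\<^esub> tens V ?Q (p g)"
    using g Pc by (intro M_eqI) (auto simp: minus_eq_sm sm_add_right sm_mult)
  have "?Q \<in> herm_mats k" by (rule herm_mats_rsmult[OF P(1)])
  moreover have "entry_bound r ?Q" using entry_bound_smult[OF Pc P(2), of "complex_of_real (- 1)"] by simp
  ultimately show ?thesis unfolding eq using g P r by (intro rep_bound_add rep_bound_tens le0)
qed

lemma rep_bound_compress:
  assumes x: "rep_bound r x" and A: "A \<in> Mat k" "entry_bound a A" and "0 \<le> r" "0 \<le> a"
  shows "rep_bound (real k * (real k * (a * r) * a)) (compress V A x)"
proof -
  obtain Z where Z: "\<forall>g\<in>{0..N}. Z g \<in> herm_mats k \<and> entry_bound r (Z g)" "x = comb Z"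
    using x unfolding rep_bound_def by blast
  have "compress V A x = comb (\<lambda>g. mat_adjoint A * Z g * A)"
    unfolding Z(2) using A Z(1) by (intro compress_matcomb) auto
  moreover have "\<forall>g\<in>{0..N}. mat_adjoint A * Z g * A \<in> herm_mats k
      \<and> entry_bound (real k * (real k * (a * r) * a)) (mat_adjoint A * Z g * A)"
    using Z(1) A assms(4,5)
    by (auto intro!: herm_mats_compress entry_bound_mult entry_bound_adjoint[of _ k])
  ultimately show ?thesis by (rule rep_boundI)
qed

text \<open>The bound does not depend on \<open>\<alpha>\<close> and \<open>\<beta>\<close>, as long as their entries are bounded by 1.\<close>

lemma rep_bound_proj_expr:
  assumes x: "x \<in> herm M" and i: "i \<le> N" and "0 \<le> \<epsilon>" "0 \<le> t"
  obtains R where "\<And>A B. A \<in> Mat k \<Longrightarrow> B \<in> Mat k \<Longrightarrow> entry_bound 1 A \<Longrightarrow> entry_bound 1 B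
    \<Longrightarrow> rep_bound R (proj_expr i \<epsilon> t A B x)"
proof -
  obtain r where r: "0 \<le> r" "rep_bound r x" using rep_bound_exists[OF x] by blast
  define s where "s = \<epsilon> * (real k * (1 * 1)) + t * (real k * (1 * 1))"
  have s0: "0 \<le> s" using assms by (simp add: s_def)
  have W: "\<epsilon> \<cdot>\<^sub>r sq A + t \<cdot>\<^sub>r sq B \<in> herm_mats k"
    "entry_bound s (\<epsilon> \<cdot>\<^sub>r sq A + t \<cdot>\<^sub>r sq B)"
    if A: "A \<in> Mat k" "entry_bound 1 A" and B: "B \<in> Mat k" "entry_bound 1 B" for A B
  proof -
    have g: "entry_bound (c * (real k * (1 * 1))) (c \<cdot>\<^sub>r sq D)"
      if "D \<in> Mat k" "entry_bound 1 D" "0 \<le> c" for D and c :: real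
    proof -
      have "entry_bound (real k * (1 * 1)) (sq D)"
        using that by (intro entry_bound_mult entry_bound_adjoint[of _ k]) auto
      then show ?thesis
        using entry_bound_smult[of "sq D" k "real k * (1 * 1)" "complex_of_real c"] that by simp
    qed
    show "\<epsilon> \<cdot>\<^sub>r sq A + t \<cdot>\<^sub>r sq B \<in> herm_mats k"
      using A B by (intro herm_mats_add herm_mats_rsmult herm_mats_gram)
    show "entry_bound s (\<epsilon> \<cdot>\<^sub>r sq A + t \<cdot>\<^sub>r sq B)"
      unfolding s_def using A B assms by (intro entry_bound_add[of _ k] g) auto
  qed
  show ?thesis
  proof (rule that)
    fix A B :: "complex mat"
    assume AB: "A \<in> Mat k" "B \<in> Mat k" "entry_bound 1 A" "entry_bound 1 B"
    have "entry_bound (1 + 1) (A + B)" using AB by (intro entry_bound_add[of _ k])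
    then have "rep_bound (real k * (real k * ((1 + 1) * r) * (1 + 1))) (compress V (A + B) x)"
      using AB r by (intro rep_bound_compress) auto
    then show "rep_bound (real k * (real k * ((1 + 1) * r) * (1 + 1)) + s + (s + s)) (proj_expr i \<epsilon> t A B x)"
      unfolding proj_expr_def using AB i s0
      by (intro rep_bound_add rep_bound_tens rep_bound_tens_compl W)
  qed
qed

subsection \<open>A uniform level\<close>

text \<open>In a set of elements with bounded coefficients there are finitely many such that each other element is within \<open>\<delta> / 2\<close>
of one of them. Perturbing these finitely many by \<open>\<delta> / 2\<close> puts them into a common \<open>K\<^sub>n\<close>. The approximating elements
are taken from the set itself, since only its members are known to be in the closure.\<close>

lemma uniform_level:
  assumes K: "\<And>n. gen_cone (K n)" and mono: "\<And>m n :: nat. m \<le> n \<Longrightarrow> K m \<subseteq> K n" and \<delta>: "0 < \<delta>"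
  shows "\<exists>n. \<forall>z\<in>arch_cl (\<Union>n. K n).
    rep_bound r z \<longrightarrow> z \<oplus>\<^bsub>M\<^esub> rsmult M \<delta> I_e \<in> K n"
proof -
  define S where "S = {z \<in> arch_cl (\<Union>n. K n). rep_bound r z}"
  have "\<exists>Z. z \<in> S \<longrightarrow> (\<forall>g\<in>{0..N}. Z g \<in> herm_mats k \<and> entry_bound r (Z g)) \<and> z = comb Z" for z
    unfolding S_def rep_bound_def by blast
  then obtain Z where Z: "\<And>z. z \<in> S \<Longrightarrow> (\<forall>g\<in>{0..N}. Z z g \<in> herm_mats k \<and> entry_bound r (Z z g)) \<and> z = comb (Z z)"
    by metis
  define c where "c = real (card {0..N}) * (real k * 2)"
  have c: "0 < c" using k_pos by (simp add: c_def)
  \<comment> \<open>Coefficients within \<open>2\<eta>\<close> of each other change an element by at most \<open>\<delta> / 2\<close> in the order.\<close>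
  define \<eta> where "\<eta> = \<delta> / 2 / c"
  have \<eta>: "0 < \<eta>" using \<delta> c by (simp add: \<eta>_def)
  define I where "I = {0..N} \<times> {..<k} \<times> {..<k}"
  obtain S0 where S0: "finite S0" "S0 \<subseteq> S"
    and close: "\<And>z. z \<in> S \<Longrightarrow> \<exists>z0\<in>S0. \<forall>i\<in>I. cmod ((case i of (g, ab) \<Rightarrow> Z z g $$ ab) - (case i of (g, ab) \<Rightarrow> Z z0 g $$ ab)) \<le> 2 * \<eta>"
  proof (rule finite_approximation[of I S "\<lambda>z (g, ab). Z z g $$ ab" r \<eta>])
    show "finite I" by (simp add: I_def)
    fix z i assume z: "z \<in> S" and i: "i \<in> I"
    obtain g a b where iab: "i = (g, a, b)" "g \<in> {0..N}" "a < k" "b < k" using i by (auto simp: I_def)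
    have "Z z g \<in> Mat k" "entry_bound r (Z z g)" using Z[OF z] iab(2) by auto
    then show "cmod (case i of (g, ab) \<Rightarrow> Z z g $$ ab) \<le> r" using iab by (auto simp: entry_bound_def)
  qed (use \<eta> in auto)
  have "\<exists>n. z \<in> S0 \<longrightarrow> z \<oplus>\<^bsub>M\<^esub> rsmult M (\<delta>/2) I_e \<in> K n" for z
    using S0(2) closureD[of z "\<Union>n. K n" "\<delta>/2"] \<delta> unfolding S_def by auto
  then obtain n where n: "\<And>z. z \<in> S0 \<Longrightarrow> z \<oplus>\<^bsub>M\<^esub> rsmult M (\<delta>/2) I_e \<in> K (n z)" by metis
  \<comment> \<open>A sum instead of a maximum, so that the empty set needs no separate treatment.\<close>
  define m where "m = (\<Sum>z\<in>S0. n z)"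
  have nm: "n z \<le> m" if "z \<in> S0" for z
    using member_le_sum[of z S0 n] that S0(1) by (simp add: m_def)
  show ?thesis
  proof (intro exI[of _ m] ballI impI)
    fix z assume "z \<in> arch_cl (\<Union>n. K n)" "rep_bound r z"
    then have z: "z \<in> S" by (simp add: S_def)
    obtain z0 where z0: "z0 \<in> S0" and cl: "\<forall>i\<in>I. cmod ((case i of (g, ab) \<Rightarrow> Z z g $$ ab) - (case i of (g, ab) \<Rightarrow> Z z0 g $$ ab)) \<le> 2 * \<eta>"
      using close[OF z] by blast
    have z0S: "z0 \<in> S" using z0 S0 by blast
    define H where "H g = Z z g + (- 1) \<cdot>\<^sub>r Z z0 g" for g
    have Zc: "Z z g \<in> Mat k" "Z z0 g \<in> Mat k" if "g \<in> {0..N}" for g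
      using Z[OF z] Z[OF z0S] that by auto
    have H: "H g \<in> herm_mats k \<and> entry_bound (2 * \<eta>) (H g)" if g: "g \<in> {0..N}" for g
    proof
      show "H g \<in> herm_mats k"
        unfolding H_def using Z[OF z] Z[OF z0S] g by (intro herm_mats_add herm_mats_rsmult) auto
      show "entry_bound (2 * \<eta>) (H g)"
        unfolding entry_bound_def
      proof (intro allI impI)
        fix a b assume "a < dim_row (H g)" "b < dim_col (H g)"
        then have ab: "a < k" "b < k" using Zc[OF g] by (auto simp: H_def)
        have "cmod (Z z g $$ (a, b) - Z z0 g $$ (a, b)) \<le> 2 * \<eta>"
          using cl[rule_format, of "(g, a, b)"] g ab by (simp add: I_def)
        then show "cmod (H g $$ (a, b)) \<le> 2 * \<eta>" using ab Zc[OF g] by (simp add: H_def)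
      qed
    qed
    have Hc: "comb H \<oplus>\<^bsub>M\<^esub> rsmult M (real (card {0..N}) * (real k * (2 * \<eta>))) I_e \<in> K m"
      using H \<eta> by (intro comb_dominated[OF K]) auto
    have "real (card {0..N}) * (real k * (2 * \<eta>)) = c * \<eta>" by (simp add: c_def)
    also have "\<dots> = \<delta> / 2" using c by (simp add: \<eta>_def)
    finally have Hc': "comb H \<oplus>\<^bsub>M\<^esub> rsmult M (\<delta>/2) I_e \<in> K m" using Hc by (simp only:)
    have z0K: "z0 \<oplus>\<^bsub>M\<^esub> rsmult M (\<delta>/2) I_e \<in> K m" using n[OF z0] mono[OF nm[OF z0]] by blast
    have "z = comb (\<lambda>g. Z z0 g + H g)"
    proof -
      have "comb (Z z) = comb (\<lambda>g. Z z0 g + H g)"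
      proof (rule matcomb_cong)
        fix h assume h: "h \<in> {0..N}"
        show "Z z h = Z z0 h + H h"
          using Zc[OF h] by (intro eq_matI) (auto simp: H_def)
      qed auto
      then show ?thesis using Z[OF z] by simp
    qed
    also have "\<dots> = comb (Z z0) \<oplus>\<^bsub>M\<^esub> comb H"
      using Zc H by (intro matcomb_add) auto
    also have "comb (Z z0) = z0" using Z[OF z0S] by simp
    finally have zH: "z = z0 \<oplus>\<^bsub>M\<^esub> comb H" .
    have z0c: "z0 \<in> carrier M" using z0S by (auto simp: S_def mem_closure)
    have "rsmult M \<delta> I_e = rsmult M (\<delta>/2) I_e \<oplus>\<^bsub>M\<^esub> rsmult M (\<delta>/2) I_e"
      by (subst M.sm_add_left[symmetric]) auto
    then have "z \<oplus>\<^bsub>M\<^esub> rsmult M \<delta> I_e = (z0 \<oplus>\<^bsub>M\<^esub> rsmult M (\<delta>/2) I_e) \<oplus>\<^bsub>M\<^esub> (comb H \<oplus>\<^bsub>M\<^esub> rsmult M (\<delta>/2) I_e)"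
      using z0c unfolding zH by (simp add: M.a_assoc M.a_lcomm)
    then show "z \<oplus>\<^bsub>M\<^esub> rsmult M \<delta> I_e \<in> K m"
      using gen_cone_add[OF K z0K Hc'] by (simp only:)
  qed
qed

text \<open>By orthonormalisation, a level that works for pairs with entries bounded by 1 works for all pairs, with the
perturbation \<open>\<delta> (\<alpha>\<^sup>*\<alpha> + \<beta>\<^sup>*\<beta>) \<otimes> e\<close> in place of \<open>\<delta> I \<otimes> e\<close>.\<close>

lemma uniform_proj_level:
  assumes K: "\<And>n. gen_cone (K n)" and mono: "\<And>m n :: nat. m \<le> n \<Longrightarrow> K m \<subseteq> K n" and \<delta>: "0 < \<delta>"
    and x: "x \<in> herm M" and i: "i \<le> N" and "0 \<le> \<epsilon>" "0 \<le> t"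
    and pos: "\<And>A B. A \<in> Mat k \<Longrightarrow> B \<in> Mat k
      \<Longrightarrow> proj_expr i \<epsilon> t A B x \<in> arch_cl (\<Union>n. K n)"
  shows "\<exists>n. \<forall>A\<in>Mat k. \<forall>B\<in>Mat k.
      proj_expr i \<epsilon> t A B x \<oplus>\<^bsub>M\<^esub> rsmult M \<delta> (tens V (sq A + sq B) (p 0)) \<in> K n"
proof -
  obtain R where R: "\<And>A B. A \<in> Mat k \<Longrightarrow> B \<in> Mat k \<Longrightarrow> entry_bound 1 A \<Longrightarrow> entry_bound 1 B
    \<Longrightarrow> rep_bound R (proj_expr i \<epsilon> t A B x)"
    using rep_bound_proj_expr[OF x i assms(6,7)] by blast
  obtain n where n: "\<forall>z\<in>arch_cl (\<Union>n. K n).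
      rep_bound R z \<longrightarrow> z \<oplus>\<^bsub>M\<^esub> rsmult M \<delta> I_e \<in> K n"
    by (rule exE[OF uniform_level[OF K mono \<delta>, where r = R]])
  show ?thesis
  proof (intro exI[of _ n] ballI)
    fix A B :: "complex mat" assume A: "A \<in> Mat k" and B: "B \<in> Mat k"
    obtain A' B' T where A': "A' \<in> Mat k" "entry_bound 1 A'" and B': "B' \<in> Mat k" "entry_bound 1 B'"
      and T: "T \<in> Mat k" and AT: "A = A' * T" and BT: "B = B' * T"
      and TT: "sq A + sq B = sq T"
      by (rule pair_orthonormalise[OF A B])
    let ?z = "proj_expr i \<epsilon> t A' B' x"
    have "compress V T (?z \<oplus>\<^bsub>M\<^esub> rsmult M \<delta> I_e) \<in> K n"
      by (intro gen_cone_compress[OF K T] n[rule_format] pos R A' B')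
    also have "compress V T (?z \<oplus>\<^bsub>M\<^esub> rsmult M \<delta> I_e)
       = proj_expr i \<epsilon> t A B x \<oplus>\<^bsub>M\<^esub> rsmult M \<delta> (tens V (sq T) (p 0))"
      using T A'(1) B'(1) i x
      by (simp add: compress_add compress_smult compress_I_e compress_proj_expr AT BT)
    finally show "proj_expr i \<epsilon> t A B x \<oplus>\<^bsub>M\<^esub> rsmult M \<delta> (tens V (sq A + sq B) (p 0)) \<in> K n"
      unfolding TT .
  qed
qed

text \<open>This is \<open>(\<alpha> + \<beta>)\<^sup>*(\<alpha> + \<beta>) + \<beta>\<^sup>*\<beta> = \<alpha>\<^sup>*\<alpha> / 2 + (\<alpha> + 2\<beta>)\<^sup>*(\<alpha> + 2\<beta>) / 2\<close>, multiplied by \<open>4\<epsilon>\<close>, with the terms that occur in the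
next lemma added on both sides.\<close>

lemma gram_shift:
  fixes A B :: "complex mat"
  assumes "A \<in> Mat k" "B \<in> Mat k"
  shows "(4 * \<epsilon>) \<cdot>\<^sub>r sq (A + B)
      + (\<epsilon>' \<cdot>\<^sub>r sq A + (t + 5 * \<epsilon>) \<cdot>\<^sub>r sq B)
    = (\<epsilon> \<cdot>\<^sub>r sq A + t \<cdot>\<^sub>r sq B)
      + \<epsilon> \<cdot>\<^sub>r (sq A + sq B)
      + ((2 * \<epsilon>) \<cdot>\<^sub>r sq (A + 2 \<cdot>\<^sub>m B) + \<epsilon>' \<cdot>\<^sub>r sq A)"
    (is "?L = ?R")
proof (rule eq_matI)
  fix i j assume "i < dim_row ?R" "j < dim_col ?R"
  then have ij: "i < k" "j < k" using assms by auto
  have g: "sq C $$ (i, j) = (\<Sum>l<k. cnj (C $$ (l, i)) * C $$ (l, j))"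
    if "C \<in> Mat k" for C :: "complex mat"
    using that ij by (simp add: mult_index[of _ k] del: index_mult_mat(1))
  have c: "A + B \<in> Mat k" "A + 2 \<cdot>\<^sub>m B \<in> Mat k" using assms by auto
  have a: "(A + B) $$ (l, j') = A $$ (l, j') + B $$ (l, j')" "(A + 2 \<cdot>\<^sub>m B) $$ (l, j') = A $$ (l, j') + 2 * B $$ (l, j')"
    if "l < k" "j' < k" for l j' using that assms by auto
  define x where "x = (\<Sum>l<k. cnj (A $$ (l, i)) * A $$ (l, j))"
  define y where "y = (\<Sum>l<k. cnj (B $$ (l, i)) * B $$ (l, j))"
  define w where "w = (\<Sum>l<k. cnj (A $$ (l, i)) * B $$ (l, j) + cnj (B $$ (l, i)) * A $$ (l, j))"
  have s1: "sq (A + B) $$ (i, j) = x + w + y"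
    unfolding g[OF c(1)] x_def y_def w_def sum.distrib[symmetric]
    using ij by (intro sum.cong) (auto simp: a algebra_simps)
  have s2: "sq (A + 2 \<cdot>\<^sub>m B) $$ (i, j) = x + 2 * w + 4 * y"
    unfolding g[OF c(2)] x_def y_def w_def sum.distrib[symmetric] sum_distrib_left
    using ij by (intro sum.cong) (auto simp: a algebra_simps)
  have s3: "sq A $$ (i, j) = x" "sq B $$ (i, j) = y"
    using g[OF assms(1)] g[OF assms(2)] by (simp_all add: x_def y_def)
  show "?L $$ (i, j) = ?R $$ (i, j)"
    using assms ij by (simp add: s1 s2 s3 algebra_simps del: index_mult_mat(1))
qed (use assms in auto)

text \<open>Adding \<open>4\<epsilon> I \<otimes> e\<close> to \<open>x\<close> contributes \<open>4\<epsilon> (\<alpha> + \<beta>)\<^sup>*(\<alpha> + \<beta>)\<close> to the coefficients of both \<open>p\<close> and its complement. By the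
previous lemma it dominates \<open>2\<epsilon> \<alpha>\<^sup>*\<alpha> - 4\<epsilon> \<beta>\<^sup>*\<beta>\<close> at \<open>p\<close> and the same with exchanged roles at the complement. The positive part
absorbs the coefficient \<open>\<epsilon>\<close> and the perturbation, so an arbitrarily small \<open>\<epsilon>'\<close> suffices; the
negative part and the perturbation are compensated by enlarging \<open>t\<close> to \<open>t + 5\<epsilon>\<close>.\<close>

lemma shifted_in_proj_cone:
  assumes D: "gen_cone D" and x: "x \<in> herm M" and i: "i \<le> N" and \<epsilon>: "0 < \<epsilon>" and t: "0 < t"
    and pos: "\<And>A B. A \<in> Mat k \<Longrightarrow> B \<in> Mat k \<Longrightarrow>
      proj_expr i \<epsilon> t A B x \<oplus>\<^bsub>M\<^esub> rsmult M \<epsilon> (tens V (sq A + sq B) (p 0)) \<in> D"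
  shows "x \<oplus>\<^bsub>M\<^esub> rsmult M (4 * \<epsilon>) I_e \<in> pcone D i"
  unfolding mem_proj_cone
proof (intro conjI allI impI)
  show "x \<oplus>\<^bsub>M\<^esub> rsmult M (4 * \<epsilon>) I_e \<in> herm M" by (intro M.herm_add M.herm_rsmult x I_e_herm)
  fix \<epsilon>' :: real assume e': "\<epsilon>' > 0"
  show "\<exists>t>0. \<forall>A\<in>Mat k. \<forall>B\<in>Mat k. proj_expr i \<epsilon>' t A B (x \<oplus>\<^bsub>M\<^esub> rsmult M (4 * \<epsilon>) I_e) \<in> D"
  proof (intro exI[of _ "t + 5 * \<epsilon>"] conjI ballI)
    fix A B :: "complex mat" assume A: "A \<in> Mat k" and B: "B \<in> Mat k"
    define G where "G = (4 * \<epsilon>) \<cdot>\<^sub>r sq (A + B)"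
    define W where "W e s C C' = e \<cdot>\<^sub>r sq C + s \<cdot>\<^sub>r sq C'"
      for e s :: real and C C' :: "complex mat"
    define Y where "Y = \<epsilon> \<cdot>\<^sub>r (sq A + sq B)"
    define R where "R C C' = (2 * \<epsilon>) \<cdot>\<^sub>r sq (C + 2 \<cdot>\<^sub>m C') + \<epsilon>' \<cdot>\<^sub>r sq C"
      for C C' :: "complex mat"
    have R: "R C C' \<in> psd k" if "C \<in> Mat k" "C' \<in> Mat k" for C C'
      unfolding R_def using that \<epsilon> e' by (intro weighted_grams_psd) auto
    have c: "G \<in> Mat k" "Y \<in> Mat k" "W e s A B \<in> Mat k" "W e s B A \<in> Mat k"
      "R A B \<in> Mat k" "R B A \<in> Mat k" for e s
      using A B R by (auto simp: G_def Y_def W_def)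
    have e1: "G + W \<epsilon>' (t + 5 * \<epsilon>) A B = W \<epsilon> t A B + Y + R A B"
      unfolding G_def W_def Y_def R_def by (rule gram_shift[OF A B])
    have AB: "A + B = B + A" using A B by (rule comm_add_mat)
    have YC: "sq A + sq B = sq B + sq A"
      using A B by (intro comm_add_mat[of _ k k]) auto
    have e2: "G + W \<epsilon>' (t + 5 * \<epsilon>) B A = W \<epsilon> t B A + Y + R B A"
      unfolding G_def W_def Y_def R_def AB YC by (rule gram_shift[OF B A])
    have xc: "x \<in> carrier M" using x by auto
    have "compress V (A + B) (x \<oplus>\<^bsub>M\<^esub> rsmult M (4 * \<epsilon>) I_e) = compress V (A + B) x \<oplus>\<^bsub>M\<^esub> tens V G (p 0)"
    proof -
      have "compress V (A + B) (rsmult M (4 * \<epsilon>) I_e) = tens V G (p 0)"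
        unfolding G_def using A B by (subst compress_smult) (auto simp: compress_I_e tens_smult)
      then show ?thesis using A B xc by (subst compress_add) auto
    qed
    also have "tens V G (p 0) = tens V G (p i) \<oplus>\<^bsub>M\<^esub> tens V G (p 0 \<ominus> p i)"
      using c i by (intro tens_unit_split) auto
    finally have "proj_expr i \<epsilon>' (t + 5 * \<epsilon>) A B (x \<oplus>\<^bsub>M\<^esub> rsmult M (4 * \<epsilon>) I_e)
      = compress V (A + B) x \<oplus>\<^bsub>M\<^esub> tens V (G + W \<epsilon>' (t + 5 * \<epsilon>) A B) (p i)
        \<oplus>\<^bsub>M\<^esub> tens V (G + W \<epsilon>' (t + 5 * \<epsilon>) B A) (p 0 \<ominus> p i)"
      unfolding proj_expr_def W_def[symmetric]
      using A B xc c i by (simp add: tens_add_left M.a_assoc M.a_lcomm)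
    also have "\<dots> = (compress V (A + B) x \<oplus>\<^bsub>M\<^esub> tens V (W \<epsilon> t A B) (p i) \<oplus>\<^bsub>M\<^esub> tens V (W \<epsilon> t B A) (p 0 \<ominus> p i)
        \<oplus>\<^bsub>M\<^esub> (tens V Y (p i) \<oplus>\<^bsub>M\<^esub> tens V Y (p 0 \<ominus> p i)))
        \<oplus>\<^bsub>M\<^esub> tens V (R A B) (p i) \<oplus>\<^bsub>M\<^esub> tens V (R B A) (p 0 \<ominus> p i)"
      unfolding e1 e2 using A B xc c i by (simp add: tens_add_left M.a_assoc M.a_lcomm)
    also have "tens V Y (p i) \<oplus>\<^bsub>M\<^esub> tens V Y (p 0 \<ominus> p i) = tens V Y (p 0)"
      using c i by (intro tens_unit_split[symmetric]) auto
    also have "tens V Y (p 0) = rsmult M \<epsilon> (tens V (sq A + sq B) (p 0))"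
      using A B by (simp add: tens_smult Y_def)
    also have "compress V (A + B) x \<oplus>\<^bsub>M\<^esub> tens V (W \<epsilon> t A B) (p i) \<oplus>\<^bsub>M\<^esub> tens V (W \<epsilon> t B A) (p 0 \<ominus> p i)
      = proj_expr i \<epsilon> t A B x" unfolding proj_expr_def W_def ..
    also have "proj_expr i \<epsilon> t A B x \<oplus>\<^bsub>M\<^esub> rsmult M \<epsilon> (tens V (sq A + sq B) (p 0))
        \<oplus>\<^bsub>M\<^esub> tens V (R A B) (p i) \<oplus>\<^bsub>M\<^esub> tens V (R B A) (p 0 \<ominus> p i) \<in> D"
      by (intro gen_cone_add[OF D] gen_cone_tens[OF D i] R A B pos)
    finally show "proj_expr i \<epsilon>' (t + 5 * \<epsilon>) A B (x \<oplus>\<^bsub>M\<^esub> rsmult M (4 * \<epsilon>) I_e) \<in> D" .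
  qed (use t \<epsilon> in simp)
qed

theorem proj_cone_closure_Union:
  assumes K: "\<And>n. gen_cone (K n)" and mono: "\<And>m n :: nat. m \<le> n \<Longrightarrow> K m \<subseteq> K n"
    and i: "i \<le> N" and cofinal: "\<And>n. \<exists>m. pcone (K n) i \<subseteq> K m"
  defines "E \<equiv> arch_cl (\<Union>n. K n)"
  shows "pcone E i = E"
proof (rule antisym)
  have "gen_cone E" unfolding E_def by (intro gen_cone_closure gen_cone_Union K mono)
  then show "E \<subseteq> pcone E i" using i by (rule proj_cone_supset)
  show "pcone E i \<subseteq> E"
  proof
    fix x assume x: "x \<in> pcone E i"
    then have h: "x \<in> herm M" by (simp add: mem_proj_cone)
    have "\<exists>m. x \<oplus>\<^bsub>M\<^esub> rsmult M \<delta> I_e \<in> K m" if "\<delta> > 0" for \<delta>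
    proof -
      define \<epsilon> where "\<epsilon> = \<delta> / 4"
      have e: "0 < \<epsilon>" "\<delta> = 4 * \<epsilon>" using that by (simp_all add: \<epsilon>_def)
      obtain t where t: "t > 0"
        and pos: "\<forall>A\<in>Mat k. \<forall>B\<in>Mat k. proj_expr i \<epsilon> t A B x \<in> E"
        using x e(1) unfolding mem_proj_cone by blast
      have "\<exists>n. \<forall>A\<in>Mat k. \<forall>B\<in>Mat k.
        proj_expr i \<epsilon> t A B x \<oplus>\<^bsub>M\<^esub> rsmult M \<epsilon> (tens V (sq A + sq B) (p 0)) \<in> K n"
        using e t pos by (intro uniform_proj_level[OF K mono e(1) h i]) (auto simp: E_def)
      then obtain n where n: "\<forall>A\<in>Mat k. \<forall>B\<in>Mat k.
        proj_expr i \<epsilon> t A B x \<oplus>\<^bsub>M\<^esub> rsmult M \<epsilon> (tens V (sq A + sq B) (p 0)) \<in> K n"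
        by (rule exE)
      have "x \<oplus>\<^bsub>M\<^esub> rsmult M (4 * \<epsilon>) I_e \<in> pcone (K n) i"
        by (rule shifted_in_proj_cone[OF K h i e(1) t n[rule_format]])
      then show ?thesis using cofinal[of n] unfolding e(2) by blast
    qed
    then show "x \<in> E" unfolding E_def mem_closure using h by blast
  qed
qed

end

section \<open>The projection cone\<close>

context matrix_space
begin

lemma matcomb_cong_gens:
  assumes "\<And>h. h \<in> F \<Longrightarrow> b' h \<in> carrier V" "\<And>h. h \<in> F \<Longrightarrow> b h = b' h" "\<And>h. h \<in> F \<Longrightarrow> Z h = Z' h"
  shows "matcomb b F Z = matcomb b' F Z'"
  using assms by (intro eq_matI) (auto simp: matcomb_def intro!: finsum_cong')

lemma matcomb_append:
  assumes "\<And>h. h < m + n \<Longrightarrow> b h \<in> carrier V" "\<And>h. h < m + n \<Longrightarrow> Z h \<in> Mat k"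
  shows "matcomb b {..<m + n} Z = matcomb b {..<m} Z \<oplus>\<^bsub>M\<^esub> matcomb (\<lambda>i. b (m + i)) {..<n} (\<lambda>i. Z (m + i))"
  using assms
proof (induction n)
  case 0
  then have "matcomb b {..<m} Z \<in> carrier M" by (intro matcomb_closed) auto
  then show ?case by simp
next
  case (Suc n)
  have c: "matcomb b {..<m} Z \<in> carrier M" "matcomb (\<lambda>i. b (m + i)) {..<n} (\<lambda>i. Z (m + i)) \<in> carrier M"
    using Suc.prems(1) by (auto intro!: matcomb_closed)
  have "matcomb b {..<m + Suc n} Z = tens V (Z (m + n)) (b (m + n)) \<oplus>\<^bsub>M\<^esub> matcomb b {..<m + n} Z"
    unfolding add_Suc_right lessThan_Suc using Suc.prems by (intro matcomb_insert) auto
  moreover have "matcomb (\<lambda>i. b (m + i)) {..<Suc n} (\<lambda>i. Z (m + i))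
    = tens V (Z (m + n)) (b (m + n)) \<oplus>\<^bsub>M\<^esub> matcomb (\<lambda>i. b (m + i)) {..<n} (\<lambda>i. Z (m + i))"
    unfolding lessThan_Suc using Suc.prems by (intro matcomb_insert) auto
  moreover have "tens V (Z (m + n)) (b (m + n)) \<in> carrier M"
    using Suc.prems by (intro tens_closed) auto
  ultimately show ?case using Suc c by (simp add: M.a_lcomm)
qed

text \<open>The matrix \<open>r\<^sup>*r\<close> for the row \<open>r\<close> of \<open>A\<close> with index \<open>l\<close>. Here \<open>A\<close> may have any number of rows.\<close>

definition row_gram :: "complex mat \<Rightarrow> nat \<Rightarrow> complex mat" where
  "row_gram A l = mat k k (\<lambda>(i, j). cnj (A $$ (l, i)) * A $$ (l, j))"

lemma row_gram_psd: "row_gram A l \<in> psd k"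
  unfolding row_gram_def by (rule psd_rank_one)

lemma row_gram_carrier [simp]: "row_gram A l \<in> Mat k"
  by (rule psd_carrier[OF row_gram_psd])

lemma row_gram_compress:
  assumes A: "A \<in> carrier_mat m k" and B: "B \<in> Mat k" and l: "l < m"
  shows "mat_adjoint B * row_gram A l * B = row_gram (A * B) l"
proof (rule eq_matI)
  fix i j assume "i < dim_row (row_gram (A * B) l)" "j < dim_col (row_gram (A * B) l)"
  then have ij: "i < k" "j < k" by (auto simp: row_gram_def)
  have AB: "(A * B) $$ (l, j) = (\<Sum>b<k. A $$ (l, b) * B $$ (b, j))" if "j < k" for j
    using A B l that by (auto simp: scalar_prod_def atLeast0LessThan)
  have "(mat_adjoint B * row_gram A l * B) $$ (i, j)
    = (\<Sum>b<k. (\<Sum>a<k. cnj (B $$ (a, i)) * (cnj (A $$ (l, a)) * A $$ (l, b))) * B $$ (b, j))"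
    using B ij by (simp add: mult_index[of _ k] row_gram_def del: index_mult_mat(1))
  also have "\<dots> = cnj ((A * B) $$ (l, i)) * (A * B) $$ (l, j)"
    unfolding AB[OF ij(1)] AB[OF ij(2)] cnj_sum sum_product
    by (subst sum.swap) (simp add: sum_distrib_right sum_distrib_left mult_ac)
  finally show "(mat_adjoint B * row_gram A l * B) $$ (i, j) = row_gram (A * B) l $$ (i, j)"
    using ij by (simp add: row_gram_def)
qed (use B in \<open>auto simp: row_gram_def\<close>)

text \<open>A compression of a diagonal matrix is the sum of the tensors of the diagonal entries with the squares of the rows. This removes
rectangular matrices from all further arguments.\<close>

lemma mem_D_max:
  assumes "\<And>v. v \<in> cone_E V N e q \<Longrightarrow> v \<in> carrier V"
  shows "X \<in> D_max V N e q k \<longleftrightarrow> (\<exists>m A s. 1 \<le> m \<and> A \<in> carrier_mat m k \<and> (\<forall>i<m. s i \<in> cone_E V N e q)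
    \<and> X = matcomb s {..<m} (row_gram A))"
proof -
  have "compress V A (diag_of V m s) = matcomb s {..<m} (row_gram A)"
    if "A \<in> carrier_mat m k" "\<forall>i<m. s i \<in> cone_E V N e q" for m A s
    using compress_diag[OF that(1), of s] that(2) assms unfolding row_gram_def by auto
  then show ?thesis unfolding D_max_def by (auto; metis)
qed

end

context gen_space
begin

lemma finsum_indicator:
  assumes "g \<in> {1..N}" "\<And>i. i \<in> {1..N} \<Longrightarrow> b i \<in> carrier V"
  shows "(\<Oplus>i\<in>{1..N}. rsmult V (if i = g then 1 else 0) (b i)) = b g"
proof -
  have "(\<Oplus>i\<in>{1..N}. rsmult V (if i = g then 1 else 0) (b i)) = (\<Oplus>i\<in>{1..N}. if g = i then b i else \<zero>)"
    using assms by (intro finsum_cong') auto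
  also have "\<dots> = b g" using assms by (intro finsum_singleton) auto
  finally show ?thesis .
qed

lemma finsum_null:
  assumes "\<And>i. i \<in> {1..N} \<Longrightarrow> b i \<in> carrier V"
  shows "(\<Oplus>i\<in>{1..N}. rsmult V 0 (b i)) = \<zero>"
  using assms by (simp cong: finsum_cong)

lemma cone_E_herm: "v \<in> cone_e \<Longrightarrow> v \<in> herm V"
  by (simp add: cone_E_def archimedean_closure_def)

text \<open>The set \<open>E\<close> requires membership only after adding a multiple of \<open>e\<close>, which is the unit part of a combination
with a single coefficient 1.\<close>

lemma gens_in_cone_E:
  assumes "g \<in> {1..N}"
  shows "p g \<in> cone_e" "p 0 \<ominus> p g \<in> cone_e"
proof -
  let ?i = "\<lambda>i. if i = g then 1 else 0 :: real"
  have c: "p i \<in> carrier V" "p 0 \<ominus> p i \<in> carrier V" if "i \<in> {1..N}" for i using that by auto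
  have g: "p g \<in> carrier V" "p 0 \<ominus> p g \<in> carrier V" using c assms by auto
  have ind: "(\<Oplus>i\<in>{1..N}. rsmult V (?i i) (p i)) = p g" "(\<Oplus>i\<in>{1..N}. rsmult V (?i i) (p 0 \<ominus> p i)) = p 0 \<ominus> p g"
    by (rule finsum_indicator[OF assms]; rule c; assumption)+
  have null: "(\<Oplus>i\<in>{1..N}. rsmult V ((\<lambda>_. 0) i) (p i)) = \<zero>" "(\<Oplus>i\<in>{1..N}. rsmult V ((\<lambda>_. 0) i) (p 0 \<ominus> p i)) = \<zero>"
    by (rule finsum_null; rule c; assumption)+
  have "p g \<oplus> rsmult V \<epsilon> (p 0) \<in> cone_tilde V N (p 0) p" if "\<epsilon> > 0" for \<epsilon>
  proof -
    have "p g \<oplus> rsmult V \<epsilon> (p 0) = rsmult V \<epsilon> (p 0) \<oplus> (\<Oplus>i\<in>{1..N}. rsmult V (?i i) (p i))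
      \<oplus> (\<Oplus>i\<in>{1..N}. rsmult V ((\<lambda>_. 0) i) (p 0 \<ominus> p i))"
      unfolding ind null using g by (simp add: a_comm)
    then show ?thesis unfolding cone_tilde_def mem_Collect_eq using that
      by (intro exI[of _ \<epsilon>] exI[of _ ?i] exI[of _ "\<lambda>_. 0"]) auto
  qed
  then show "p g \<in> cone_e"
    unfolding cone_E_def archimedean_closure_def using p_herm assms by auto
  have "(p 0 \<ominus> p g) \<oplus> rsmult V \<epsilon> (p 0) \<in> cone_tilde V N (p 0) p" if "\<epsilon> > 0" for \<epsilon>
  proof -
    have "(p 0 \<ominus> p g) \<oplus> rsmult V \<epsilon> (p 0) = rsmult V \<epsilon> (p 0) \<oplus> (\<Oplus>i\<in>{1..N}. rsmult V ((\<lambda>_. 0) i) (p i))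
      \<oplus> (\<Oplus>i\<in>{1..N}. rsmult V (?i i) (p 0 \<ominus> p i))"
      unfolding ind null using g by (simp add: a_comm)
    then show ?thesis unfolding cone_tilde_def mem_Collect_eq using that
      by (intro exI[of _ \<epsilon>] exI[of _ "\<lambda>_. 0"] exI[of _ ?i]) auto
  qed
  then show "p 0 \<ominus> p g \<in> cone_e"
    unfolding cone_E_def archimedean_closure_def using p_herm assms by (auto intro!: herm_minus)
qed

lemma mem_D: "X \<in> D_max V N (p 0) p k \<longleftrightarrow> (\<exists>m A s. 1 \<le> m \<and> A \<in> carrier_mat m k
    \<and> (\<forall>i<m. s i \<in> cone_e) \<and> X = matcomb s {..<m} (row_gram A))"
  by (rule mem_D_max) (use cone_E_herm in auto)

text \<open>Sums come from concatenating the families of diagonal entries and rows, nonnegative multiples from scaling the rows by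
a square root, and compressions from multiplying the rows.\<close>

lemma gen_cone_D_max: "gen_cone (D_max V N (p 0) p k)"
  unfolding gen_cone_def is_cone_def
proof (intro conjI ballI allI impI)
  let ?D = "D_max V N (p 0) p k"
  note Ec = herm_carrier[OF cone_E_herm]
  show "?D \<subseteq> herm M"
  proof
    fix X assume "X \<in> ?D"
    then obtain m A s where "\<forall>i<m. s i \<in> cone_e" "X = matcomb s {..<m} (row_gram A)"
      unfolding mem_D by blast
    then show "X \<in> herm M"
      using cone_E_herm psd_herm[OF row_gram_psd] by (auto intro!: matcomb_herm)
  qed
  {
    fix X Y assume "X \<in> ?D" "Y \<in> ?D"
    then obtain m A s n B t where A: "A \<in> carrier_mat m k" "1 \<le> m" and s: "\<And>i. i < m \<Longrightarrow> s i \<in> cone_e"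
      and X: "X = matcomb s {..<m} (row_gram A)"
      and B: "B \<in> carrier_mat n k" and t: "\<And>i. i < n \<Longrightarrow> t i \<in> cone_e"
      and Y: "Y = matcomb t {..<n} (row_gram B)"
      unfolding mem_D by metis
    let ?C = "mat (m + n) k (\<lambda>(i, j). if i < m then A $$ (i, j) else B $$ (i - m, j))"
    let ?u = "\<lambda>i. if i < m then s i else t (i - m)"
    have u: "?u i \<in> cone_e" if "i < m + n" for i using s t that by auto
    have "matcomb ?u {..<m + n} (row_gram ?C)
      = matcomb ?u {..<m} (row_gram ?C) \<oplus>\<^bsub>M\<^esub> matcomb (\<lambda>i. ?u (m + i)) {..<n} (\<lambda>i. row_gram ?C (m + i))"
      using Ec[OF u] by (intro matcomb_append) auto
    also have "matcomb ?u {..<m} (row_gram ?C) = X"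
      unfolding X using Ec[OF s] by (intro matcomb_cong_gens) (auto simp: row_gram_def intro!: eq_matI)
    also have "matcomb (\<lambda>i. ?u (m + i)) {..<n} (\<lambda>i. row_gram ?C (m + i)) = Y"
      unfolding Y using Ec[OF t] by (intro matcomb_cong_gens) (auto simp: row_gram_def intro!: eq_matI)
    finally show "X \<oplus>\<^bsub>M\<^esub> Y \<in> ?D"
      unfolding mem_D using A(2) u by (intro exI[of _ "m + n"] exI[of _ ?C] exI[of _ ?u]) auto
  }
  {
    fix r :: real and X assume r: "0 \<le> r" and "X \<in> ?D"
    then obtain m A s where A: "A \<in> carrier_mat m k" "1 \<le> m" and s: "\<And>i. i < m \<Longrightarrow> s i \<in> cone_e"
      and X: "X = matcomb s {..<m} (row_gram A)"
      unfolding mem_D by metis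
    let ?B = "(sqrt r) \<cdot>\<^sub>r A"
    have sq: "complex_of_real (sqrt r) * complex_of_real (sqrt r) = complex_of_real r"
      using r by (simp flip: of_real_mult)
    have "row_gram ?B l = r \<cdot>\<^sub>r row_gram A l" if "l < m" for l
      unfolding sq[symmetric] using A that by (intro eq_matI) (auto simp: row_gram_def)
    then have "matcomb s {..<m} (row_gram ?B) = matcomb s {..<m} (\<lambda>l. r \<cdot>\<^sub>r row_gram A l)"
      using Ec[OF s] by (intro matcomb_cong) auto
    also have "\<dots> = rsmult M r X"
      unfolding X using Ec[OF s] by (intro matcomb_smult) auto
    finally show "rsmult M r X \<in> ?D"
      unfolding mem_D using A s by (intro exI[of _ m] exI[of _ ?B] exI[of _ s]) auto
  }
  {
    fix B :: "complex mat" and X assume B: "B \<in> Mat k" and "X \<in> ?D"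
    then obtain m A s where A: "A \<in> carrier_mat m k" "1 \<le> m" and s: "\<And>i. i < m \<Longrightarrow> s i \<in> cone_e"
      and X: "X = matcomb s {..<m} (row_gram A)"
      unfolding mem_D by metis
    have "compress V B X = matcomb s {..<m} (\<lambda>l. mat_adjoint B * row_gram A l * B)"
      unfolding X using B Ec[OF s] by (intro compress_matcomb) auto
    also have "\<dots> = matcomb s {..<m} (row_gram (A * B))"
      using Ec[OF s] row_gram_compress[OF A(1) B] by (intro matcomb_cong) auto
    finally show "compress V B X \<in> ?D"
      unfolding mem_D using A B s by (intro exI[of _ m] exI[of _ "A * B"] exI[of _ s]) auto
  }
  have unit: "tens V (1\<^sub>m k) v \<in> ?D" if v: "v \<in> cone_e" for v
  proof -
    have "tens V (1\<^sub>m k) v = matcomb (\<lambda>_. v) {..<k} (row_gram (1\<^sub>m k))"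
    proof (rule M_eqI)
      fix i j assume ij: "i < k" "j < k"
      have "(\<Oplus>l\<in>{..<k}. row_gram (1\<^sub>m k) l $$ (i, j) \<odot> v) = (\<Sum>l<k. row_gram (1\<^sub>m k) l $$ (i, j)) \<odot> v"
        using Ec[OF v] by (intro finsum_coeff) auto
      also have "(\<Sum>l<k. row_gram (1\<^sub>m k) l $$ (i, j)) = (\<Sum>l<k. if l = i then 1\<^sub>m k $$ (i, j) else 0)"
        using ij by (intro sum.cong) (auto simp: row_gram_def)
      also have "\<dots> = 1\<^sub>m k $$ (i, j)" using ij by simp
      finally show "tens V (1\<^sub>m k) v $$ (i, j) = matcomb (\<lambda>_. v) {..<k} (row_gram (1\<^sub>m k)) $$ (i, j)"
        using ij by (simp add: matcomb_def)
    qed (auto simp: matcomb_def)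
    then show ?thesis unfolding mem_D using k_pos v
      by (intro exI[of _ k] exI[of _ "1\<^sub>m k"] exI[of _ "\<lambda>_. v"]) auto
  qed
  fix i assume i: "i \<in> {1..N}"
  show "tens V (1\<^sub>m k) (p i) \<in> ?D" "tens V (1\<^sub>m k) (p 0 \<ominus> p i) \<in> ?D"
    using gens_in_cone_E[OF i] by (auto intro: unit)
qed

subsection \<open>The iteration and its closure\<close>

abbreviation E_iter :: "nat \<Rightarrow> 'v mat set" where
  "E_iter \<equiv> proj_iter V N (p 0) p k"

abbreviation E :: "'v mat set" where
  "E \<equiv> E_proj V N (p 0) p k"

lemma index_le: "n mod N + 1 \<le> N"
  using N_pos mod_less_divisor[of N n] by linarith

lemma gen_cone_iter: "gen_cone (E_iter n)"
proof (induction n)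
  case 0
  show ?case by (simp add: E_max_def gen_cone_closure gen_cone_D_max)
next
  case (Suc n)
  show ?case unfolding proj_iter.simps by (rule gen_cone_proj_cone[OF Suc index_le])
qed

lemma iter_mono: "m \<le> n \<Longrightarrow> E_iter m \<subseteq> E_iter n"
proof (induction n rule: dec_induct)
  case (step n)
  have "E_iter n \<subseteq> E_iter (Suc n)"
    unfolding proj_iter.simps by (rule proj_cone_supset[OF gen_cone_iter index_le])
  then show ?case using step by blast
qed simp

text \<open>Every generator is used again after each stage of the iteration, and the cones increase.\<close>

lemma iter_cofinal:
  assumes "i \<in> {1..N}"
  shows "\<exists>m. pcone (E_iter n) i \<subseteq> E_iter m"
proof -
  obtain j where j: "i = Suc j" "j < N" using assms by (cases i) auto
  let ?m = "n * N + j"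
  have "n \<le> ?m" using N_pos by (cases N) auto
  then have "pcone (E_iter n) i \<subseteq> pcone (E_iter ?m) i"
    by (intro proj_cone_mono iter_mono)
  also have "\<dots> = E_iter (Suc ?m)" using j by simp
  finally show ?thesis by blast
qed

lemma E_closure: "E = arch_cl (\<Union>n. E_iter n)"
  by (simp add: E_proj_def)

lemma gen_cone_E: "gen_cone E"
  unfolding E_closure by (intro gen_cone_closure gen_cone_Union gen_cone_iter iter_mono)

lemma proj_cone_E:
  assumes "i \<in> {1..N}"
  shows "pcone E i = E"
  unfolding E_closure using assms
  by (intro proj_cone_closure_Union gen_cone_iter iter_mono iter_cofinal) auto

lemma abstract_projection_E:
  assumes "i \<in> {1..N}"
  shows "abstract_projection V k E (p 0) (p i)"
  unfolding abstract_projection_def positive_contraction_def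
  using assms p_herm gen_cone_contraction[OF gen_cone_E, of i] proj_cone_E[OF assms] by auto

text \<open>Everything except properness holds for arbitrary generators; properness is stated here without additive inverses.\<close>

lemma k_aou_space_E:
  assumes "\<And>x y. x \<in> E \<Longrightarrow> y \<in> E \<Longrightarrow> x \<oplus>\<^bsub>M\<^esub> y = \<zero>\<^bsub>M\<^esub> \<Longrightarrow> x = \<zero>\<^bsub>M\<^esub>"
  shows "k_aou_space V k E (p 0)"
proof (intro k_aou_space.intro star_vector_space_axioms k_aou_space_axioms.intro)
  show "is_proper_cone M E"
    unfolding is_proper_cone_def
  proof (intro conjI gen_cone_is_cone gen_cone_E equalityI subsetI)
    fix x assume "x \<in> E \<inter> a_inv M ` E"
    then obtain y where y: "x \<in> E" "y \<in> E" "x = \<ominus>\<^bsub>M\<^esub> y" by blast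
    have "x \<oplus>\<^bsub>M\<^esub> y = \<zero>\<^bsub>M\<^esub>" using gen_cone_carrier[OF gen_cone_E y(2)] y(3) by (simp add: M.l_neg)
    then show "x \<in> {\<zero>\<^bsub>M\<^esub>}" using assms y by blast
  next
    fix x assume "x \<in> {\<zero>\<^bsub>M\<^esub>}"
    moreover have "\<zero>\<^bsub>M\<^esub> = \<ominus>\<^bsub>M\<^esub> \<zero>\<^bsub>M\<^esub>" by (rule M.minus_equality[symmetric]) auto
    ultimately show "x \<in> E \<inter> a_inv M ` E" using gen_cone_zero[OF gen_cone_E] by blast
  qed
  show "compress V A x \<in> E" if "A \<in> Mat k" "x \<in> E" for A x
    using that by (rule gen_cone_compress[OF gen_cone_E])
  show "archimedean_order_unit M E I_e"
    unfolding E_closure by (intro closure_order_unit gen_cone_Union gen_cone_iter iter_mono)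
  show "p 0 \<in> carrier V" by simp
qed

end

section \<open>Comparison with a k-AOU space\<close>

text \<open>The situation in which a given space shows that the projection cone is proper.\<close>

locale gen_space_hom = gen_space V k N p + W: k_aou_space W k C f
  for V :: "'v star_space" (structure) and k :: nat and N :: nat and p :: "nat \<Rightarrow> 'v"
    and W :: "'w star_space" and C :: "'w mat set" and f :: 'w +
  fixes \<phi> :: "'v \<Rightarrow> 'w"
  assumes hom_closed: "v \<in> carrier V \<Longrightarrow> \<phi> v \<in> carrier W"
    and hom_add: "v \<in> carrier V \<Longrightarrow> w \<in> carrier V \<Longrightarrow> \<phi> (v \<oplus> w) = \<phi> v \<oplus>\<^bsub>W\<^esub> \<phi> w"
    and hom_sm: "v \<in> carrier V \<Longrightarrow> \<phi> (c \<odot> v) = c \<odot>\<^bsub>W\<^esub> \<phi> v"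
    and hom_star: "v \<in> carrier V \<Longrightarrow> \<phi> (star V v) = star W (\<phi> v)"
    and hom_unit: "\<phi> (p 0) = f"
    and hom_proj: "i \<in> {1..N} \<Longrightarrow> abstract_projection W k C f (\<phi> (p i))"

sublocale gen_space_hom \<subseteq> W: matrix_space W k
  by unfold_locales

context gen_space_hom
begin

lemma hom_zero: "\<phi> \<zero> = \<zero>\<^bsub>W\<^esub>"
  using hom_sm[of \<zero> 0] hom_closed[of \<zero>] by simp

lemma hom_minus:
  assumes "v \<in> carrier V" "w \<in> carrier V"
  shows "\<phi> (v \<ominus> w) = \<phi> v \<ominus>\<^bsub>W\<^esub> \<phi> w"
  using assms by (simp add: minus_eq_sm W.minus_eq_sm hom_closed hom_add hom_sm)

lemma hom_finsum:
  "finite F \<Longrightarrow> (\<And>i. i \<in> F \<Longrightarrow> b i \<in> carrier V) \<Longrightarrow> \<phi> (\<Oplus>i\<in>F. b i) = (\<Oplus>\<^bsub>W\<^esub>i\<in>F. \<phi> (b i))"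
proof (induction F rule: finite_induct)
  case empty
  show ?case by (simp add: hom_zero)
next
  case (insert x F)
  then show ?case by (simp add: hom_add hom_closed Pi_def)
qed

abbreviation mhom :: "'v mat \<Rightarrow> 'w mat" where "mhom \<equiv> map_mat \<phi>"

lemma mhom_add: "X \<in> carrier M \<Longrightarrow> Y \<in> carrier M \<Longrightarrow> mhom (X \<oplus>\<^bsub>M\<^esub> Y) = mhom X \<oplus>\<^bsub>W.M\<^esub> mhom Y"
  by (intro W.M_eqI) (simp_all add: hom_add)

lemma mhom_closed: "X \<in> carrier M \<Longrightarrow> mhom X \<in> carrier W.M"
  by (intro W.M_I) (simp_all add: hom_closed)

lemma mhom_zero: "mhom \<zero>\<^bsub>M\<^esub> = \<zero>\<^bsub>W.M\<^esub>"
  by (intro W.M_eqI) (simp_all add: hom_zero)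

lemma mhom_sm: "X \<in> carrier M \<Longrightarrow> mhom (c \<odot>\<^bsub>M\<^esub> X) = c \<odot>\<^bsub>W.M\<^esub> mhom X"
  by (intro W.M_eqI) (simp_all add: hom_sm mhom_closed)

lemma mhom_herm:
  assumes "X \<in> herm M"
  shows "mhom X \<in> herm W.M"
proof (rule W.M.hermI)
  show "mhom X \<in> carrier W.M" using assms by (auto intro: mhom_closed)
  have "star W.M (mhom X) = mhom (star M X)"
    using assms by (intro W.M_eqI) (simp_all add: hom_star)
  then show "star W.M (mhom X) = mhom X" using M.herm_star[OF assms] by (simp only:)
qed

lemma mhom_tens: "A \<in> Mat k \<Longrightarrow> v \<in> carrier V \<Longrightarrow> mhom (tens V A v) = tens W A (\<phi> v)"
  by (intro W.M_eqI) (auto simp: hom_sm)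

lemma mhom_matcomb:
  assumes "finite F" "\<And>h. h \<in> F \<Longrightarrow> b h \<in> carrier V"
  shows "mhom (matcomb b F Z) = W.matcomb (\<lambda>h. \<phi> (b h)) F Z"
proof (rule W.M_eqI)
  fix i j assume ij: "i < k" "j < k"
  have "\<phi> (\<Oplus>g\<in>F. Z g $$ (i, j) \<odot> b g) = (\<Oplus>\<^bsub>W\<^esub>g\<in>F. \<phi> (Z g $$ (i, j) \<odot> b g))"
    using assms by (intro hom_finsum) auto
  also have "\<dots> = (\<Oplus>\<^bsub>W\<^esub>g\<in>F. Z g $$ (i, j) \<odot>\<^bsub>W\<^esub> \<phi> (b g))"
    using assms by (intro W.finsum_cong') (auto simp: hom_sm hom_closed)
  finally show "mhom (matcomb b F Z) $$ (i, j) = W.matcomb (\<lambda>h. \<phi> (b h)) F Z $$ (i, j)"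
    using ij by (simp add: matcomb_def W.matcomb_def)
qed (auto simp: matcomb_def W.matcomb_def)

lemma mhom_compress:
  assumes A: "A \<in> Mat k" and X: "X \<in> carrier M"
  shows "mhom (compress V A X) = compress W A (mhom X)"
proof -
  obtain Z where Z: "\<And>g. Z g \<in> Mat k" "X = comb Z" using comb_exists[OF X] by blast
  have c: "\<And>h. h \<in> {0..N} \<Longrightarrow> p h \<in> carrier V" by simp
  have "mhom (compress V A X) = mhom (comb (\<lambda>g. mat_adjoint A * Z g * A))"
    unfolding Z(2) using A Z(1) by (subst compress_comb) auto
  also have "\<dots> = W.matcomb (\<lambda>h. \<phi> (p h)) {0..N} (\<lambda>g. mat_adjoint A * Z g * A)"
    using c by (intro mhom_matcomb) auto
  also have "\<dots> = compress W A (W.matcomb (\<lambda>h. \<phi> (p h)) {0..N} Z)"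
    using A Z(1) c by (intro W.compress_matcomb[symmetric]) (auto simp: hom_closed)
  also have "W.matcomb (\<lambda>h. \<phi> (p h)) {0..N} Z = mhom X"
    unfolding Z(2) using c by (intro mhom_matcomb[symmetric]) auto
  finally show ?thesis .
qed

lemma mhom_rsmult_I_e:
  "mhom (X \<oplus>\<^bsub>M\<^esub> rsmult M \<epsilon> I_e) = mhom X \<oplus>\<^bsub>W.M\<^esub> rsmult W.M \<epsilon> (tens W (1\<^sub>m k) f)"
  if "X \<in> carrier M"
  using that by (simp add: mhom_add mhom_sm mhom_tens hom_unit)

lemma C_cone: "is_cone W.M C"
  using W.proper_cone by (simp add: is_proper_cone_def)

lemma C_archimedean:
  assumes "x \<in> herm W.M" "\<And>\<epsilon>. \<epsilon> > 0 \<Longrightarrow> x \<oplus>\<^bsub>W.M\<^esub> rsmult W.M \<epsilon> (tens W (1\<^sub>m k) f) \<in> C"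
  shows "x \<in> C"
  using W.order_unit assms unfolding archimedean_order_unit_def by blast

text \<open>Since the target cone is Archimedean closed, a positive map on a set of matrices stays positive on its closure.\<close>

lemma mhom_closure:
  assumes "x \<in> arch_cl D" "\<And>y. y \<in> D \<Longrightarrow> mhom y \<in> C"
  shows "mhom x \<in> C"
proof (rule C_archimedean)
  have h: "x \<in> herm M" using assms(1) by (simp add: mem_closure)
  then show "mhom x \<in> herm W.M" by (rule mhom_herm)
  show "mhom x \<oplus>\<^bsub>W.M\<^esub> rsmult W.M \<epsilon> (tens W (1\<^sub>m k) f) \<in> C" if "\<epsilon> > 0" for \<epsilon>
    using assms(2)[OF closureD[OF assms(1) that]] mhom_rsmult_I_e[OF M.herm_carrier[OF h]] by (simp only:)
qed

text \<open>Positivity of elements is that of their ampliations in the target; it is inherited from the generators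
by all nonnegative combinations.\<close>

definition positive :: "'v \<Rightarrow> bool" where
  "positive v \<longleftrightarrow> v \<in> carrier V \<and> tens W (1\<^sub>m k) (\<phi> v) \<in> C"

lemma positive_add: "positive v \<Longrightarrow> positive w \<Longrightarrow> positive (v \<oplus> w)"
  by (auto simp: positive_def hom_add hom_closed W.tens_add_right intro!: W.M.is_coneD(2)[OF C_cone])

lemma positive_rsmult:
  assumes "positive v" "0 \<le> r"
  shows "positive (rsmult V r v)"
proof -
  have v: "v \<in> carrier V" using assms by (simp add: positive_def)
  have "tens W (1\<^sub>m k) (\<phi> (rsmult V r v)) = rsmult W.M r (tens W (1\<^sub>m k) (\<phi> v))"
    using v by (intro W.M_eqI) (auto simp: hom_sm hom_closed W.sm_mult mult.commute)
  then show ?thesis using assms v W.M.is_coneD(3)[OF C_cone] by (simp add: positive_def)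
qed

lemma positive_zero: "positive \<zero>"
proof -
  have "C \<noteq> {}"
    using hom_proj[of 1] N_pos unfolding abstract_projection_def positive_contraction_def by auto
  then show ?thesis
    using W.M.is_cone_zero[OF C_cone] by (simp add: positive_def hom_zero)
qed

lemma positive_finsum: "finite F \<Longrightarrow> (\<And>i. i \<in> F \<Longrightarrow> positive (b i)) \<Longrightarrow> positive (\<Oplus>i\<in>F. b i)"
proof (induction F rule: finite_induct)
  case empty
  show ?case by (simp add: positive_zero)
next
  case (insert x F)
  then show ?case by (simp add: positive_def[of "b _"] Pi_def positive_add)
qed

lemma positive_gens:
  assumes "i \<in> {1..N}"
  shows "positive (p i)" "positive (p 0 \<ominus> p i)"
  using hom_proj[OF assms] assms
  by (auto simp: abstract_projection_def positive_contraction_def positive_def hom_minus hom_unit)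

lemma positive_unit: "positive (p 0)"
proof -
  have 1: "1 \<in> {1..N}" using N_pos by simp
  have "positive (p 1 \<oplus> (p 0 \<ominus> p 1))"
    using positive_gens[OF 1] by (intro positive_add)
  then show ?thesis using N_pos by (simp add: minus_add_cancel)
qed

lemma cone_E_positive:
  assumes v: "v \<in> cone_e"
  shows "positive v"
proof -
  have h: "v \<in> herm V" using v by (rule cone_E_herm)
  have tilde: "positive x" if x: "x \<in> cone_tilde V N (p 0) p" for x
  proof -
    obtain r t s where rts: "0 \<le> r" "\<forall>i\<in>{1..N}. 0 \<le> t i \<and> 0 \<le> s i"
      and "x = rsmult V r (p 0) \<oplus> (\<Oplus>i\<in>{1..N}. rsmult V (t i) (p i))
        \<oplus> (\<Oplus>i\<in>{1..N}. rsmult V (s i) (p 0 \<ominus> p i))"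
      using x unfolding cone_tilde_def by blast
    then show ?thesis using rts
      by (auto intro!: positive_add positive_finsum positive_rsmult positive_unit positive_gens)
  qed
  have "tens W (1\<^sub>m k) (\<phi> v) \<in> C"
  proof (rule C_archimedean)
    have "tens W (1\<^sub>m k) (\<phi> v) = mhom (tens V (1\<^sub>m k) v)" using h by (simp add: mhom_tens)
    also have "\<dots> \<in> herm W.M" using h by (intro mhom_herm tens_herm) auto
    finally show "tens W (1\<^sub>m k) (\<phi> v) \<in> herm W.M" .
    fix \<epsilon> :: real assume "\<epsilon> > 0"
    then have "positive (v \<oplus> rsmult V \<epsilon> (p 0))"
      using v tilde unfolding cone_E_def archimedean_closure_def by blast
    then have "tens W (1\<^sub>m k) (\<phi> (v \<oplus> rsmult V \<epsilon> (p 0))) \<in> C" by (simp add: positive_def)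
    also have "tens W (1\<^sub>m k) (\<phi> (v \<oplus> rsmult V \<epsilon> (p 0)))
      = tens W (1\<^sub>m k) (\<phi> v) \<oplus>\<^bsub>W.M\<^esub> rsmult W.M \<epsilon> (tens W (1\<^sub>m k) f)"
      using h hom_closed[of "p 0"] hom_closed[of v]
      by (intro W.M_eqI) (auto simp: hom_add hom_sm hom_unit W.sm_add_right W.sm_mult mult.commute)
    finally show "tens W (1\<^sub>m k) (\<phi> v) \<oplus>\<^bsub>W.M\<^esub> rsmult W.M \<epsilon> (tens W (1\<^sub>m k) f) \<in> C" .
  qed
  then show ?thesis using h by (simp add: positive_def)
qed

lemma matcomb_positive:
  "finite F \<Longrightarrow> (\<And>h. h \<in> F \<Longrightarrow> positive (b h)) \<Longrightarrow> (\<And>h. h \<in> F \<Longrightarrow> Z h \<in> psd k)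
    \<Longrightarrow> W.matcomb (\<lambda>h. \<phi> (b h)) F Z \<in> C"
proof (induction F rule: finite_induct)
  case empty
  have "tens W (1\<^sub>m k) (\<phi> \<zero>) \<in> C" using positive_zero by (simp add: positive_def)
  then show ?case by (simp add: hom_zero)
next
  case (insert g F)
  have g: "positive (b g)" "Z g \<in> psd k" and F: "\<And>h. h \<in> F \<Longrightarrow> positive (b h)" "\<And>h. h \<in> F \<Longrightarrow> Z h \<in> psd k"
    using insert.prems by auto
  have c: "\<phi> (b h) \<in> carrier W" if "h \<in> insert g F" for h
    using insert.prems(1)[OF that] by (intro hom_closed) (simp add: positive_def)
  have gW: "tens W (Z g) (\<phi> (b g)) \<in> C"
  proof (rule W.tens_psd[OF C_cone _ _ _ g(2)])
    show "compress W A x \<in> C" if "A \<in> Mat k" "x \<in> C" for A x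
      using that by (rule k_aou_space.compress_closed[OF W.k_aou_space_axioms])
    show "\<phi> (b g) \<in> carrier W" using c by simp
    show "tens W (1\<^sub>m k) (\<phi> (b g)) \<in> C" using g(1) by (simp add: positive_def)
  qed
  have FW: "W.matcomb (\<lambda>h. \<phi> (b h)) F Z \<in> C" by (rule insert.IH[OF F])
  have "W.matcomb (\<lambda>h. \<phi> (b h)) (insert g F) Z
    = tens W (Z g) (\<phi> (b g)) \<oplus>\<^bsub>W.M\<^esub> W.matcomb (\<lambda>h. \<phi> (b h)) F Z"
    using insert.hyps c psd_carrier[OF g(2)] by (intro W.matcomb_insert)
  then show ?case using W.M.is_coneD(2)[OF C_cone gW FW] by (simp only:)
qed

lemma mhom_D_max:
  assumes "X \<in> D_max V N (p 0) p k"
  shows "mhom X \<in> C"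
proof -
  obtain m A s where s: "\<And>i. i < m \<Longrightarrow> s i \<in> cone_e" and X: "X = matcomb s {..<m} (row_gram A)"
    using assms unfolding mem_D by metis
  have "mhom X = W.matcomb (\<lambda>h. \<phi> (s h)) {..<m} (row_gram A)"
    unfolding X using herm_carrier[OF cone_E_herm[OF s]] by (intro mhom_matcomb) auto
  also have "\<dots> \<in> C"
    using cone_E_positive[OF s] row_gram_psd by (intro matcomb_positive) auto
  finally show ?thesis .
qed

text \<open>The image of \<open>D[p]\<close> lies in \<open>C[q]\<close>, which equals \<open>C\<close> because \<open>q\<close> is an abstract projection.\<close>

lemma mhom_proj_cone:
  assumes i: "i \<in> {1..N}" and x: "x \<in> pcone D i" and D: "\<And>y. y \<in> D \<Longrightarrow> mhom y \<in> C"
    and Dc: "D \<subseteq> carrier M"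
  shows "mhom x \<in> C"
proof -
  have h: "x \<in> herm M" using x by (simp add: mem_proj_cone)
  have iN: "i \<le> N" using i by simp
  have "mhom x \<in> proj_cone W k f C (\<phi> (p i))"
    unfolding proj_cone_def
  proof (intro CollectI conjI allI impI)
    show "mhom x \<in> herm W.M" by (rule mhom_herm[OF h])
    fix \<epsilon> :: real assume "\<epsilon> > 0"
    then obtain t where t: "t > 0" "\<forall>A\<in>Mat k. \<forall>B\<in>Mat k. proj_expr i \<epsilon> t A B x \<in> D"
      using x unfolding mem_proj_cone by blast
    show "\<exists>t>0. \<forall>\<alpha>\<in>Mat k. \<forall>\<beta>\<in>Mat k.
       compress W (\<alpha> + \<beta>) (mhom x)
       \<oplus>\<^bsub>W.M\<^esub> tens W (\<epsilon> \<cdot>\<^sub>r (mat_adjoint \<alpha> * \<alpha>) + t \<cdot>\<^sub>r (mat_adjoint \<beta> * \<beta>)) (\<phi> (p i))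
       \<oplus>\<^bsub>W.M\<^esub> tens W (\<epsilon> \<cdot>\<^sub>r (mat_adjoint \<beta> * \<beta>) + t \<cdot>\<^sub>r (mat_adjoint \<alpha> * \<alpha>)) (f \<ominus>\<^bsub>W\<^esub> \<phi> (p i)) \<in> C"
    proof (intro exI[of _ t] conjI t(1) ballI)
      fix A B :: "complex mat" assume A: "A \<in> Mat k" and B: "B \<in> Mat k"
      have "mhom (proj_expr i \<epsilon> t A B x) \<in> C" using t(2) A B D by blast
      then show "compress W (A + B) (mhom x)
       \<oplus>\<^bsub>W.M\<^esub> tens W (\<epsilon> \<cdot>\<^sub>r sq A + t \<cdot>\<^sub>r sq B) (\<phi> (p i))
       \<oplus>\<^bsub>W.M\<^esub> tens W (\<epsilon> \<cdot>\<^sub>r sq B + t \<cdot>\<^sub>r sq A) (f \<ominus>\<^bsub>W\<^esub> \<phi> (p i)) \<in> C"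
        using A B iN h by (simp add: proj_expr_def mhom_add mhom_compress mhom_tens hom_minus hom_unit)
    qed
  qed
  then show ?thesis
    using hom_proj[OF i] unfolding abstract_projection_def by blast
qed

lemma mhom_iter: "x \<in> E_iter n \<Longrightarrow> mhom x \<in> C"
proof (induction n arbitrary: x)
  case 0
  then show ?case unfolding proj_iter.simps E_max_def by (rule mhom_closure) (rule mhom_D_max)
next
  case (Suc n)
  show ?case
    using Suc index_le gen_cone_carrier[OF gen_cone_iter]
    by (intro mhom_proj_cone[of "n mod N + 1" x "E_iter n"]) auto
qed

lemma mhom_E: "x \<in> E \<Longrightarrow> mhom x \<in> C"
  unfolding E_closure by (erule mhom_closure) (use mhom_iter in blast)

text \<open>If \<open>x\<close> and \<open>-x\<close> both lie in \<open>E\<close>, then their images lie in the proper cone \<open>C\<close>, so the image of \<open>x\<close> vanishes.\<close>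

theorem k_aou_space_E_if_inj:
  assumes inj: "inj_on \<phi> (carrier V)"
  shows "k_aou_space V k E (p 0)"
proof (rule k_aou_space_E)
  fix x y assume xy: "x \<in> E" "y \<in> E" "x \<oplus>\<^bsub>M\<^esub> y = \<zero>\<^bsub>M\<^esub>"
  have c: "x \<in> carrier M" "y \<in> carrier M" using xy gen_cone_carrier[OF gen_cone_E] by auto
  note C = mhom_E[OF xy(1)] mhom_E[OF xy(2)]
  have "mhom x \<oplus>\<^bsub>W.M\<^esub> mhom y = \<zero>\<^bsub>W.M\<^esub>"
    using arg_cong[OF xy(3), of mhom] c by (simp add: mhom_add mhom_zero)
  then have "mhom x = \<ominus>\<^bsub>W.M\<^esub> mhom y"
    using c mhom_closed by (intro W.M.minus_equality[symmetric]) auto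
  then have "mhom x \<in> C \<inter> a_inv W.M ` C" using C by blast
  then have "mhom x = \<zero>\<^bsub>W.M\<^esub>" using W.proper_cone unfolding is_proper_cone_def by blast
  then have eq: "mhom x = mhom \<zero>\<^bsub>M\<^esub>" by (simp only: mhom_zero)
  show "x = \<zero>\<^bsub>M\<^esub>"
  proof (rule M_eqI)
    fix i j assume ij: "i < k" "j < k"
    have "\<phi> (x $$ (i, j)) = \<phi> \<zero>" using arg_cong[OF eq, of "\<lambda>Y. Y $$ (i, j)"] ij c by simp
    then show "x $$ (i, j) = \<zero>\<^bsub>M\<^esub> $$ (i, j)"
      using inj_onD[OF inj, of "x $$ (i, j)" \<zero>] ij c by simp
  qed (use c in auto)
qed

end

section \<open>Linear algebra of spans\<close>

lemma (in Module.module) span_induct_module: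
  assumes x: "x \<in> span S" and S: "S \<subseteq> carrier M" "\<And>x. x \<in> S \<Longrightarrow> P x" and zero: "P \<zero>\<^bsub>M\<^esub>"
    and add: "\<And>x y. x \<in> carrier M \<Longrightarrow> y \<in> carrier M \<Longrightarrow> P x \<Longrightarrow> P y \<Longrightarrow> P (x \<oplus>\<^bsub>M\<^esub> y)"
    and smult: "\<And>c x. c \<in> carrier R \<Longrightarrow> x \<in> carrier M \<Longrightarrow> P x \<Longrightarrow> P (c \<odot>\<^bsub>M\<^esub> x)"
  shows "P x"
proof -
  have "submodule R {x \<in> carrier M. P x} M"
    by (intro submodule.intro) (auto simp: zero add smult module_axioms)
  then have "span S \<subseteq> {x \<in> carrier M. P x}"
    using S by (intro span_is_subset) auto
  then show ?thesis using x by blast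
qed

text \<open>If a nonzero vector is in the kernel, then some vector \<open>b\<close> of a basis occurs in it, and the image of \<open>b\<close> is a combination of the
images of the other basis vectors. These images alone then span the target, which is too few for its dimension.\<close>

lemma surj_imp_inj_if_dim_eq:
  assumes "star_vector_space V" "star_vector_space W"
    and closed: "\<And>v. v \<in> carrier V \<Longrightarrow> \<phi> v \<in> carrier W"
    and add: "\<And>v w. v \<in> carrier V \<Longrightarrow> w \<in> carrier V \<Longrightarrow> \<phi> (v \<oplus>\<^bsub>V\<^esub> w) = \<phi> v \<oplus>\<^bsub>W\<^esub> \<phi> w"
    and sm: "\<And>c v. v \<in> carrier V \<Longrightarrow> \<phi> (c \<odot>\<^bsub>V\<^esub> v) = c \<odot>\<^bsub>W\<^esub> \<phi> v"
    and fin: "vectorspace.fin_dim class_ring V"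
    and surj: "carrier W \<subseteq> \<phi> ` carrier V"
    and dim: "vectorspace.dim class_ring V = vectorspace.dim class_ring W"
  shows "inj_on \<phi> (carrier V)"
proof -
  interpret V: star_vector_space V by fact
  interpret W: star_vector_space W by fact
  obtain B where B: "finite B" "V.basis B" using V.finite_basis_exists[OF fin] by blast
  have Bc: "B \<subseteq> carrier V" and Bs: "V.span B = carrier V" using B(2) by (auto simp: V.basis_def)
  have zero: "\<phi> \<zero>\<^bsub>V\<^esub> = \<zero>\<^bsub>W\<^esub>" using sm[of "\<zero>\<^bsub>V\<^esub>" 0] closed[of "\<zero>\<^bsub>V\<^esub>"] by simp
  have ker: "v = \<zero>\<^bsub>V\<^esub>" if v: "v \<in> carrier V" "\<phi> v = \<zero>\<^bsub>W\<^esub>" for v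
  proof (rule ccontr)
    assume nz: "v \<noteq> \<zero>\<^bsub>V\<^esub>"
    have "v \<in> V.span B" using v(1) Bs by simp
    then obtain a where a: "V.lincomb a B = v"
      using V.finite_in_span[OF B(1) Bc] by blast
    have "\<exists>b\<in>B. a b \<noteq> 0"
    proof (rule ccontr)
      assume "\<not> (\<exists>b\<in>B. a b \<noteq> 0)"
      then have "V.lincomb a B = (\<Oplus>\<^bsub>V\<^esub>b\<in>B. \<zero>\<^bsub>V\<^esub>)"
        unfolding V.lincomb_def using Bc by (intro V.finsum_cong') auto
      then show False using a nz by simp
    qed
    then obtain b where b: "b \<in> B" "a b \<noteq> 0" by blast
    have bc: "b \<in> carrier V" using b Bc by blast
    let ?S = "\<phi> ` (B - {b})"
    let ?w = "V.lincomb a (B - {b})"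
    have Sc: "?S \<subseteq> carrier W" using Bc closed by blast
    have sub: "submodule class_ring (W.span ?S) W" using Sc by (rule W.span_is_submodule)
    have mem: "\<phi> x \<in> W.span ?S" if "x \<in> V.span X" "X \<subseteq> carrier V" "\<phi> ` X \<subseteq> W.span ?S" for x X
    proof (rule V.span_induct_module[OF that(1,2), of "\<lambda>x. \<phi> x \<in> W.span ?S"])
      show "\<phi> \<zero>\<^bsub>V\<^esub> \<in> W.span ?S" unfolding zero by (rule submodule.zero_closed[OF sub])
    qed (use that(3) in \<open>auto simp: add sm intro: submodule.m_closed[OF sub] submodule.smult_closed[OF sub]\<close>)
    have wc: "?w \<in> carrier V" using Bc by (intro V.lincomb_closed) auto
    have "?w \<in> V.span (B - {b})"
      unfolding V.span_def using B(1)
      by (intro CollectI exI[of _ a] exI[of _ "B - {b}"] conjI) auto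
    then have wS: "\<phi> ?w \<in> W.span ?S"
      using Bc W.in_own_span[OF Sc] by (intro mem) auto
    have "V.lincomb a B = a b \<odot>\<^bsub>V\<^esub> b \<oplus>\<^bsub>V\<^esub> ?w"
      using B(1) Bc b(1) by (intro V.lincomb_del2) auto
    then have "\<zero>\<^bsub>W\<^esub> = a b \<odot>\<^bsub>W\<^esub> \<phi> b \<oplus>\<^bsub>W\<^esub> \<phi> ?w"
      using a v(2) bc wc by (simp add: add sm)
    then have "a b \<odot>\<^bsub>W\<^esub> \<phi> b = \<ominus>\<^bsub>W\<^esub> \<phi> ?w"
      using closed[OF bc] closed[OF wc] by (intro W.minus_equality[symmetric]) auto
    also have "\<dots> = (- 1) \<odot>\<^bsub>W\<^esub> \<phi> ?w"
      using W.smult_minus_1[OF closed[OF wc]] by (simp add: class_ring_simps)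
    finally have "(1 / a b) \<odot>\<^bsub>W\<^esub> (a b \<odot>\<^bsub>W\<^esub> \<phi> b) = (1 / a b) \<odot>\<^bsub>W\<^esub> ((- 1) \<odot>\<^bsub>W\<^esub> \<phi> ?w)" by (rule arg_cong)
    then have "\<phi> b = (- 1 / a b) \<odot>\<^bsub>W\<^esub> \<phi> ?w"
      using closed[OF bc] closed[OF wc] b(2) by (simp add: W.sm_mult)
    then have "\<phi> b \<in> W.span ?S" using submodule.smult_closed[OF sub _ wS] by simp
    then have "\<phi> ` B \<subseteq> W.span ?S" using W.in_own_span[OF Sc] by blast
    then have "carrier W \<subseteq> W.span ?S" using mem[OF _ Bc] surj Bs by blast
    then have "W.span ?S = carrier W" using W.span_is_subset2[OF Sc] by blast
    then have "W.dim \<le> card ?S" using B(1) Sc by (intro W.gen_ge_dim) auto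
    also have "card ?S \<le> card (B - {b})" using B(1) by (intro card_image_le) auto
    also have "\<dots> < card B" using B(1) b(1) by (rule card_Diff1_less)
    also have "card B = V.dim" using V.dim_basis[OF B] by simp
    finally show False using dim by simp
  qed
  show ?thesis
  proof (rule inj_onI)
    fix v w assume v: "v \<in> carrier V" and w: "w \<in> carrier V" and eq: "\<phi> v = \<phi> w"
    have "\<phi> (v \<ominus>\<^bsub>V\<^esub> w) = \<phi> w \<oplus>\<^bsub>W\<^esub> (- 1) \<odot>\<^bsub>W\<^esub> \<phi> w"
      using v w by (simp add: V.minus_eq_sm add sm eq)
    also have "\<dots> = \<zero>\<^bsub>W\<^esub>" using closed[OF w] W.minus_eq_sm[of "\<phi> w" "\<phi> w"] by (simp add: a_minus_def W.r_neg)
    finally have "v \<ominus>\<^bsub>V\<^esub> w = \<zero>\<^bsub>V\<^esub>" using v w by (intro ker) auto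
    then have "w \<oplus>\<^bsub>V\<^esub> \<zero>\<^bsub>V\<^esub> = v" using V.minus_add_cancel[OF v w] by simp
    then show "v = w" using w by simp
  qed
qed

section \<open>The universal space\<close>

locale relations =
  fixes N l :: nat and R :: "real mat"
  assumes R_carrier: "R \<in> carrier_mat l (Suc N)"
begin

abbreviation vecs :: "complex vec set" where "vecs \<equiv> carrier_vec (Suc N)"
abbreviation A :: "(complex, complex vec) module" where "A \<equiv> module_vec TYPE(complex) (Suc N)"
abbreviation J :: "complex vec set" where "J \<equiv> rel_span N R"
abbreviation U :: "complex vec set star_space" where "U \<equiv> univ_space N R"
abbreviation coset :: "complex vec \<Rightarrow> complex vec set" where "coset w \<equiv> J +>\<^bsub>A\<^esub> w"
abbreviation gen :: "nat \<Rightarrow> complex vec set" where "gen \<equiv> univ_gen N R"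

definition relation_rows :: "complex vec set" where
  "relation_rows = {map_vec complex_of_real (row R i) | i. i < dim_row R}"

sublocale A: vectorspace class_ring A
  by (rule vec_vs)

lemma J_span: "J = A.span relation_rows"
  by (simp add: rel_span_def relation_rows_def)

lemma rows_carrier: "relation_rows \<subseteq> carrier A"
  using R_carrier by (auto simp: relation_rows_def module_vec_simps)

lemma J_submodule: "submodule class_ring J A"
  unfolding J_span by (rule A.span_is_submodule[OF rows_carrier])

lemma J_carrier: "J \<subseteq> vecs"
  using submodule.subset[OF J_submodule] by (simp add: module_vec_simps)

lemma J_add: "x \<in> J \<Longrightarrow> y \<in> J \<Longrightarrow> x + y \<in> J"
  using submodule.m_closed[OF J_submodule, of x y] by (simp add: module_vec_simps)

lemma J_zero: "0\<^sub>v (Suc N) \<in> J"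
  using submodule.zero_closed[OF J_submodule] by (simp add: module_vec_simps)

lemma J_smult: "x \<in> J \<Longrightarrow> c \<cdot>\<^sub>v x \<in> J"
  using submodule.smult_closed[OF J_submodule, of c x] by (simp add: module_vec_simps)

lemma J_induct:
  assumes "x \<in> J" "\<And>i. i < l \<Longrightarrow> P (map_vec complex_of_real (row R i))" "P (0\<^sub>v (Suc N))"
    "\<And>x y. x \<in> vecs \<Longrightarrow> y \<in> vecs \<Longrightarrow> P x \<Longrightarrow> P y \<Longrightarrow> P (x + y)"
    "\<And>c x. x \<in> vecs \<Longrightarrow> P x \<Longrightarrow> P (c \<cdot>\<^sub>v x)"
  shows "P x"
proof (rule A.span_induct_module[OF assms(1)[unfolded J_span] rows_carrier])
  fix x assume "x \<in> relation_rows"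
  then show "P x" using assms(2) R_carrier by (auto simp: relation_rows_def)
qed (use assms(3-5) in \<open>auto simp: module_vec_simps\<close>)

text \<open>The generating relations are real, so their span is invariant under entrywise conjugation.\<close>

lemma J_conjugate:
  assumes "x \<in> J"
  shows "conjugate x \<in> J"
  using assms
proof (rule J_induct)
  fix i assume i: "i < l"
  have "conjugate (map_vec complex_of_real (row R i)) = map_vec complex_of_real (row R i)"
    by (intro eq_vecI) auto
  moreover have "map_vec complex_of_real (row R i) \<in> J"
    unfolding J_span using A.in_own_span[OF rows_carrier] i R_carrier by (auto simp: relation_rows_def)
  ultimately show "conjugate (map_vec complex_of_real (row R i)) \<in> J" by simp
next
  show "conjugate (0\<^sub>v (Suc N)) \<in> J" using J_zero by simp
next
  fix x y :: "complex vec" assume xy: "x \<in> vecs" "y \<in> vecs" "conjugate x \<in> J" "conjugate y \<in> J"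
  have "conjugate (x + y) = conjugate x + conjugate y" using xy(1,2) by (rule conjugate_add_vec)
  then show "conjugate (x + y) \<in> J" using J_add[OF xy(3,4)] by simp
next
  fix c :: complex and x :: "complex vec" assume x: "x \<in> vecs" "conjugate x \<in> J"
  have "conjugate (c \<cdot>\<^sub>v x) = cnj c \<cdot>\<^sub>v conjugate x" by (intro eq_vecI) auto
  then show "conjugate (c \<cdot>\<^sub>v x) \<in> J" using J_smult[OF x(2)] by simp
qed

lemma mem_coset: "x \<in> coset w \<longleftrightarrow> (\<exists>h\<in>J. x = h + w)"
  by (auto simp: a_r_coset_defs module_vec_simps)

lemma coset_eqI:
  assumes "v \<in> vecs" "w \<in> vecs" "v - w \<in> J"
  shows "coset v = coset w"
proof (rule Set.set_eqI)
  have c: "h \<in> vecs" if "h \<in> J" for h using that J_carrier by blast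
  have m: "w - v \<in> J"
  proof -
    have "w - v = (- 1) \<cdot>\<^sub>v (v - w)" using assms(1,2) by (intro eq_vecI) auto
    then show ?thesis using J_smult[OF assms(3)] by simp
  qed
  fix x
  have "h + v = (h + (v - w)) + w" if "h \<in> J" for h using assms(1,2) c[OF that] by (intro eq_vecI) auto
  moreover have "h + w = (h + (w - v)) + v" if "h \<in> J" for h using assms(1,2) c[OF that] by (intro eq_vecI) auto
  ultimately show "x \<in> coset v \<longleftrightarrow> x \<in> coset w"
    unfolding mem_coset using J_add assms(3) m by metis
qed

lemma coset_self: "w \<in> vecs \<Longrightarrow> w \<in> coset w"
  unfolding mem_coset by (rule bexI[OF _ J_zero]) auto

lemma coset_memD:
  assumes "w \<in> vecs" "x \<in> coset w"
  shows "x \<in> vecs" "x - w \<in> J"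
proof -
  obtain h where h: "h \<in> J" "x = h + w" using assms(2) unfolding mem_coset by blast
  have hc: "h \<in> vecs" using h J_carrier by blast
  show "x \<in> vecs" using h hc assms(1) by auto
  have "x - w = h" unfolding h(2) using hc assms(1) by (intro eq_vecI) auto
  then show "x - w \<in> J" using h by simp
qed

lemma U_carrier: "X \<in> carrier U \<longleftrightarrow> (\<exists>w\<in>vecs. X = coset w)"
  by (auto simp: univ_space_def Let_def A_RCOSETS_def RCOSETS_def a_r_coset_def module_vec_simps)

lemma coset_carrier [simp]: "w \<in> vecs \<Longrightarrow> coset w \<in> carrier U"
  unfolding U_carrier by blast

lemma U_zero: "\<zero>\<^bsub>U\<^esub> = coset (0\<^sub>v (Suc N))"
proof -
  have "J = coset (0\<^sub>v (Suc N))"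
  proof (rule Set.set_eqI)
    fix x
    have "h + 0\<^sub>v (Suc N) = h" if "h \<in> J" for h using that J_carrier by auto
    then show "x \<in> J \<longleftrightarrow> x \<in> coset (0\<^sub>v (Suc N))" unfolding mem_coset by metis
  qed
  then show ?thesis by (simp add: univ_space_def Let_def)
qed

lemma U_add:
  assumes v: "v \<in> vecs" and w: "w \<in> vecs"
  shows "coset v \<oplus>\<^bsub>U\<^esub> coset w = coset (v + w)"
proof (rule Set.set_eqI)
  fix x
  have "coset v \<oplus>\<^bsub>U\<^esub> coset w = {a + b | a b. a \<in> coset v \<and> b \<in> coset w}"
    by (auto simp: univ_space_def Let_def set_add_defs module_vec_simps)
  moreover have "(\<exists>a b. x = a + b \<and> a \<in> coset v \<and> b \<in> coset w) \<longleftrightarrow> x \<in> coset (v + w)"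
  proof
    assume "\<exists>a b. x = a + b \<and> a \<in> coset v \<and> b \<in> coset w"
    then obtain g h where gh: "g \<in> J" "h \<in> J" "x = (g + v) + (h + w)" unfolding mem_coset by blast
    moreover have "(g + v) + (h + w) = (g + h) + (v + w)"
      using gh(1,2) J_carrier v w by (intro eq_vecI) auto
    ultimately show "x \<in> coset (v + w)" unfolding mem_coset using J_add by metis
  next
    assume "x \<in> coset (v + w)"
    then obtain h where h: "h \<in> J" "x = h + (v + w)" unfolding mem_coset by blast
    then have "x = (h + v) + w" using J_carrier v w by auto
    then show "\<exists>a b. x = a + b \<and> a \<in> coset v \<and> b \<in> coset w"
      using h(1) coset_self[OF w] unfolding mem_coset by metis
  qed
  ultimately show "x \<in> coset v \<oplus>\<^bsub>U\<^esub> coset w \<longleftrightarrow> x \<in> coset (v + w)" by simp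
qed

lemma U_smult:
  assumes w: "w \<in> vecs"
  shows "c \<odot>\<^bsub>U\<^esub> coset w = coset (c \<cdot>\<^sub>v w)"
proof -
  have "coset (c \<cdot>\<^sub>v x) = coset (c \<cdot>\<^sub>v w)" if "x \<in> coset w" for x
  proof (rule coset_eqI)
    show "c \<cdot>\<^sub>v x \<in> vecs" "c \<cdot>\<^sub>v w \<in> vecs" using coset_memD(1)[OF w that] w by auto
    have "c \<cdot>\<^sub>v x - c \<cdot>\<^sub>v w = c \<cdot>\<^sub>v (x - w)"
      using coset_memD(1)[OF w that] w by (intro eq_vecI) (auto simp: algebra_simps)
    then show "c \<cdot>\<^sub>v x - c \<cdot>\<^sub>v w \<in> J" using J_smult[OF coset_memD(2)[OF w that]] by simp
  qed
  then have "(\<Union>x\<in>coset w. coset (c \<cdot>\<^sub>v x)) = coset (c \<cdot>\<^sub>v w)" using coset_self[OF w] by blast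
  then show ?thesis by (simp add: univ_space_def Let_def module_vec_simps)
qed

lemma U_star:
  assumes w: "w \<in> vecs"
  shows "star U (coset w) = coset (conjugate w)"
proof (rule Set.set_eqI)
  fix x :: "complex vec"
  have U: "star U (coset w) = conjugate ` coset w" by (simp add: univ_space_def Let_def)
  have add: "conjugate (h + w) = conjugate h + conjugate w" if "h \<in> J" for h
    using that J_carrier w by (intro conjugate_add_vec) auto
  show "x \<in> star U (coset w) \<longleftrightarrow> x \<in> coset (conjugate w)"
  proof
    assume "x \<in> star U (coset w)"
    then obtain y where y: "y \<in> coset w" "x = conjugate y" unfolding U by blast
    then obtain h where "h \<in> J" "x = conjugate (h + w)" unfolding mem_coset by blast
    then show "x \<in> coset (conjugate w)" unfolding mem_coset using add J_conjugate by metis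
  next
    assume "x \<in> coset (conjugate w)"
    then obtain h where h: "h \<in> J" "x = h + conjugate w" unfolding mem_coset by blast
    then have "x = conjugate (conjugate h + w)" using add[OF J_conjugate[OF h(1)]] by simp
    moreover have "conjugate h + w \<in> coset w" unfolding mem_coset using J_conjugate[OF h(1)] by blast
    ultimately show "x \<in> star U (coset w)" unfolding U by blast
  qed
qed

lemma U_star_vector_space: "star_vector_space U"
proof -
  have field: "field (class_ring :: complex ring)" by (rule class_field)
  note cring = domain.axioms(1)[OF field.axioms(1)[OF field]]
  have ag: "abelian_group U"
  proof (rule abelian_groupI)
    fix X assume "X \<in> carrier U"
    then obtain w where w: "w \<in> vecs" "X = coset w" unfolding U_carrier by blast
    show "\<exists>Y\<in>carrier U. Y \<oplus>\<^bsub>U\<^esub> X = \<zero>\<^bsub>U\<^esub>"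
      by (rule bexI[of _ "coset (- w)"]) (use w in \<open>auto simp: U_add U_zero\<close>)
  next
    fix X Y Z assume "X \<in> carrier U" "Y \<in> carrier U" "Z \<in> carrier U"
    then show "X \<oplus>\<^bsub>U\<^esub> Y \<oplus>\<^bsub>U\<^esub> Z = X \<oplus>\<^bsub>U\<^esub> (Y \<oplus>\<^bsub>U\<^esub> Z)"
      by (auto simp: U_carrier U_add assoc_add_vec[of _ "Suc N"])
  next
    fix X Y assume "X \<in> carrier U" "Y \<in> carrier U"
    then show "X \<oplus>\<^bsub>U\<^esub> Y = Y \<oplus>\<^bsub>U\<^esub> X"
      by (auto simp: U_carrier U_add comm_add_vec[of _ "Suc N"])
  next
    fix X Y assume "X \<in> carrier U" "Y \<in> carrier U"
    then show "X \<oplus>\<^bsub>U\<^esub> Y \<in> carrier U" by (auto simp: U_carrier U_add)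
  next
    show "\<zero>\<^bsub>U\<^esub> \<in> carrier U" by (simp add: U_zero)
  next
    fix X assume "X \<in> carrier U"
    then show "\<zero>\<^bsub>U\<^esub> \<oplus>\<^bsub>U\<^esub> X = X" by (auto simp: U_carrier U_zero U_add)
  qed
  have "Module.module (class_ring :: complex ring) U"
  proof (rule moduleI[OF cring ag])
    fix s t :: complex and X assume "X \<in> carrier U"
    then obtain w where w: "w \<in> vecs" "X = coset w" unfolding U_carrier by blast
    show "s \<odot>\<^bsub>U\<^esub> X \<in> carrier U" using w by (simp add: U_smult)
    show "(s \<oplus>\<^bsub>class_ring\<^esub> t) \<odot>\<^bsub>U\<^esub> X = s \<odot>\<^bsub>U\<^esub> X \<oplus>\<^bsub>U\<^esub> t \<odot>\<^bsub>U\<^esub> X"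
      using w by (simp add: U_smult U_add add_smult_distrib_vec)
    show "(s \<otimes>\<^bsub>class_ring\<^esub> t) \<odot>\<^bsub>U\<^esub> X = s \<odot>\<^bsub>U\<^esub> (t \<odot>\<^bsub>U\<^esub> X)"
      using w by (simp add: U_smult smult_smult_assoc)
    show "\<one>\<^bsub>class_ring\<^esub> \<odot>\<^bsub>U\<^esub> X = X" using w by (simp add: U_smult)
    fix Y assume "Y \<in> carrier U"
    then obtain v where v: "v \<in> vecs" "Y = coset v" unfolding U_carrier by blast
    show "s \<odot>\<^bsub>U\<^esub> (X \<oplus>\<^bsub>U\<^esub> Y) = s \<odot>\<^bsub>U\<^esub> X \<oplus>\<^bsub>U\<^esub> s \<odot>\<^bsub>U\<^esub> Y"
      using w v by (simp add: U_smult U_add smult_add_distrib_vec[of _ "Suc N"])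
  qed
  then have vs: "vectorspace (class_ring :: complex ring) U"
    by (intro vectorspace.intro field)
  show ?thesis
  proof (rule star_vector_space.intro[OF vs star_vector_space_axioms.intro])
    fix X assume "X \<in> carrier U"
    then obtain w where w: "w \<in> vecs" "X = coset w" unfolding U_carrier by blast
    show "star U X \<in> carrier U" using w by (simp add: U_star)
    show "star U (star U X) = X" using w by (simp add: U_star)
    show "star U (c \<odot>\<^bsub>U\<^esub> X) = cnj c \<odot>\<^bsub>U\<^esub> star U X" for c
    proof -
      have "conjugate (c \<cdot>\<^sub>v w) = cnj c \<cdot>\<^sub>v conjugate w" by (intro eq_vecI) auto
      then show ?thesis using w by (simp add: U_star U_smult)
    qed
    fix Y assume "Y \<in> carrier U"
    then obtain v where v: "v \<in> vecs" "Y = coset v" unfolding U_carrier by blast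
    show "star U (X \<oplus>\<^bsub>U\<^esub> Y) = star U X \<oplus>\<^bsub>U\<^esub> star U Y"
      using w v by (simp add: U_star U_add conjugate_add_vec[of _ "Suc N"])
  qed
qed

sublocale U: star_vector_space U
  by (rule U_star_vector_space)

lemma gen_eq: "gen j = coset (unit_vec (Suc N) j)"
  by (simp add: univ_gen_def)

lemma gen_carrier [simp]: "gen j \<in> carrier U"
  by (simp add: gen_eq)

lemma gen_herm: "gen j \<in> herm U"
proof (rule U.hermI)
  have "conjugate (unit_vec (Suc N) j :: complex vec) = unit_vec (Suc N) j"
    by (intro eq_vecI) (auto simp: unit_vec_def)
  then show "star U (gen j) = gen j" by (simp add: gen_eq U_star)
qed simp

lemma coset_expand:
  assumes w: "w \<in> vecs"
  shows "coset w = (\<Oplus>\<^bsub>U\<^esub>j\<in>{0..N}. (w $ j) \<odot>\<^bsub>U\<^esub> gen j)"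
proof -
  have "(\<Oplus>\<^bsub>U\<^esub>j\<in>F. (w $ j) \<odot>\<^bsub>U\<^esub> gen j) = coset (vec (Suc N) (\<lambda>i. if i \<in> F then w $ i else 0))"
    if "finite F" "F \<subseteq> {0..N}" for F
    using that
  proof (induction F rule: finite_induct)
    case empty
    have "vec (Suc N) (\<lambda>i. if i \<in> {} then w $ i else 0) = 0\<^sub>v (Suc N)" by (intro eq_vecI) auto
    then show ?case by (simp add: U_zero)
  next
    case (insert j F)
    have "(\<Oplus>\<^bsub>U\<^esub>j\<in>insert j F. (w $ j) \<odot>\<^bsub>U\<^esub> gen j) = (w $ j) \<odot>\<^bsub>U\<^esub> gen j \<oplus>\<^bsub>U\<^esub> (\<Oplus>\<^bsub>U\<^esub>j\<in>F. (w $ j) \<odot>\<^bsub>U\<^esub> gen j)"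
      using insert by (intro U.finsum_insert) auto
    also have "\<dots> = coset ((w $ j) \<cdot>\<^sub>v unit_vec (Suc N) j + vec (Suc N) (\<lambda>i. if i \<in> F then w $ i else 0))"
      using insert by (simp add: gen_eq U_smult U_add)
    also have "(w $ j) \<cdot>\<^sub>v unit_vec (Suc N) j + vec (Suc N) (\<lambda>i. if i \<in> F then w $ i else 0)
      = vec (Suc N) (\<lambda>i. if i \<in> insert j F then w $ i else 0)"
      using insert by (intro eq_vecI) (auto simp: unit_vec_def)
    finally show ?case .
  qed
  moreover have "vec (Suc N) (\<lambda>i. if i \<in> {0..N} then w $ i else 0) = w"
    using w by (intro eq_vecI) auto
  ultimately show ?thesis by simp
qed

lemma gens_span: "v \<in> carrier U \<Longrightarrow> \<exists>c. v = (\<Oplus>\<^bsub>U\<^esub>j\<in>{0..N}. c j \<odot>\<^bsub>U\<^esub> gen j)"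
  unfolding U_carrier using coset_expand by blast

lemma U_fin_dim: "U.fin_dim"
proof -
  have G: "gen ` {0..N} \<subseteq> carrier U" by auto
  have sub: "submodule class_ring (U.span (gen ` {0..N})) U" using G by (rule U.span_is_submodule)
  have "(\<Oplus>\<^bsub>U\<^esub>j\<in>F. c j \<odot>\<^bsub>U\<^esub> gen j) \<in> U.span (gen ` {0..N})" if "finite F" "F \<subseteq> {0..N}" for F c
    using that
  proof (induction F rule: finite_induct)
    case empty
    then show ?case using submodule.zero_closed[OF sub] by simp
  next
    case (insert j F)
    then have "gen j \<in> U.span (gen ` {0..N})" using U.in_own_span[OF G] by auto
    then show ?case
      using insert submodule.m_closed[OF sub] submodule.smult_closed[OF sub] by (simp add: Pi_def)
  qed
  then have "carrier U \<subseteq> U.span (gen ` {0..N})" using gens_span by blast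
  then have "U.span (gen ` {0..N}) = carrier U" using U.span_is_subset2[OF G] by blast
  then show ?thesis unfolding U.fin_dim_def using G by blast
qed

end

section \<open>Evaluation in a model of the relations\<close>

locale relation_model = relations N l R + V: k_aou_space V k C f
  for N l :: nat and R :: "real mat" and V :: "'v star_space" and k :: nat
    and C :: "'v mat set" and f :: 'v +
  fixes q :: "nat \<Rightarrow> 'v"
  assumes k_pos: "1 \<le> k" and N_pos: "1 \<le> N"
    and projections: "i \<in> {1..N} \<Longrightarrow> abstract_projection V k C f (q i)"
    and satisfies: "satisfies_relations V N R f q"
    and spanned: "V.span (insert f (q ` {1..N})) = carrier V"
    and dim_eq: "U.dim = V.dim"
begin

definition image_gen :: "nat \<Rightarrow> 'v" where
  "image_gen j = (if j = 0 then f else q j)"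

definition eval :: "complex vec \<Rightarrow> 'v" where
  "eval w = (\<Oplus>\<^bsub>V\<^esub>j\<in>{0..N}. (w $ j) \<odot>\<^bsub>V\<^esub> image_gen j)"

text \<open>The evaluation of a coset at a chosen representative; the choice is immaterial because the relations evaluate
to zero.\<close>

definition quot_eval :: "complex vec set \<Rightarrow> 'v" where
  "quot_eval X = eval (SOME w. w \<in> vecs \<and> X = coset w)"

lemma f_herm: "f \<in> herm V"
proof -
  interpret M: matrix_space V k by unfold_locales
  have h: "tens V (1\<^sub>m k) f \<in> herm (mat_space k V)"
    using V.order_unit by (simp add: archimedean_order_unit_def)
  have "star V (tens V (1\<^sub>m k) f $$ (0, 0)) = tens V (1\<^sub>m k) f $$ (0, 0)"
    using k_pos by (intro M.M_herm_entry[OF h]) auto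
  then have "star V f = f" using k_pos V.unit_closed by simp
  then show ?thesis by (rule V.hermI[OF V.unit_closed])
qed

lemma image_gen_herm: "j \<in> {0..N} \<Longrightarrow> image_gen j \<in> herm V"
  using f_herm projections[of j]
  by (auto simp: image_gen_def abstract_projection_def positive_contraction_def)

lemma image_gen_carrier [simp]: "j \<in> {0..N} \<Longrightarrow> image_gen j \<in> carrier V"
  by (rule V.herm_carrier[OF image_gen_herm])

lemma eval_closed [simp]: "eval w \<in> carrier V"
  unfolding eval_def by (rule V.finsum_closed) auto

lemma eval_add:
  assumes "v \<in> vecs" "w \<in> vecs"
  shows "eval (v + w) = eval v \<oplus>\<^bsub>V\<^esub> eval w"
proof -
  have "eval (v + w) = (\<Oplus>\<^bsub>V\<^esub>j\<in>{0..N}. (v $ j) \<odot>\<^bsub>V\<^esub> image_gen j \<oplus>\<^bsub>V\<^esub> (w $ j) \<odot>\<^bsub>V\<^esub> image_gen j)"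
    unfolding eval_def using assms by (intro V.finsum_cong') (auto simp: V.sm_add_left)
  also have "\<dots> = eval v \<oplus>\<^bsub>V\<^esub> eval w"
    unfolding eval_def by (intro V.finsum_addf) auto
  finally show ?thesis .
qed

lemma eval_smult:
  assumes "w \<in> vecs"
  shows "eval (c \<cdot>\<^sub>v w) = c \<odot>\<^bsub>V\<^esub> eval w"
proof -
  have "eval (c \<cdot>\<^sub>v w) = (\<Oplus>\<^bsub>V\<^esub>j\<in>{0..N}. c \<odot>\<^bsub>V\<^esub> ((w $ j) \<odot>\<^bsub>V\<^esub> image_gen j))"
    unfolding eval_def using assms by (intro V.finsum_cong') (auto simp: V.sm_mult)
  also have "\<dots> = c \<odot>\<^bsub>V\<^esub> eval w"
    unfolding eval_def by (intro V.finsum_sm[symmetric]) auto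
  finally show ?thesis .
qed

lemma eval_conjugate:
  assumes "w \<in> vecs"
  shows "eval (conjugate w) = star V (eval w)"
proof -
  have "star V (eval w) = (\<Oplus>\<^bsub>V\<^esub>j\<in>{0..N}. star V ((w $ j) \<odot>\<^bsub>V\<^esub> image_gen j))"
    unfolding eval_def by (intro V.star_finsum) auto
  also have "\<dots> = eval (conjugate w)"
    unfolding eval_def using assms
    by (intro V.finsum_cong') (auto simp: V.star_smult V.herm_star[OF image_gen_herm])
  finally show ?thesis by simp
qed

lemma eval_unit:
  assumes "j \<le> N"
  shows "eval (unit_vec (Suc N) j) = image_gen j"
proof -
  have "eval (unit_vec (Suc N) j) = (\<Oplus>\<^bsub>V\<^esub>i\<in>{0..N}. if j = i then image_gen i else \<zero>\<^bsub>V\<^esub>)"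
    unfolding eval_def using assms by (intro V.finsum_cong') (auto simp: unit_vec_def)
  also have "\<dots> = image_gen j" using assms by (intro V.finsum_singleton) auto
  finally show ?thesis .
qed

lemma eval_J: "x \<in> J \<Longrightarrow> eval x = \<zero>\<^bsub>V\<^esub>"
proof (erule J_induct)
  fix i assume i: "i < l"
  have "eval (map_vec complex_of_real (row R i))
    = (\<Oplus>\<^bsub>V\<^esub>j\<in>{0..N}. rsmult V (R $$ (i, j)) (if j = 0 then f else q j))"
    unfolding eval_def
  proof (rule V.finsum_cong')
    fix j assume j: "j \<in> {0..N}"
    then show "(map_vec complex_of_real (row R i) $ j) \<odot>\<^bsub>V\<^esub> image_gen j
      = rsmult V (R $$ (i, j)) (if j = 0 then f else q j)"
      using R_carrier i by (auto simp: image_gen_def)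
  next
    show "(\<lambda>j. rsmult V (R $$ (i, j)) (if j = 0 then f else q j)) \<in> {0..N} \<rightarrow> carrier V"
      using image_gen_carrier by (auto simp: image_gen_def)
  qed simp
  also have "\<dots> = \<zero>\<^bsub>V\<^esub>"
    using satisfies i R_carrier unfolding satisfies_relations_def by auto
  finally show "eval (map_vec complex_of_real (row R i)) = \<zero>\<^bsub>V\<^esub>" .
next
  have "eval (0 \<cdot>\<^sub>v 0\<^sub>v (Suc N)) = 0 \<odot>\<^bsub>V\<^esub> eval (0\<^sub>v (Suc N))" by (intro eval_smult) auto
  moreover have "(0 :: complex) \<cdot>\<^sub>v 0\<^sub>v (Suc N) = 0\<^sub>v (Suc N)" by (intro eq_vecI) auto
  ultimately show "eval (0\<^sub>v (Suc N)) = \<zero>\<^bsub>V\<^esub>" by simp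
qed (auto simp: eval_add eval_smult)

lemma quot_eval_coset:
  assumes w: "w \<in> vecs"
  shows "quot_eval (coset w) = eval w"
proof -
  define v where "v = (SOME v. v \<in> vecs \<and> coset w = coset v)"
  have v: "v \<in> vecs \<and> coset w = coset v"
    unfolding v_def by (rule someI[of _ w]) (use w in simp)
  have "v \<in> coset w" using v coset_self[of v] by simp
  then have "v - w \<in> J" by (rule coset_memD(2)[OF w])
  moreover have "v = w + (v - w)" using v w by (intro eq_vecI) auto
  moreover have "v - w \<in> vecs" using v w by auto
  ultimately have "eval v = eval w \<oplus>\<^bsub>V\<^esub> \<zero>\<^bsub>V\<^esub>" using eval_add[OF w, of "v - w"] eval_J[of "v - w"] by metis
  then show ?thesis unfolding quot_eval_def v_def[symmetric] by simp
qed

lemma quot_eval_gen: "j \<le> N \<Longrightarrow> quot_eval (gen j) = image_gen j"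
  unfolding gen_eq by (subst quot_eval_coset) (auto simp: eval_unit)

sublocale gen_space_hom U k N gen V C f quot_eval
proof unfold_locales
  show "1 \<le> k" "1 \<le> N" by (rule k_pos N_pos)+
  show "gen i \<in> herm U" for i by (rule gen_herm)
  show "\<exists>c. v = (\<Oplus>\<^bsub>U\<^esub>g\<in>{0..N}. c g \<odot>\<^bsub>U\<^esub> gen g)" if "v \<in> carrier U" for v
    by (rule gens_span[OF that])
  show "quot_eval v \<in> carrier V" if "v \<in> carrier U" for v
    unfolding quot_eval_def by simp
  show "quot_eval (v \<oplus>\<^bsub>U\<^esub> w) = quot_eval v \<oplus>\<^bsub>V\<^esub> quot_eval w" if "v \<in> carrier U" "w \<in> carrier U" for v w
    using that by (auto simp: U_carrier U_add quot_eval_coset eval_add)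
  show "quot_eval (c \<odot>\<^bsub>U\<^esub> v) = c \<odot>\<^bsub>V\<^esub> quot_eval v" if "v \<in> carrier U" for c v
    using that by (auto simp: U_carrier U_smult quot_eval_coset eval_smult)
  show "quot_eval (star U v) = star V (quot_eval v)" if "v \<in> carrier U" for v
    using that by (auto simp: U_carrier U_star quot_eval_coset eval_conjugate)
  show "quot_eval (gen 0) = f" by (simp add: quot_eval_gen image_gen_def)
  show "abstract_projection V k C f (quot_eval (gen i))" if "i \<in> {1..N}" for i
    using that projections[OF that] by (simp add: quot_eval_gen image_gen_def)
qed

lemma quot_eval_surj: "carrier V \<subseteq> quot_eval ` carrier U"
proof
  fix x assume "x \<in> carrier V"
  then have x: "x \<in> V.span (insert f (q ` {1..N}))" using spanned by simp
  have g: "image_gen j \<in> quot_eval ` carrier U" if "j \<le> N" for j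
    using imageI[OF gen_carrier[of j], of quot_eval] unfolding quot_eval_gen[OF that] .
  show "x \<in> quot_eval ` carrier U"
    using x
  proof (rule V.span_induct_module)
    have "q j \<in> carrier V" if "j \<in> {1..N}" for j
      using image_gen_carrier[of j] that by (auto simp: image_gen_def)
    then show "insert f (q ` {1..N}) \<subseteq> carrier V" using V.unit_closed by blast
    fix y assume "y \<in> insert f (q ` {1..N})"
    then obtain j where "j \<le> N" "y = image_gen j"
    proof (elim insertE imageE)
      assume "y = f"
      then show thesis using that[of 0] by (simp add: image_gen_def)
    next
      fix j assume "y = q j" "j \<in> {1..N}"
      then show thesis using that[of j] by (simp add: image_gen_def)
    qed
    then show "y \<in> quot_eval ` carrier U" using g by simp
  next
    show "\<zero>\<^bsub>V\<^esub> \<in> quot_eval ` carrier U"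
      using imageI[OF U.zero_closed, of quot_eval] unfolding hom_zero .
  next
    fix y z assume "y \<in> quot_eval ` carrier U" "z \<in> quot_eval ` carrier U"
    then obtain v w where vw: "v \<in> carrier U" "w \<in> carrier U" "y = quot_eval v" "z = quot_eval w" by blast
    show "y \<oplus>\<^bsub>V\<^esub> z \<in> quot_eval ` carrier U"
      unfolding vw(3,4) hom_add[OF vw(1,2), symmetric] using vw(1,2) by (intro imageI U.a_closed)
  next
    fix c y assume "y \<in> quot_eval ` carrier U"
    then obtain v where v: "v \<in> carrier U" "y = quot_eval v" by blast
    show "c \<odot>\<^bsub>V\<^esub> y \<in> quot_eval ` carrier U"
      unfolding v(2) hom_sm[OF v(1), symmetric] using v(1) by (intro imageI U.sm_closed)
  qed
qed

lemma quot_eval_inj: "inj_on quot_eval (carrier U)"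
  by (rule surj_imp_inj_if_dim_eq[OF U.star_vector_space_axioms V.star_vector_space_axioms])
    (auto simp: hom_closed hom_add hom_sm U_fin_dim dim_eq intro: quot_eval_surj[THEN subsetD])

end

theorem theorem5p11:
  fixes V :: "'v star_space" and C :: "'v mat set" and f :: 'v and q :: "nat \<Rightarrow> 'v"
    and R :: "real mat" and k l N :: nat
  defines "U \<equiv> univ_space N R"
    and "e \<equiv> univ_gen N R 0"
    and "p \<equiv> univ_gen N R"
  assumes "1 \<le> k" and "1 \<le> N"
    and "R \<in> carrier_mat l (Suc N)"
    and "k_aou_space V k C f"
    and "\<forall>i\<in>{1..N}. abstract_projection V k C f (q i)"
    and "satisfies_relations V N R f q"
    and "LinearCombinations.module.span class_ring V (insert f (q ` {1..N})) = carrier V"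
    and "vectorspace.dim class_ring U = vectorspace.dim class_ring V"
  shows "k_aou_space U k (E_proj U N e p k) e
    \<and> (\<forall>i\<in>{1..N}. proj_cone U k e (E_proj U N e p k) (p i) = E_proj U N e p k
        \<and> abstract_projection U k (E_proj U N e p k) e (p i))"
proof -
  interpret relation_model N l R V k C f q
    using assms unfolding U_def
    by (intro relation_model.intro relations.intro relation_model_axioms.intro) auto
  show ?thesis
    unfolding U_def e_def p_def
    using k_aou_space_E_if_inj[OF quot_eval_inj] proj_cone_E abstract_projection_E by blast
qed

end
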